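(* Let $(\mathcal H,\nabla)/(B,D)$ be a logarithmic F-bundle, where $B$ is the formal neighborhood of a rational point $b$ in a smooth $\Bbbk$-variety. Let $\nabla_b^{\mathrm{fr}}$ be a framing of the restricted F-bundle $(\mathcal H,\nabla)|_b$. Then $\nabla_b^{\mathrm{fr}}$ extends to a framing of $(\mathcal H,\nabla)$ over $B$ if and only if $\nabla_b^{\mathrm{fr}}$ is strong with respect to $D$. In this case, the extension is unique.
   Context: $\Bbbk$ is a field of characteristic $0$. Let $B$ be a smooth formal scheme over $\Bbbk$ with a normal crossing divisor $D\subset B$. A logarithmic F-bundle over $(B,D)$ consists of a vector bundle $\mathcal H$ over $B\times\mathrm{Spf}\,\Bbbk[[u]]$ and a meromorphic flat connection $\nabla$ on $\mathcal H$ (in all directions, including $u$), such that $\nabla_{u^2\partial_u}$ and $\nabla_{u\xi}$ are regular (preserve $\mathcal H$) for every logarithmic tangent vector field $\xi\in TB(-\log D)$. When $B$ is the formal neighborhood of $b$ one writes $B=\mathrm{Spf}\,\Bbbk[[q_1,\dots,q_s,t_1,\dots,t_n]]$ with $b$ given by $q=t=0$ and $D=\{q_1\cdots q_s=0\}$; logarithmic vector fields are generated by the $q_i\partial_{q_i}$ and $\partial_{t_j}$. A framing of a logarithmic F-bundle $(\mathcal H,\nabla)/(B,D)$ is another flat connection $\nabla^{\mathrm{fr}}$ on $\mathcal H$ without poles such that, in the trivializations of $\mathcal H$ given by $\nabla^{\mathrm{fr}}$-flat sections (with $H$ the vector space of flat sections), $\nabla$ has the form $$\nabla_{\partial_u}=\partial_u+u^{-2}\mathbf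 K+u^{-1}\mathbf G,\qquad \nabla_\xi=\xi+u^{-1}\mathbf A(\xi)$$ for all logarithmic vector fields $\xi$ on $B$, where $\mathbf K,\mathbf G$ are $\mathrm{End}(H)$-valued functions on $B$ and $\mathbf A$ is an $\mathrm{End}(H)$-valued (logarithmic) $1$-form on $B$, all independent of $u$. The restriction $(\mathcal H,\nabla)|_b$ is the F-bundle over the point $b$ given by $\mathcal H|_{b\times\mathrm{Spf}\,\Bbbk[[u]]}$ with the restricted connection in the $u$-direction; a framing of it is another connection $\nabla_b^{\mathrm{fr}}$ (in the $u$-direction) on $\mathcal H|_{b\times\mathrm{Spf}\,\Bbbk[[u]]}$ without poles such that, in the trivialization of $\mathcal H|_{b\times\mathrm{Spf}\,\Bbbk[[u]]}$ given by $\nabla_b^{\mathrm{fr}}$-flat sections (with $H$ the vector space of flat sections), the restricted connection has the form $\nabla_{\partial_u}=\partial_u+u^{-2}\mathbf K+u^{-1}\mathbf G$ with $\mathbf K,\mathbf G\in\mathrm{End}(H)$ independent of $u$. A framing of $(\mathcal H,\nabla)$ extends $\nabla_b^{\mathrm{fr}}$ if its restriction to $b\times\mathrm{Spf}\,\Bbbk[[u]]$ is $\nabla_b^{\mathrm{fr}}$. A framing $\nabla_b^{\mathrm{fr}}$ of $(\mathcal H,\nabla)|_b$ is strong with respect to $D$ if for each function $q$ locally defining a component of $D$ (i.e. $q=q_i$, $1\le i\le s$), the endomorphism $\nabla_{uq\partial_q}|_{b\times\mathrm{Spf}\,\Bbbk[[u]]}$ of $\mathcal H|_{b\times\mathrm{Spf}\,\Bbbk[[u]]}$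 is independent of $u$ in a $\nabla_b^{\mathrm{fr}}$-flat trivialization. *)

theory Defs
  imports
    "HOL-Library.Poly_Mapping"
    "HOL-Computational_Algebra.Formal_Laurent_Series"
begin

section \<open>The base\<close>

text \<open>
  The base is \<open>B = Spf R\<close>, where \<open>R\<close> (the whole type \<open>'r\<close>) is a power series ring
  \<open>k[[x_i : i \<in> I]]\<close> in finitely many variables; the closed point \<open>b\<close> is \<open>x = 0\<close>. The isomorphism
  is given by the coefficient function \<open>cf\<close>, and monomials are finitely supported exponent vectors.
  Giving \<open>R\<close> by its coordinates rather than as a type of power series in \<open>'i\<close>-indexed
  variables also covers the case of no variables at all.
\<close>

definition power_series_coords ::
  "'i set \<Rightarrow> ('r::comm_ring_1 \<Rightarrow> ('i \<Rightarrow>\<^sub>0 nat) \<Rightarrow> 'k::field_char_0) \<Rightarrow> bool" where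
  "power_series_coords I cf \<longleftrightarrow>
     finite I \<and> inj cf \<and>
     range cf = {a. \<forall>m. a m \<noteq> 0 \<longrightarrow> Poly_Mapping.keys m \<subseteq> I} \<and>
     cf 1 = (\<lambda>m. if m = 0 then 1 else 0) \<and>
     (\<forall>f g m. cf (f + g) m = cf f m + cf g m) \<and>
     (\<forall>f g m. cf (f * g) m = (\<Sum>(m1, m2)\<in>{(m1, m2). m1 + m2 = m}. cf f m1 * cf g m2))"

definition coord :: "('r \<Rightarrow> ('i \<Rightarrow>\<^sub>0 nat) \<Rightarrow> 'k::field_char_0) \<Rightarrow> 'i \<Rightarrow> 'r" where
  "coord cf i = inv cf (\<lambda>m. if m = Poly_Mapping.single i 1 then 1 else 0)"

definition pderiv_coord ::
  "('r \<Rightarrow> ('i \<Rightarrow>\<^sub>0 nat) \<Rightarrow> 'k::field_char_0) \<Rightarrow> 'i \<Rightarrow> 'r \<Rightarrow> 'r" where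
  "pderiv_coord cf i f =
     inv cf (\<lambda>m. of_nat (Poly_Mapping.lookup m i + 1) * cf f (m + Poly_Mapping.single i 1))"

definition eval_b :: "('r \<Rightarrow> ('i \<Rightarrow>\<^sub>0 nat) \<Rightarrow> 'k) \<Rightarrow> 'r \<Rightarrow> 'k" where
  "eval_b cf f = cf f 0"

text \<open>
  The variables are indexed by \<open>Q \<union> T\<close>: \<open>q_i\<close> for \<open>i \<in> Q\<close> and \<open>t_j\<close> for \<open>j \<in> T\<close>, and
  \<open>D = {\<Prod>i\<in>Q. q_i = 0}\<close>. The following vector fields (\<open>q_i \<partial>/\<partial>q_i\<close> for \<open>i \<in> Q\<close>, \<open>\<partial>/\<partial>t_j\<close> for
  \<open>j \<in> T\<close>) form an \<open>R\<close>-basis of the logarithmic vector fields \<open>TB(-log D)\<close>.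
\<close>

definition log_field ::
  "('r::comm_ring_1 \<Rightarrow> ('i \<Rightarrow>\<^sub>0 nat) \<Rightarrow> 'k::field_char_0) \<Rightarrow> 'i set \<Rightarrow> 'i \<Rightarrow> 'r \<Rightarrow> 'r" where
  "log_field cf Q i f =
     (if i \<in> Q then coord cf i * pderiv_coord cf i f else pderiv_coord cf i f)"

text \<open>
  Functions on \<open>B \<times> Spf k[[u]]\<close> with poles along \<open>u = 0\<close> are the Laurent series \<open>R((u)) = R[[u]][1/u]\<close>,
  with \<open>u\<close> being \<open>fls_X\<close> and \<open>\<partial>/\<partial>u\<close> being \<open>fls_deriv\<close>. Vector fields on \<open>B\<close> and evaluation at \<open>b\<close> act
  on the coefficients (\<open>\<phi> 0 = 0\<close> in all uses).
\<close>

definition fls_map :: "('a::zero \<Rightarrow> 'b::zero) \<Rightarrow> 'a fls \<Rightarrow> 'b fls" where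
  "fls_map \<phi> f = Abs_fls (\<lambda>n. \<phi> (fls_nth f n))"

section \<open>Vector bundles and connections\<close>

text \<open>
  A vector bundle \<open>H\<close> over \<open>Spf A[[u]]\<close> (\<open>A\<close> local, so that it is free of finite rank) is represented
  as a lattice in the \<open>A((u))\<close>-module \<open>H[1/u]\<close> of its meromorphic sections, which is the whole
  type \<open>'v\<close> with scalar multiplication \<open>sc\<close>. The next predicate says that \<open>E\<close> is a basis of \<open>H\<close>
  over \<open>A[[u]]\<close> and of \<open>'v\<close> over \<open>A((u))\<close>.
\<close>

definition bundle_basis ::
  "('a::comm_ring_1 fls \<Rightarrow> 'v::ab_group_add \<Rightarrow> 'v) \<Rightarrow> 'v set \<Rightarrow> 'v set \<Rightarrow> bool" where
  "bundle_basis sc H E \<longleftrightarrow>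
     finite E \<and> \<not> module.dependent sc E \<and> module.span sc E = UNIV \<and>
     H = range (\<lambda>a :: 'v \<Rightarrow> 'a fps. \<Sum>e\<in>E. sc (fps_to_fls (a e)) e)"

definition vector_bundle ::
  "('a::comm_ring_1 fls \<Rightarrow> 'v::ab_group_add \<Rightarrow> 'v) \<Rightarrow> 'v set \<Rightarrow> bool" where
  "vector_bundle sc H \<longleftrightarrow> module sc \<and> (\<exists>E. bundle_basis sc H E)"

definition covariant_derivative ::
  "('a::comm_ring_1 \<Rightarrow> 'v::ab_group_add \<Rightarrow> 'v) \<Rightarrow> ('a \<Rightarrow> 'a) \<Rightarrow> ('v \<Rightarrow> 'v) \<Rightarrow> bool" where
  "covariant_derivative sc \<delta> N \<longleftrightarrow>
     (\<forall>v w. N (v + w) = N v + N w) \<and> (\<forall>f v. N (sc f v) = sc (\<delta> f) v + sc f (N v))"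

section \<open>Logarithmic F-bundles and framings\<close>

text \<open>
  A connection is linear over functions in the vector field, so it is given by its covariant
  derivatives along a frame: here \<open>nu\<close> along \<open>\<partial>/\<partial>u\<close> and \<open>nx i\<close> along \<open>log_field cf Q i\<close>. The
  frame fields commute, so flatness means that the covariant derivatives commute, and
  regularity of \<open>\<nabla>\<close> along \<open>u \<xi>\<close> for all logarithmic \<open>\<xi>\<close> amounts to regularity along the frame.
  Values \<open>nx i\<close> for \<open>i \<notin> Q \<union> T\<close> are irrelevant throughout.
\<close>

definition log_F_bundle ::
  "('r::comm_ring_1 \<Rightarrow> ('i \<Rightarrow>\<^sub>0 nat) \<Rightarrow> 'k::field_char_0) \<Rightarrow> 'i set \<Rightarrow> 'i set \<Rightarrow>
   ('r fls \<Rightarrow> 'v::ab_group_add \<Rightarrow> 'v) \<Rightarrow> 'v set \<Rightarrow> ('v \<Rightarrow> 'v) \<Rightarrow> ('i \<Rightarrow> 'v \<Rightarrow> 'v) \<Rightarrow> bool" where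
  "log_F_bundle cf Q T sc H nu nx \<longleftrightarrow>
     vector_bundle sc H \<and>
     covariant_derivative sc fls_deriv nu \<and>
     (\<forall>i\<in>Q \<union> T. covariant_derivative sc (fls_map (log_field cf Q i)) (nx i)) \<and>
     (\<forall>i\<in>Q \<union> T. \<forall>v. nu (nx i v) = nx i (nu v)) \<and>
     (\<forall>i\<in>Q \<union> T. \<forall>j\<in>Q \<union> T. \<forall>v. nx i (nx j v) = nx j (nx i v)) \<and>
     (\<forall>h\<in>H. sc (fls_X ^ 2) (nu h) \<in> H) \<and>
     (\<forall>i\<in>Q \<union> T. \<forall>h\<in>H. sc fls_X (nx i h) \<in> H)"

text \<open>
  A framing is a flat connection without poles, also along \<open>D\<close>: \<open>fx i\<close> is the covariant derivative
  along \<open>\<partial>/\<partial>x_i\<close>, for \<open>i \<in> Q\<close> as well. A trivialization of \<open>H\<close> by flat sections is a basis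
  \<open>E\<close> of \<open>H\<close> consisting of flat sections; in it, endomorphisms independent of \<open>u\<close> are matrices (indexed
  by \<open>E\<close>) with entries in \<open>R\<close>. Another such basis differs by a constant matrix over \<open>k\<close>, so
  the form of \<open>\<nabla>\<close> below does not depend on the choice of \<open>E\<close>.
\<close>

definition framing ::
  "('r::comm_ring_1 \<Rightarrow> ('i \<Rightarrow>\<^sub>0 nat) \<Rightarrow> 'k::field_char_0) \<Rightarrow> 'i set \<Rightarrow> 'i set \<Rightarrow>
   ('r fls \<Rightarrow> 'v::ab_group_add \<Rightarrow> 'v) \<Rightarrow> 'v set \<Rightarrow> ('v \<Rightarrow> 'v) \<Rightarrow> ('i \<Rightarrow> 'v \<Rightarrow> 'v) \<Rightarrow>
   ('v \<Rightarrow> 'v) \<Rightarrow> ('i \<Rightarrow> 'v \<Rightarrow> 'v) \<Rightarrow> bool" where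
  "framing cf Q T sc H nu nx fu fx \<longleftrightarrow>
     covariant_derivative sc fls_deriv fu \<and>
     (\<forall>i\<in>Q \<union> T. covariant_derivative sc (fls_map (pderiv_coord cf i)) (fx i)) \<and>
     (\<forall>i\<in>Q \<union> T. \<forall>v. fu (fx i v) = fx i (fu v)) \<and>
     (\<forall>i\<in>Q \<union> T. \<forall>j\<in>Q \<union> T. \<forall>v. fx i (fx j v) = fx j (fx i v)) \<and>
     (\<forall>h\<in>H. fu h \<in> H) \<and>
     (\<forall>i\<in>Q \<union> T. \<forall>h\<in>H. fx i h \<in> H) \<and>
     (\<exists>E. bundle_basis sc H E \<and>
        (\<forall>e\<in>E. fu e = 0 \<and> (\<forall>i\<in>Q \<union> T. fx i e = 0)) \<and>
        (\<exists>K G :: 'v \<Rightarrow> 'v \<Rightarrow> 'r. \<forall>e\<in>E.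
           nu e = (\<Sum>e'\<in>E. sc (fls_X_inv ^ 2 * fls_const (K e' e) + fls_X_inv * fls_const (G e' e)) e')) \<and>
        (\<exists>A :: 'i \<Rightarrow> 'v \<Rightarrow> 'v \<Rightarrow> 'r. \<forall>i\<in>Q \<union> T. \<forall>e\<in>E.
           nx i e = (\<Sum>e'\<in>E. sc (fls_X_inv * fls_const (A i e' e)) e')))"

section \<open>Restriction to the point\<close>

text \<open>
  The map \<open>\<rho>\<close> exhibits the \<open>k((u))\<close>-module \<open>'w\<close> as the base change of \<open>'v\<close> along the evaluation
  \<open>R((u)) \<rightarrow> k((u))\<close> at \<open>b\<close>, that is, as the quotient of \<open>'v\<close> by the multiples of the kernel of
  this evaluation. The restricted bundle is then the image \<open>\<rho> ` H\<close>.
\<close>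

definition restriction_map ::
  "('r::comm_ring_1 \<Rightarrow> ('i \<Rightarrow>\<^sub>0 nat) \<Rightarrow> 'k::field_char_0) \<Rightarrow>
   ('r fls \<Rightarrow> 'v::ab_group_add \<Rightarrow> 'v) \<Rightarrow> ('k fls \<Rightarrow> 'w::ab_group_add \<Rightarrow> 'w) \<Rightarrow> ('v \<Rightarrow> 'w) \<Rightarrow> bool" where
  "restriction_map cf sc scb \<rho> \<longleftrightarrow>
     module scb \<and> surj \<rho> \<and>
     (\<forall>v w. \<rho> (v + w) = \<rho> v + \<rho> w) \<and>
     (\<forall>f v. \<rho> (sc f v) = scb (fls_map (eval_b cf) f) (\<rho> v)) \<and>
     (\<forall>v. \<rho> v = 0 \<longleftrightarrow> v \<in> module.span sc {sc f w | f w. fls_map (eval_b cf) f = 0})"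

text \<open>
  The operator induced on the restriction; it exists for covariant derivatives along \<open>\<partial>/\<partial>u\<close> and
  along \<open>q_i \<partial>/\<partial>q_i\<close>, as these derivations preserve the kernel of the evaluation at \<open>b\<close>.
\<close>

definition restrict_op :: "('v \<Rightarrow> 'w) \<Rightarrow> ('v \<Rightarrow> 'v) \<Rightarrow> 'w \<Rightarrow> 'w" where
  "restrict_op \<rho> N = (THE Nb. \<forall>v. Nb (\<rho> v) = \<rho> (N v))"

definition framing_at_b ::
  "('k::field_char_0 fls \<Rightarrow> 'w::ab_group_add \<Rightarrow> 'w) \<Rightarrow> 'w set \<Rightarrow> ('w \<Rightarrow> 'w) \<Rightarrow> ('w \<Rightarrow> 'w) \<Rightarrow> bool" where
  "framing_at_b scb Hb nb fb \<longleftrightarrow>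
     covariant_derivative scb fls_deriv fb \<and>
     (\<forall>h\<in>Hb. fb h \<in> Hb) \<and>
     (\<exists>E. bundle_basis scb Hb E \<and> (\<forall>e\<in>E. fb e = 0) \<and>
        (\<exists>K G :: 'w \<Rightarrow> 'w \<Rightarrow> 'k. \<forall>e\<in>E.
           nb e = (\<Sum>e'\<in>E. scb (fls_X_inv ^ 2 * fls_const (K e' e) + fls_X_inv * fls_const (G e' e)) e')))"

definition extends_framing ::
  "('v \<Rightarrow> 'w) \<Rightarrow> ('v \<Rightarrow> 'v) \<Rightarrow> ('w \<Rightarrow> 'w) \<Rightarrow> bool" where
  "extends_framing \<rho> fu fb \<longleftrightarrow> (\<forall>v. fb (\<rho> v) = \<rho> (fu v))"

definition strong_framing ::
  "'i set \<Rightarrow> ('r::comm_ring_1 fls \<Rightarrow> 'v::ab_group_add \<Rightarrow> 'v) \<Rightarrow> ('i \<Rightarrow> 'v \<Rightarrow> 'v) \<Rightarrow>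
   ('k::field_char_0 fls \<Rightarrow> 'w::ab_group_add \<Rightarrow> 'w) \<Rightarrow> ('v \<Rightarrow> 'w) \<Rightarrow> 'w set \<Rightarrow> ('w \<Rightarrow> 'w) \<Rightarrow> bool" where
  "strong_framing Q sc nx scb \<rho> Hb fb \<longleftrightarrow>
     (\<forall>i\<in>Q. \<exists>E. bundle_basis scb Hb E \<and> (\<forall>e\<in>E. fb e = 0) \<and>
        (\<exists>M :: 'w \<Rightarrow> 'w \<Rightarrow> 'k. \<forall>e\<in>E.
           restrict_op \<rho> (\<lambda>v. sc fls_X (nx i v)) e = (\<Sum>e'\<in>E. scb (fls_const (M e' e)) e')))"

end

theory Submission
  imports Defs "HOL-Library.Function_Algebras"
begin

text \<open>
  Let \<open>\<theta> = \<Sum> x_i \<partial>/\<partial>x_i\<close> be the Euler field, the sum being over all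
  coordinates. The operators \<open>u \<nabla>\<close> along the \<open>x_i \<partial>/\<partial>x_i\<close> and along \<open>\<theta>\<close>, and \<open>u\<^sup>2 \<nabla>\<close> along \<open>\<partial>/\<partial>u\<close>,
  preserve the lattice \<open>H\<close>; they are called \<open>logD i\<close>, \<open>eulerD\<close> and \<open>irrD\<close> below. In a frame of \<open>H\<close> over
  \<open>R[[u]]\<close> they are given by matrices \<open>A_i\<close>, \<open>A = \<Sum> A_i\<close> and \<open>U\<close> over \<open>R[[u]]\<close>. A framing amounts to
  a frame in which the \<open>A_i\<close> do not depend on \<open>u\<close> and \<open>U\<close> is of degree at most \<open>1\<close> in \<open>u\<close>
  (\<open>normal_frame\<close>). At the closed point \<open>A_i\<close> vanishes for each variable that does not define a component of
  \<open>D\<close>. So, in a frame that lifts a flat basis for the given framing at the point, this framing is strong if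
  and only if all \<open>A_i\<close> are independent of \<open>u\<close> at the point; then so is \<open>A\<close>.

  The Euler direction alone determines a framing. On monomials of degree \<open>d\<close> the field \<open>\<theta>\<close> acts as
  multiplication by \<open>d\<close>. In a gauge equation \<open>u \<theta> g + A g = g B\<close>, the coefficient \<open>g_m\<close> of a monomial
  \<open>m\<close> of degree \<open>d > 0\<close> therefore satisfies \<open>(u d + ad M) g_m = B_m + (known terms)\<close>, where \<open>M\<close> is the
  matrix of \<open>A\<close> at the closed point. The key observation is that \<open>M\<close> is nilpotent: flatness in the
  \<open>u\<close>-direction gives \<open>[G, M] = M\<close> at the point, \<open>G\<close> being the \<open>u\<close>-linear part of \<open>U\<close>, and in characteristic \<open>0\<close>
  this forces \<open>M\<close> to be nilpotent. Comparing powers of \<open>u\<close>, the equation becomes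
  \<open>d g_(m,k) + ad M g_(m,k+1) = (known)\<close> for all \<open>k \<ge> 0\<close>, and a nilpotent \<open>ad M\<close> makes this descending recursion
  uniquely solvable; the coefficient of \<open>u^0\<close> then defines \<open>B_m\<close>. This is \<open>normal_form_exists\<close> for existence and
  \<open>euler_equation_unique\<close> for uniqueness.

  For existence, lift a flat basis at the point to a frame of \<open>H\<close> and apply the gauge transformation \<open>g\<close>
  just found, so that \<open>eulerD\<close> becomes independent of \<open>u\<close>. Flatness turns the matrices of \<open>logD i\<close> and
  \<open>irrD\<close> into solutions of linear equations of the same shape along \<open>\<theta>\<close>. Their coefficients of high
  \<open>u\<close>-degree solve the homogeneous equation and vanish at the point, so they vanish
  (\<open>normal_frame_of_constant_euler\<close>).

  For uniqueness, note that the transition matrix between the flat frames of two framings satisfies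
  \<open>u \<theta> g + A g = g A'\<close> and is constant at the point. Hence it has no positive powers of \<open>u\<close>, and then the
  coefficient of \<open>u\<close> in the equation says \<open>\<theta> g = 0\<close>. So \<open>g\<close> is constant and both framings have the same flat
  sections (\<open>normal_frames_transition_constant\<close>).
\<close>

section \<open>Matrices over a finite index set\<close>

text \<open>
  Only the product knows the finite index set of a matrix. Entries outside it never enter, so that
  associativity and distributivity hold without carrier conditions. Rectangular matrices occur as
  transition matrices between frames with unrelated index sets.
\<close>

definition mm :: "'b set \<Rightarrow> ('a \<Rightarrow> 'b \<Rightarrow> 'r::comm_ring_1) \<Rightarrow> ('b \<Rightarrow> 'c \<Rightarrow> 'r) \<Rightarrow> 'a \<Rightarrow> 'c \<Rightarrow> 'r" where
  "mm J P Q = (\<lambda>a c. \<Sum>b\<in>J. P a b * Q b c)"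

lemma mm_assoc: "mm J (mm L P Q) S = mm L P (mm J Q S)"
proof (intro ext)
  fix a d
  have "mm J (mm L P Q) S a d = (\<Sum>c\<in>J. \<Sum>b\<in>L. P a b * (Q b c * S c d))"
    by (simp add: mm_def sum_distrib_right mult.assoc)
  also have "\<dots> = mm L P (mm J Q S) a d"
    by (subst sum.swap) (simp add: mm_def sum_distrib_left)
  finally show "mm J (mm L P Q) S a d = mm L P (mm J Q S) a d" .
qed

lemma mm_cong:
  "(\<And>b. b \<in> J \<Longrightarrow> P a b = P' a b) \<Longrightarrow> (\<And>b. b \<in> J \<Longrightarrow> Q b c = Q' b c) \<Longrightarrow> mm J P Q a c = mm J P' Q' a c"
  by (simp add: mm_def)

definition one_mat :: "'a \<Rightarrow> 'a \<Rightarrow> 'r::comm_ring_1" where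
  "one_mat a b = (if a = b then 1 else 0)"

lemma mm_one_left: "finite J \<Longrightarrow> a \<in> J \<Longrightarrow> mm J one_mat P a c = P a c"
  by (simp add: mm_def one_mat_def if_distrib[of "\<lambda>x. x * _"] sum.delta cong: if_cong)

lemma mm_one_right: "finite J \<Longrightarrow> c \<in> J \<Longrightarrow> mm J P one_mat a c = P a c"
  by (simp add: mm_def one_mat_def if_distrib[of "\<lambda>x. _ * x"] sum.delta' cong: if_cong)

section \<open>Nilpotent matrices and Sylvester operators\<close>

text \<open>
  The powers start at \<open>M\<close>, that is, \<open>mpow J M n\<close> is the \<open>(n+1)\<close>-st power: the identity matrix would be
  an identity for \<open>mm J\<close> on \<open>J\<close> only.
\<close>

primrec mpow :: "'a set \<Rightarrow> ('a \<Rightarrow> 'a \<Rightarrow> 'r::comm_ring_1) \<Rightarrow> nat \<Rightarrow> 'a \<Rightarrow> 'a \<Rightarrow> 'r" where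
  "mpow J M 0 = M"
| "mpow J M (Suc n) = mm J M (mpow J M n)"

definition nilpotent_mat :: "'a set \<Rightarrow> ('a \<Rightarrow> 'a \<Rightarrow> 'r::comm_ring_1) \<Rightarrow> bool" where
  "nilpotent_mat J M \<longleftrightarrow> (\<exists>n. \<forall>a\<in>J. \<forall>b\<in>J. mpow J M n a b = 0)"

lemma mpow_commute: "mm J (mpow J M n) M = mm J M (mpow J M n)"
  by (induction n) (simp_all add: mm_assoc)

lemma mpow_scale: "mpow J (\<lambda>a b. s * M a b) n = (\<lambda>a b. s ^ Suc n * mpow J M n a b)"
  by (induction n) (simp_all add: mm_def fun_eq_iff sum_distrib_left algebra_simps)

lemma nilpotent_mat_scale: "nilpotent_mat J M \<Longrightarrow> nilpotent_mat J (\<lambda>a b. s * M a b)"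
  unfolding nilpotent_mat_def mpow_scale by (metis mult_zero_right)

lemma mpow_cong:
  assumes "\<And>a b. a \<in> J \<Longrightarrow> b \<in> J \<Longrightarrow> M a b = N a b" "a \<in> J" "b \<in> J"
  shows "mpow J M n a b = mpow J N n a b"
  using assms(2,3)
proof (induction n arbitrary: a b)
  case (Suc n)
  show ?case unfolding mpow.simps
    by (rule mm_cong) (use Suc in \<open>simp_all add: assms(1)\<close>)
qed (simp add: assms(1))

lemma nilpotent_mat_cong:
  assumes "\<And>a b. a \<in> J \<Longrightarrow> b \<in> J \<Longrightarrow> M a b = N a b" "nilpotent_mat J M"
  shows "nilpotent_mat J N"
proof -
  obtain n where "\<forall>a\<in>J. \<forall>b\<in>J. mpow J M n a b = 0"
    using assms(2) by (auto simp: nilpotent_mat_def)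
  then have "\<forall>a\<in>J. \<forall>b\<in>J. mpow J N n a b = 0"
    using mpow_cong[of J M N, OF assms(1)] by simp
  then show ?thesis by (auto simp: nilpotent_mat_def)
qed

lemma funpow_mm_left: "(mm J M ^^ Suc n) X = mm J (mpow J M n) X"
  by (induction n) (simp_all add: mm_assoc)

lemma funpow_mm_right: "((\<lambda>X. mm J X M) ^^ Suc n) X = mm J X (mpow J M n)"
proof (induction n)
  case (Suc n)
  have "((\<lambda>X. mm J X M) ^^ Suc (Suc n)) X = mm J (mm J X (mpow J M n)) M"
    using Suc by simp
  then show ?case by (simp add: mm_assoc mpow_commute)
qed simp

lemma nilpotent_mat_left:
  assumes "nilpotent_mat J M"
  shows "\<exists>n. \<forall>X :: 'a \<Rightarrow> 'b \<Rightarrow> 'r::comm_ring_1. (mm J M ^^ n) X = 0"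
proof -
  obtain n where n: "\<forall>a\<in>J. \<forall>b\<in>J. mpow J M n a b = 0"
    using assms by (auto simp: nilpotent_mat_def)
  have "(mm J M ^^ Suc (Suc n)) X = 0" for X :: "'a \<Rightarrow> 'b \<Rightarrow> 'r"
  proof -
    have "(mm J M ^^ Suc (Suc n)) X = mm J M (mm J (mpow J M n) X)"
      using funpow_mm_left[of n J M X] by simp
    also have "\<dots> = 0" using n by (simp add: mm_def fun_eq_iff)
    finally show ?thesis .
  qed
  then show ?thesis by blast
qed

lemma nilpotent_mat_right:
  assumes "nilpotent_mat J M"
  shows "\<exists>n. \<forall>X :: 'b \<Rightarrow> 'a \<Rightarrow> 'r::comm_ring_1. ((\<lambda>X. mm J X M) ^^ n) X = 0"
proof -
  obtain n where n: "\<forall>a\<in>J. \<forall>b\<in>J. mpow J M n a b = 0"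
    using assms by (auto simp: nilpotent_mat_def)
  have "((\<lambda>X. mm J X M) ^^ Suc (Suc n)) X = 0" for X :: "'b \<Rightarrow> 'a \<Rightarrow> 'r"
  proof -
    have "((\<lambda>X. mm J X M) ^^ Suc (Suc n)) X = mm J (mm J X (mpow J M n)) M"
      using funpow_mm_right[of n J M X] by simp
    also have "\<dots> = 0" using n by (simp add: mm_def fun_eq_iff)
    finally show ?thesis .
  qed
  then show ?thesis by blast
qed

lemma funpow_zero_mono:
  fixes f :: "'s::zero \<Rightarrow> 's"
  assumes "\<And>x. (f ^^ n) x = 0" "n \<le> m" shows "(f ^^ m) x = 0"
proof -
  have "(f ^^ m) x = (f ^^ n) ((f ^^ (m - n)) x)"
    using assms(2) by (simp flip: funpow_add comp_apply[of "f ^^ n"])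
  then show ?thesis using assms(1) by simp
qed

text \<open>
  Say that \<open>x\<close> has level \<open>j\<close> if \<open>L^a R^b x = 0\<close> whenever \<open>a + b \<ge> j\<close>. Every element has level
  \<open>2 n\<close>, only \<open>0\<close> has level \<open>0\<close>, and \<open>L - R\<close> lowers the level by one.
\<close>

lemma nilpotent_diff_of_commuting:
  fixes L R :: "'s::ab_group_add \<Rightarrow> 's"
  assumes addL: "\<And>x y. L (x - y) = L x - L y" and addR: "\<And>x y. R (x - y) = R x - R y"
    and comm: "\<And>x. L (R x) = R (L x)"
    and nilL: "\<And>x. (L ^^ n) x = 0" and nilR: "\<And>x. (R ^^ n) x = 0"
  shows "((\<lambda>x. L x - R x) ^^ (2 * n)) x = 0"
proof -
  have L: "(L ^^ a) (x - y) = (L ^^ a) x - (L ^^ a) y" for a x y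
    by (induction a) (simp_all add: addL)
  have R: "(R ^^ a) (x - y) = (R ^^ a) x - (R ^^ a) y" for a x y
    by (induction a) (simp_all add: addR)
  have RL: "(R ^^ b) (L x) = L ((R ^^ b) x)" for b x
    by (induction b) (simp_all add: comm)
  have main: "\<forall>a b. a + b \<ge> j \<longrightarrow> (L ^^ a) ((R ^^ b) x) = 0 \<Longrightarrow> ((\<lambda>x. L x - R x) ^^ j) x = 0" for j x
  proof (induction j arbitrary: x)
    case 0
    from this[rule_format, of 0 0] show ?case by simp
  next
    case (Suc j)
    have "((\<lambda>x. L x - R x) ^^ j) (L x - R x) = 0"
    proof (intro Suc.IH allI impI)
      fix a b :: nat assume ab: "a + b \<ge> j"
      have "(L ^^ a) ((R ^^ b) (L x - R x)) = (L ^^ Suc a) ((R ^^ b) x) - (L ^^ a) ((R ^^ Suc b) x)"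
        by (simp add: R L RL funpow_swap1)
      also have "\<dots> = 0"
        using ab Suc.prems[rule_format, of "Suc a" b] Suc.prems[rule_format, of a "Suc b"] by simp
      finally show "(L ^^ a) ((R ^^ b) (L x - R x)) = 0" .
    qed
    then show ?case by (simp add: funpow_Suc_right del: funpow.simps)
  qed
  have L0: "(L ^^ a) 0 = 0" for a using L[of a 0 0] by simp
  show ?thesis
  proof (intro main allI impI)
    fix a b :: nat assume "2 * n \<le> a + b"
    then consider "n \<le> a" | "n \<le> b" by linarith
    then show "(L ^^ a) ((R ^^ b) x) = 0"
    proof cases
      case 1 then show ?thesis using funpow_zero_mono[where f = L and n = n and m = a, OF nilL] by blast
    next
      case 2
      then have "(R ^^ b) x = 0" using funpow_zero_mono[where f = R and n = n and m = b, OF nilR] by blast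
      then show ?thesis by (simp add: L0)
    qed
  qed
qed

text \<open>
  For \<open>M = M'\<close> and \<open>s = 1\<close> this is the commutator with \<open>M\<close>. The factor \<open>s\<close> absorbs the division by the degree of a
  monomial.
\<close>

definition sylvester_op ::
  "'a set \<Rightarrow> 'b set \<Rightarrow> ('a \<Rightarrow> 'a \<Rightarrow> 'k::comm_ring_1) \<Rightarrow> ('b \<Rightarrow> 'b \<Rightarrow> 'k) \<Rightarrow> 'k \<Rightarrow> ('a \<Rightarrow> 'b \<Rightarrow> 'k) \<Rightarrow> 'a \<Rightarrow> 'b \<Rightarrow> 'k" where
  "sylvester_op J J' M M' s X = (\<lambda>a b. s * (mm J M X a b - mm J' X M' a b))"

lemma sylvester_op_diff:
  "sylvester_op J J' M M' s (X - Y) = sylvester_op J J' M M' s X - sylvester_op J J' M M' s Y"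
  by (simp add: sylvester_op_def mm_def fun_eq_iff algebra_simps sum_subtractf)

lemma sylvester_op_nilpotent:
  fixes M :: "'a \<Rightarrow> 'a \<Rightarrow> 'k::comm_ring_1" and M' :: "'b \<Rightarrow> 'b \<Rightarrow> 'k"
  assumes "nilpotent_mat J M" "nilpotent_mat J' M'"
  shows "\<exists>n. \<forall>X. (sylvester_op J J' M M' s ^^ n) X = 0"
proof -
  define L where "L = (mm J (\<lambda>a b. s * M a b) :: ('a \<Rightarrow> 'b \<Rightarrow> 'k) \<Rightarrow> _)"
  define R where "R = (\<lambda>X :: 'a \<Rightarrow> 'b \<Rightarrow> 'k. mm J' X (\<lambda>a b. s * M' a b))"
  have eq: "sylvester_op J J' M M' s = (\<lambda>X. L X - R X)"
    by (simp add: sylvester_op_def L_def R_def mm_def fun_eq_iff sum_distrib_left right_diff_distrib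
          mult_ac)
  obtain n where n: "\<And>X. (L ^^ n) X = 0"
    using nilpotent_mat_left[OF nilpotent_mat_scale[OF assms(1)]] unfolding L_def by blast
  obtain m where m: "\<And>X. (R ^^ m) X = 0"
    using nilpotent_mat_right[OF nilpotent_mat_scale[OF assms(2)]] unfolding R_def by blast
  have "((\<lambda>X. L X - R X) ^^ (2 * max n m)) X = 0" for X
  proof (rule nilpotent_diff_of_commuting)
    show "(L ^^ max n m) x = 0" for x using funpow_zero_mono[where f = L and n = n and m = "max n m", OF n] by simp
    show "(R ^^ max n m) x = 0" for x using funpow_zero_mono[where f = R and n = m and m = "max n m", OF m] by simp
    show "L (R x) = R (L x)" for x by (simp add: L_def R_def mm_assoc)
  qed (simp_all add: L_def R_def mm_def fun_eq_iff algebra_simps sum_subtractf)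
  then show ?thesis unfolding eq by blast
qed

text \<open>
  The descending recursions of this form come from comparing coefficients of powers of \<open>u\<close>. They have no
  initial value, but substituting the recursion into itself \<open>n\<close> times brings in \<open>N ^^ n\<close>.
\<close>

lemma nilpotent_recursion_unique:
  fixes N :: "'s::zero \<Rightarrow> 's"
  assumes "\<And>x. (N ^^ n) x = 0" and "\<And>k. x k = N (x (Suc k))"
  shows "x k = 0"
proof -
  have "x k = (N ^^ j) (x (k + j))" for j
  proof (induction j)
    case (Suc j)
    then show ?case using assms(2)[of "k + j"] by (simp add: funpow_swap1)
  qed simp
  from this[of n] show ?thesis by (simp add: assms(1))
qed

text \<open>
  The solution is the finite sum \<open>y k = \<Sum>j. N^j (x (k + j))\<close>. It is built by induction on the nilpotency order of
  the data, since \<open>y - x\<close> solves the recursion with data \<open>N (x (Suc k))\<close>.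
\<close>

lemma nilpotent_recursion_solvable:
  fixes N :: "'s::ab_group_add \<Rightarrow> 's"
  assumes nil: "\<And>x. (N ^^ n) x = 0" and diff: "\<And>x y. N (x - y) = N x - N y"
  shows "\<exists>y. \<forall>k. y k = x k + N (y (Suc k))"
proof -
  have add: "N (x + y) = N x + N y" for x y
    using diff[of "x + y" y] by (simp add: algebra_simps)
  have "\<forall>k. (N ^^ n) (x k) = 0 \<Longrightarrow> \<exists>y. \<forall>k. y k = x k + N (y (Suc k))" for x :: "nat \<Rightarrow> 's"
  proof (induction n arbitrary: x)
    case 0
    then show ?case using diff[of 0 0] by (intro exI[of _ "\<lambda>_. 0"]) simp
  next
    case (Suc n)
    obtain y where y: "\<And>k. y k = N (x (Suc k)) + N (y (Suc k))"
      using Suc.IH[of "\<lambda>k. N (x (Suc k))"] Suc.prems by (auto simp: funpow_swap1)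
    show ?case by (rule exI[of _ "\<lambda>k. x k + y k"]) (metis y add)
  qed
  then show ?thesis using nil by blast
qed

subsection \<open>Nilpotency from a commutator relation\<close>

text \<open>
  If \<open>[G, M] = M\<close>, then \<open>ad G\<close> is a derivation that fixes \<open>M\<close>, so the powers of \<open>M\<close> are eigenvectors with distinct
  eigenvalues.
\<close>

lemma commutator_mpow:
  assumes GM: "\<And>a b. a \<in> J \<Longrightarrow> b \<in> J \<Longrightarrow> mm J G M a b - mm J M G a b = M a b"
    and "a \<in> J" "b \<in> J"
  shows "mm J G (mpow J M n) a b - mm J (mpow J M n) G a b = of_nat (Suc n) * mpow J M n a b"
  using assms(2,3)
proof (induction n arbitrary: a b)
  case (Suc n)
  let ?P = "mpow J M n"
  have 1: "mm J G (mm J M ?P) a b = mm J (mm J G M) ?P a b" by (simp add: mm_assoc)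
  also have "\<dots> = mm J (\<lambda>x y. mm J M G x y + M x y) ?P a b"
    using GM Suc.prems by (intro mm_cong) (auto simp: algebra_simps)
  also have "\<dots> = mm J M (mm J G ?P) a b + mm J M ?P a b"
    by (simp flip: mm_assoc) (simp add: mm_def algebra_simps sum.distrib)
  also have "mm J M (mm J G ?P) a b = mm J M (\<lambda>x y. mm J ?P G x y + of_nat (Suc n) * ?P x y) a b"
    using Suc by (intro mm_cong) (auto simp: algebra_simps)
  also have "\<dots> = mm J (mm J M ?P) G a b + of_nat (Suc n) * mm J M ?P a b"
    unfolding mm_assoc by (simp add: mm_def algebra_simps sum.distrib sum_distrib_left)
  finally show ?case by (simp add: algebra_simps)
qed (use GM in simp)

text \<open>
  Eigenvectors for distinct eigenvalues are linearly independent: \<open>T\<close> minus one of the eigenvalues removes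
  one vector from a relation.
\<close>

lemma eigenvector_relation_trivial:
  fixes c :: "'n \<Rightarrow> 'k::field" and T :: "('x \<Rightarrow> 'k) \<Rightarrow> 'x \<Rightarrow> 'k"
  assumes lin: "\<And>F d. finite F \<Longrightarrow> T (\<lambda>x. \<Sum>n\<in>F. d n * v n x) = (\<lambda>x. \<Sum>n\<in>F. d n * T (v n) x)"
    and T0: "T (\<lambda>x. 0) = (\<lambda>x. 0)"
    and eig: "\<And>n. T (v n) = (\<lambda>x. ev n * v n x)" and inj: "inj ev" and nz: "\<And>n. v n \<noteq> (\<lambda>x. 0)"
    and "finite F" "\<And>x. (\<Sum>n\<in>F. c n * v n x) = 0" "n \<in> F"
  shows "c n = 0"
  using assms(6-8)
proof (induction F arbitrary: c n rule: finite_induct)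
  case (insert m F)
  have "(\<Sum>n\<in>insert m F. c n * (ev n - ev m) * v n x) = 0" for x
  proof -
    have "T (\<lambda>x. \<Sum>n\<in>insert m F. c n * v n x) = (\<lambda>x. \<Sum>n\<in>insert m F. c n * (ev n * v n x))"
      using lin[of "insert m F" c] insert.hyps by (simp add: eig)
    then have "(\<Sum>n\<in>insert m F. c n * (ev n * v n x)) = 0"
      using insert.prems(1) T0 by (metis (no_types, lifting) ext)
    moreover have "(\<Sum>n\<in>insert m F. c n * (ev n - ev m) * v n x) =
        (\<Sum>n\<in>insert m F. c n * (ev n * v n x)) - ev m * (\<Sum>n\<in>insert m F. c n * v n x)"
      by (simp only: sum_distrib_left flip: sum_subtractf) (simp add: algebra_simps)
    ultimately show ?thesis using insert.prems(1) by simp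
  qed
  then have rel: "(\<Sum>n\<in>F. c n * (ev n - ev m) * v n x) = 0" for x
    using insert.hyps by simp
  have F: "c j = 0" if "j \<in> F" for j
  proof -
    have "c j * (ev j - ev m) = 0" by (rule insert.IH[OF rel that])
    moreover have "ev j \<noteq> ev m" using inj that insert.hyps by (metis injD)
    ultimately show ?thesis by simp
  qed
  have "c m * v m x = 0" for x
    using insert.prems(1)[of x] insert.hyps F by simp
  then have "c m = 0" using nz[of m] by fastforce
  with F insert.prems(2) show ?case by blast
qed simp

text \<open>
  A space of functions on a finite set has finite dimension; a sequence of functions is therefore linearly
  dependent, even if its members repeat.
\<close>

lemma linear_relation_exists:
  fixes v :: "nat \<Rightarrow> 'x \<Rightarrow> 'k::field"
  assumes "finite X"
  shows "\<exists>F c. finite F \<and> (\<exists>n\<in>F. c n \<noteq> 0) \<and> (\<forall>x\<in>X. (\<Sum>n\<in>F. c n * v n x) = 0)"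
  using assms
proof (induction X arbitrary: v rule: finite_induct)
  case empty
  show ?case by (intro exI[of _ "{0}"] exI[of _ "\<lambda>_. 1"]) simp
next
  case (insert x X)
  show ?case
  proof (cases "\<forall>n. v n x = 0")
    case True
    then show ?thesis using insert.IH[of v] by auto
  next
    case False
    then obtain p where p: "v p x \<noteq> 0" by blast
    \<comment> \<open>Gaussian elimination of the coordinate x with pivot p.\<close>
    define w where "w = (\<lambda>n y. v (Suc p + n) y - v (Suc p + n) x / v p x * v p y)"
    obtain F c where F: "finite F" "\<exists>n\<in>F. c n \<noteq> 0" "\<And>y. y \<in> X \<Longrightarrow> (\<Sum>n\<in>F. c n * w n y) = 0"
      using insert.IH[of w] by blast
    have wx: "w n x = 0" for n using p by (simp add: w_def)
    define s where "s = (\<Sum>n\<in>F. c n * (v (Suc p + n) x / v p x))"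
    define F' where "F' = insert p ((+) (Suc p) ` F)"
    define c' where "c' = (\<lambda>n. if n = p then - s else c (n - Suc p))"
    have "(\<Sum>n\<in>F'. c' n * v n y) = (\<Sum>n\<in>F. c n * w n y)" for y
    proof -
      have "(\<Sum>n\<in>F'. c' n * v n y) = - s * v p y + (\<Sum>n\<in>(+) (Suc p) ` F. c' n * v n y)"
        unfolding F'_def using F(1) by (subst sum.insert) (auto simp: c'_def)
      also have "(\<Sum>n\<in>(+) (Suc p) ` F. c' n * v n y) = (\<Sum>n\<in>F. c n * v (Suc p + n) y)"
        by (subst sum.reindex) (auto simp: c'_def)
      finally show ?thesis
        by (simp add: w_def s_def right_diff_distrib sum_subtractf sum_distrib_right mult.assoc)
    qed
    then have "\<forall>y\<in>insert x X. (\<Sum>n\<in>F'. c' n * v n y) = 0" using F(3) wx by auto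
    moreover have "\<exists>n\<in>F'. c' n \<noteq> 0" using F(2) by (force simp: F'_def c'_def)
    moreover have "finite F'" using F(1) by (simp add: F'_def)
    ultimately show ?thesis by blast
  qed
qed

text \<open>
  Otherwise the powers of \<open>M\<close> would be infinitely many independent eigenvectors of \<open>ad G\<close> in a
  finite-dimensional space. Characteristic \<open>0\<close> keeps the eigenvalues distinct.
\<close>

lemma nilpotent_mat_of_commutator:
  fixes M G :: "'a \<Rightarrow> 'a \<Rightarrow> 'k::field_char_0"
  assumes "finite J"
    and GM: "\<And>a b. a \<in> J \<Longrightarrow> b \<in> J \<Longrightarrow> mm J G M a b - mm J M G a b = M a b"
  shows "nilpotent_mat J M"
proof (rule ccontr)
  assume not_nil: "\<not> nilpotent_mat J M"
  \<comment> \<open>Matrices as functions on pairs, cut off outside the index set to make them determined by their entries.\<close>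
  define v where "v = (\<lambda>n x. if fst x \<in> J \<and> snd x \<in> J then mpow J M n (fst x) (snd x) else 0)"
  define T where "T = (\<lambda>(f :: 'a \<times> 'a \<Rightarrow> 'k) x. if fst x \<in> J \<and> snd x \<in> J then
      mm J G (curry f) (fst x) (snd x) - mm J (curry f) G (fst x) (snd x) else 0)"
  have nz: "v n \<noteq> (\<lambda>x. 0)" for n
  proof
    assume "v n = (\<lambda>x. 0)"
    then have "v n (a, b) = 0" for a b by simp
    then have "\<forall>a\<in>J. \<forall>b\<in>J. mpow J M n a b = 0" unfolding v_def by (metis fst_conv snd_conv)
    with not_nil show False by (auto simp: nilpotent_mat_def)
  qed
  have eig: "T (v n) = (\<lambda>x. of_nat (Suc n) * v n x)" for n
  proof (rule ext, cases)
    fix x :: "'a \<times> 'a" assume x: "fst x \<in> J \<and> snd x \<in> J"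
    have "T (v n) x = mm J G (mpow J M n) (fst x) (snd x) - mm J (mpow J M n) G (fst x) (snd x)"
      using x by (simp add: T_def v_def mm_def)
    also have "\<dots> = of_nat (Suc n) * v n x"
      using commutator_mpow[of J G M, OF GM] x by (simp add: v_def)
    finally show "T (v n) x = of_nat (Suc n) * v n x" .
  next
    fix x :: "'a \<times> 'a" assume "\<not> (fst x \<in> J \<and> snd x \<in> J)"
    then show "T (v n) x = of_nat (Suc n) * v n x" by (auto simp: T_def v_def)
  qed
  have T0: "T (\<lambda>x. 0) = (\<lambda>x. 0)" by (simp add: T_def mm_def fun_eq_iff)
  have lin: "T (\<lambda>x. \<Sum>n\<in>F. d n * v n x) = (\<lambda>x. \<Sum>n\<in>F. d n * T (v n) x)" if "finite F" for F d
    using that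
  proof (induction F rule: finite_induct)
    case empty show ?case using T0 by simp
  next
    case (insert m F)
    have "T (\<lambda>x. f x + c * g x) = (\<lambda>x. T f x + c * T g x)" for f g c
      by (simp add: T_def mm_def fun_eq_iff algebra_simps sum.distrib sum_distrib_left)
    from this[of "\<lambda>x. \<Sum>n\<in>F. d n * v n x" "d m" "v m"] show ?case
      using insert by (simp add: add.commute)
  qed
  obtain F c where F: "finite F" "\<exists>n\<in>F. c n \<noteq> 0" "\<forall>x\<in>J \<times> J. (\<Sum>n\<in>F. c n * v n x) = 0"
    using linear_relation_exists[of "J \<times> J" v] assms(1) by auto
  have rel: "(\<Sum>n\<in>F. c n * v n x) = 0" for x
    using F(3) by (cases "x \<in> J \<times> J") (auto simp: v_def mem_Times_iff intro!: sum.neutral)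
  have inj: "inj (\<lambda>n. of_nat (Suc n) :: 'k)" by (rule injI) (metis Suc_inject of_nat_eq_iff)
  from F(2) show False
    using eigenvector_relation_trivial[where T = T and v = v and ev = "\<lambda>n. of_nat (Suc n)",
      OF lin T0 eig inj nz F(1) rel] by blast
qed


section \<open>Power series in coordinates\<close>

lemma finite_splittings: "finite {(m1, m2). m1 + m2 = (m :: 'i \<Rightarrow>\<^sub>0 nat)}"
proof -
  let ?S = "{n :: 'i \<Rightarrow>\<^sub>0 nat. \<exists>p. n + p = m}"
  let ?F = "{f. \<forall>i. (i \<in> Poly_Mapping.keys m \<longrightarrow> f i \<in> {..Max (range (Poly_Mapping.lookup m))}) \<and>
              (i \<notin> Poly_Mapping.keys m \<longrightarrow> f i = 0)}"
  have fin: "finite (range (Poly_Mapping.lookup m))"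
    by (rule finite_subset[of _ "insert 0 (Poly_Mapping.lookup m ` Poly_Mapping.keys m)"])
      (auto simp: in_keys_iff)
  have "Poly_Mapping.lookup ` ?S \<subseteq> ?F"
  proof clarify
    fix n p :: "'i \<Rightarrow>\<^sub>0 nat" and i assume m: "m = n + p"
    have le: "Poly_Mapping.lookup n i \<le> Poly_Mapping.lookup (n + p) i" by (simp add: lookup_add)
    have "Poly_Mapping.lookup (n + p) i \<le> Max (range (Poly_Mapping.lookup (n + p)))"
      using fin m by (intro Max_ge) auto
    with le show "(i \<in> Poly_Mapping.keys (n + p) \<longrightarrow>
        Poly_Mapping.lookup n i \<in> {..Max (range (Poly_Mapping.lookup (n + p)))}) \<and>
        (i \<notin> Poly_Mapping.keys (n + p) \<longrightarrow> Poly_Mapping.lookup n i = 0)"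
      by (auto simp: in_keys_iff)
  qed
  moreover have "finite ?F" by (rule finite_set_of_finite_funs) auto
  ultimately have "finite (Poly_Mapping.lookup ` ?S)" by (rule finite_subset)
  then have "finite ?S" by (rule finite_imageD) (auto intro!: inj_onI poly_mapping_eqI)
  moreover have "{(m1, m2). m1 + m2 = m} \<subseteq> ?S \<times> ?S" by auto (metis add.commute)
  ultimately show ?thesis by (meson finite_SigmaI finite_subset)
qed

lemma keys_add_nat: "Poly_Mapping.keys (m + n :: 'i \<Rightarrow>\<^sub>0 nat) = Poly_Mapping.keys m \<union> Poly_Mapping.keys n"
  by (auto simp: in_keys_iff lookup_add)

definition fps_map :: "('a \<Rightarrow> 'b) \<Rightarrow> 'a fps \<Rightarrow> 'b fps" where
  "fps_map \<phi> f = Abs_fps (\<lambda>n. \<phi> (fps_nth f n))"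

lemma fps_map_nth [simp]: "fps_nth (fps_map \<phi> f) n = \<phi> (fps_nth f n)"
  by (simp add: fps_map_def)

locale power_series_ring =
  fixes I :: "'i set" and cf :: "'r::comm_ring_1 \<Rightarrow> ('i \<Rightarrow>\<^sub>0 nat) \<Rightarrow> 'k::field_char_0"
  assumes coords: "power_series_coords I cf"
begin

lemma finite_vars: "finite I"
  using coords by (simp add: power_series_coords_def)

lemma cf_add [simp]: "cf (f + g) m = cf f m + cf g m"
  using coords by (simp add: power_series_coords_def)

lemma cf_one: "cf 1 m = (if m = 0 then 1 else 0)"
  using coords by (simp add: power_series_coords_def)

lemma cf_mult: "cf (f * g) m = (\<Sum>(m1, m2)\<in>{(m1, m2). m1 + m2 = m}. cf f m1 * cf g m2)"
  using coords by (simp add: power_series_coords_def)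

lemma cf_eqI: "(\<And>m. cf f m = cf g m) \<Longrightarrow> f = g"
  using coords unfolding power_series_coords_def by (metis injD ext)

lemma cf_inv: "(\<And>m. a m \<noteq> 0 \<Longrightarrow> Poly_Mapping.keys m \<subseteq> I) \<Longrightarrow> cf (inv cf a) m = a m"
proof -
  assume "\<And>m. a m \<noteq> 0 \<Longrightarrow> Poly_Mapping.keys m \<subseteq> I"
  then have "a \<in> range cf" using coords by (auto simp: power_series_coords_def)
  then show ?thesis by (simp add: f_inv_into_f)
qed

lemma cf_outside: "\<not> Poly_Mapping.keys m \<subseteq> I \<Longrightarrow> cf f m = 0"
proof -
  have "cf f \<in> {a. \<forall>m. a m \<noteq> 0 \<longrightarrow> Poly_Mapping.keys m \<subseteq> I}"
    using coords unfolding power_series_coords_def by blast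
  then show "\<not> Poly_Mapping.keys m \<subseteq> I \<Longrightarrow> cf f m = 0" by blast
qed

lemma cf_zero [simp]: "cf 0 m = 0"
  using cf_add[of 0 0 m] by simp

lemma cf_uminus [simp]: "cf (- f) m = - cf f m"
  using cf_add[of f "- f" m] by (simp add: add_eq_0_iff)

lemma cf_diff [simp]: "cf (f - g) m = cf f m - cf g m"
  using cf_add[of f "- g" m] by simp

lemma cf_sum: "cf (sum f A) m = (\<Sum>x\<in>A. cf (f x) m)"
  by (induction A rule: infinite_finite_induct) simp_all

lemma cf_of_int_mult: "cf (of_int m * x) p = of_int m * cf x p"
proof -
  have nat: "cf (of_nat n * x) p = of_nat n * cf x p" for n
    by (induction n) (simp_all add: algebra_simps)
  show ?thesis by (cases m rule: int_cases2) (simp_all add: nat)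
qed

lemma cf_mm:
  "cf (mm J P Q a c) m =
     (\<Sum>(m1, m2)\<in>{(m1, m2). m1 + m2 = m}. mm J (\<lambda>a b. cf (P a b) m1) (\<lambda>a b. cf (Q a b) m2) a c)"
proof -
  have "cf (mm J P Q a c) m =
      (\<Sum>b\<in>J. \<Sum>s\<in>{(m1, m2). m1 + m2 = m}. cf (P a b) (fst s) * cf (Q b c) (snd s))"
    by (simp add: mm_def cf_sum cf_mult case_prod_beta)
  also have "\<dots> = (\<Sum>s\<in>{(m1, m2). m1 + m2 = m}. \<Sum>b\<in>J. cf (P a b) (fst s) * cf (Q b c) (snd s))"
    by (rule sum.swap)
  finally show ?thesis by (simp add: mm_def case_prod_beta)
qed

subsection \<open>The point and the constants\<close>

lemma splittings_zero: "{(m1, m2). m1 + m2 = (0 :: 'i \<Rightarrow>\<^sub>0 nat)} = {(0, 0)}"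
proof -
  have "m1 = 0" if "m1 + m2 = (0 :: 'i \<Rightarrow>\<^sub>0 nat)" for m1 m2
    using keys_add_nat[of m1 m2] that by simp
  then show ?thesis by force
qed

lemma cf_mult_0 [simp]: "cf (f * g) 0 = cf f 0 * cf g 0"
  by (simp add: cf_mult splittings_zero)

lemma cf_one_0 [simp]: "cf 1 0 = 1"
  by (simp add: cf_one)

definition cst :: "'k \<Rightarrow> 'r" where
  "cst c = inv cf (\<lambda>m. if m = 0 then c else 0)"

lemma cf_cst: "cf (cst c) m = (if m = 0 then c else 0)"
  unfolding cst_def by (rule cf_inv) (auto split: if_splits)

lemma cf_cst_0 [simp]: "cf (cst c) 0 = c"
  by (simp add: cf_cst)

lemma cf_cst_mult: "cf (cst c * f) m = c * cf f m"
proof -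
  have "cf (cst c * f) m = (\<Sum>s\<in>{(m1, m2). m1 + m2 = m}. if s = (0, m) then c * cf f m else 0)"
    unfolding cf_mult by (intro sum.cong) (auto simp: cf_cst split: if_splits)
  also have "\<dots> = c * cf f m" by (simp add: finite_splittings)
  finally show ?thesis .
qed

lemma cst_0 [simp]: "cst 0 = 0" and cst_1 [simp]: "cst 1 = 1"
  and cst_add: "cst (c + d) = cst c + cst d" and cst_mult: "cst (c * d) = cst c * cst d"
  by (rule cf_eqI, simp add: cf_cst cf_one cf_cst_mult)+

lemma cst_sum: "cst (sum f A) = (\<Sum>x\<in>A. cst (f x))"
  by (induction A rule: infinite_finite_induct) (simp_all add: cst_add)

subsection \<open>Derivations\<close>

lemma cf_coord: "i \<in> I \<Longrightarrow> cf (coord cf i) m = (if m = Poly_Mapping.single i 1 then 1 else 0)"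
  unfolding coord_def by (rule cf_inv) (auto split: if_splits)

lemma cf_pderiv:
  "i \<in> I \<Longrightarrow> cf (pderiv_coord cf i f) m =
     of_nat (Poly_Mapping.lookup m i + 1) * cf f (m + Poly_Mapping.single i 1)"
  unfolding pderiv_coord_def
  by (rule cf_inv) (metis cf_outside keys_add_nat le_sup_iff mult_zero_right)

lemma cf_coord_mult:
  assumes "i \<in> I"
  shows "cf (coord cf i * f) (m + Poly_Mapping.single i 1) = cf f m"
    and "Poly_Mapping.lookup m i = 0 \<Longrightarrow> cf (coord cf i * f) m = 0"
proof -
  have "cf (coord cf i * f) (m + Poly_Mapping.single i 1) =
    (\<Sum>s\<in>{(m1, m2). m1 + m2 = m + Poly_Mapping.single i 1}.
       if s = (Poly_Mapping.single i 1, m) then cf f m else 0)"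
    unfolding cf_mult by (intro sum.cong) (auto simp: cf_coord[OF assms] add.commute split: if_splits)
  also have "\<dots> = cf f m" by (simp add: finite_splittings add.commute)
  finally show "cf (coord cf i * f) (m + Poly_Mapping.single i 1) = cf f m" .
  assume "Poly_Mapping.lookup m i = 0"
  then show "cf (coord cf i * f) m = 0"
    unfolding cf_mult by (intro sum.neutral) (auto simp: cf_coord[OF assms] lookup_add split: if_splits)
qed

lemma coord_mult_cancel:
  assumes "i \<in> I" "coord cf i * f = coord cf i * g" shows "f = g"
  by (rule cf_eqI) (metis assms cf_coord_mult(1))

text \<open>
  The derivation \<open>x_i \<partial>/\<partial>x_i\<close> is diagonal on monomials. It is used for every coordinate, whether or not the
  coordinate defines a component of \<open>D\<close>.
\<close>

definition theta :: "'i \<Rightarrow> 'r \<Rightarrow> 'r" where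
  "theta i f = coord cf i * pderiv_coord cf i f"

text \<open>
  Multiplying by \<open>x_i\<close> undoes the shift of exponents in the derivative. Exponent \<open>0\<close> is a separate case, because
  there is no monomial to shift from.
\<close>

lemma cf_theta:
  assumes "i \<in> I" shows "cf (theta i f) m = of_nat (Poly_Mapping.lookup m i) * cf f m"
proof (cases "Poly_Mapping.lookup m i = 0")
  case True
  then show ?thesis using assms by (simp add: theta_def cf_coord_mult(2))
next
  case False
  have "m = (m - Poly_Mapping.single i 1) + Poly_Mapping.single i 1"
    using False by (intro poly_mapping_eqI) (auto simp: lookup_add lookup_minus lookup_single when_def)
  then obtain n where n: "m = n + Poly_Mapping.single i 1" by blast
  show ?thesis unfolding n theta_def using assms
    by (simp add: cf_coord_mult(1)[simplified] cf_pderiv lookup_add)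
qed

lemma theta_add: "i \<in> I \<Longrightarrow> theta i (f + g) = theta i f + theta i g"
  by (rule cf_eqI) (simp add: cf_theta algebra_simps)

lemma theta_mult: "i \<in> I \<Longrightarrow> theta i (f * g) = theta i f * g + f * theta i g"
proof (rule cf_eqI)
  fix m assume i: "i \<in> I"
  have "of_nat (Poly_Mapping.lookup m i) * (\<Sum>s\<in>{(m1, m2). m1 + m2 = m}. cf f (fst s) * cf g (snd s)) =
     (\<Sum>s\<in>{(m1, m2). m1 + m2 = m}.
        of_nat (Poly_Mapping.lookup (fst s) i) * cf f (fst s) * cf g (snd s) +
        cf f (fst s) * (of_nat (Poly_Mapping.lookup (snd s) i) * cf g (snd s)))"
    unfolding sum_distrib_left by (intro sum.cong) (auto simp: lookup_add algebra_simps)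
  then show "cf (theta i (f * g)) m = cf (theta i f * g + f * theta i g) m"
    using i by (simp add: cf_theta cf_mult case_prod_beta sum.distrib)
qed

lemma theta_cst [simp]: "i \<in> I \<Longrightarrow> theta i (cst c) = 0"
  by (rule cf_eqI) (simp add: cf_theta cf_cst)

lemma theta_coord: "i \<in> I \<Longrightarrow> j \<in> I \<Longrightarrow> theta i (coord cf j) = (if i = j then coord cf j else 0)"
  by (rule cf_eqI) (auto simp: cf_theta cf_coord lookup_single)

lemma pderiv_add: "i \<in> I \<Longrightarrow> pderiv_coord cf i (f + g) = pderiv_coord cf i f + pderiv_coord cf i g"
  by (rule cf_eqI) (simp add: cf_pderiv algebra_simps)

text \<open>
  The Leibniz rule is clear for \<open>theta i\<close> from its action on monomials, and \<open>x_i\<close> can be cancelled.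
\<close>

lemma pderiv_mult:
  assumes "i \<in> I"
  shows "pderiv_coord cf i (f * g) = pderiv_coord cf i f * g + f * pderiv_coord cf i g"
proof (rule coord_mult_cancel[OF assms])
  show "coord cf i * pderiv_coord cf i (f * g) =
      coord cf i * (pderiv_coord cf i f * g + f * pderiv_coord cf i g)"
    using theta_mult[OF assms, of f g] by (simp add: theta_def algebra_simps)
qed

lemma pderiv_0 [simp]: "i \<in> I \<Longrightarrow> pderiv_coord cf i 0 = 0"
  by (rule cf_eqI) (simp add: cf_pderiv)

lemma pderiv_cst [simp]: "i \<in> I \<Longrightarrow> pderiv_coord cf i (cst c) = 0"
  by (rule coord_mult_cancel[where i = i]) (use theta_cst[of i c] in \<open>simp_all add: theta_def\<close>)

lemma pderiv_commute:
  assumes "i \<in> I" "j \<in> I"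
  shows "pderiv_coord cf i (pderiv_coord cf j f) = pderiv_coord cf j (pderiv_coord cf i f)"
  using assms
  by (intro cf_eqI) (auto simp: cf_pderiv lookup_add lookup_single when_def add_ac)

lemma pderiv_coord_other:
  assumes "i \<in> I" "j \<in> I" "i \<noteq> j"
  shows "pderiv_coord cf i (coord cf j) = 0"
  by (rule coord_mult_cancel[OF assms(1)])
    (use theta_coord[of i j] assms in \<open>simp add: theta_def\<close>)

definition euler :: "'r \<Rightarrow> 'r" where
  "euler f = (\<Sum>i\<in>I. theta i f)"

definition total_degree :: "('i \<Rightarrow>\<^sub>0 nat) \<Rightarrow> nat" where
  "total_degree m = (\<Sum>i\<in>I. Poly_Mapping.lookup m i)"

lemma cf_euler: "cf (euler f) m = of_nat (total_degree m) * cf f m"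
  by (simp add: euler_def total_degree_def cf_sum cf_theta sum_distrib_right)

lemma total_degree_0 [simp]: "total_degree 0 = 0"
  by (simp add: total_degree_def)

lemma total_degree_add: "total_degree (m + n) = total_degree m + total_degree n"
  by (simp add: total_degree_def lookup_add sum.distrib)

lemma total_degree_pos:
  assumes "Poly_Mapping.keys m \<subseteq> I" "m \<noteq> 0" shows "total_degree m > 0"
proof -
  obtain i where "i \<in> Poly_Mapping.keys m" using assms(2) keys_eq_empty by blast
  then have "Poly_Mapping.lookup m i > 0" "i \<in> I" using assms(1) by (auto simp: in_keys_iff)
  then show ?thesis unfolding total_degree_def using finite_vars by (meson sum_pos2 zero_le)
qed

lemma total_degree_less:
  assumes "Poly_Mapping.keys m \<subseteq> I" "m1 + m2 = m"
  shows "m1 \<noteq> 0 \<Longrightarrow> total_degree m2 < total_degree m" "m2 \<noteq> 0 \<Longrightarrow> total_degree m1 < total_degree m"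
  using assms total_degree_add[of m1 m2] total_degree_pos[of m1] total_degree_pos[of m2] keys_add_nat[of m1 m2] by auto

lemma euler_zero_imp_cst:
  assumes "euler f = 0" shows "f = cst (cf f 0)"
proof (rule cf_eqI)
  fix m
  show "cf f m = cf (cst (cf f 0)) m"
  proof (cases "Poly_Mapping.keys m \<subseteq> I \<and> m \<noteq> 0")
    case True
    then have "of_nat (total_degree m) \<noteq> (0::'k)" using total_degree_pos[of m] by simp
    moreover have "of_nat (total_degree m) * cf f m = 0" using cf_euler[of f m] assms by simp
    ultimately show ?thesis using True by (simp add: cf_cst)
  next
    case False
    then show ?thesis using cf_outside by (auto simp: cf_cst)
  qed
qed

section \<open>Equations along the Euler field\<close>

text \<open>
  \<open>X k\<close> is thought of as the coefficient of \<open>u^k\<close>, so that the hypothesis is the equation \<open>u \<theta> X + A X - X A' = 0\<close>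
  in all positive degrees in \<open>u\<close>. By induction on the degree of a monomial \<open>m\<close>, only the value of \<open>A\<close> and \<open>A'\<close> at the
  point contributes to its coefficient, which leaves the descending recursion
  \<open>deg m X_(m,k) = - (M X_(m,k+1) - X_(m,k+1) M')\<close> with a nilpotent right-hand side. The lemma is applied to tails
  of sequences to bound degrees in \<open>u\<close>.
\<close>

lemma euler_equation_unique:
  fixes A :: "'a \<Rightarrow> 'a \<Rightarrow> 'r" and A' :: "'b \<Rightarrow> 'b \<Rightarrow> 'r" and X :: "nat \<Rightarrow> 'a \<Rightarrow> 'b \<Rightarrow> 'r"
  assumes nil: "nilpotent_mat J (\<lambda>a b. cf (A a b) 0)" "nilpotent_mat J' (\<lambda>a b. cf (A' a b) 0)"
    and eq: "\<And>k a b. a \<in> J \<Longrightarrow> b \<in> J' \<Longrightarrow>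
      euler (X k a b) + mm J A (X (Suc k)) a b - mm J' (X (Suc k)) A' a b = 0"
    and X0: "\<And>k a b. a \<in> J \<Longrightarrow> b \<in> J' \<Longrightarrow> cf (X k a b) 0 = 0"
    and "a \<in> J" "b \<in> J'"
  shows "X k a b = 0"
proof -
  have "\<forall>k. \<forall>a\<in>J. \<forall>b\<in>J'. cf (X k a b) m = 0" for m
  proof (induction m rule: measure_induct_rule[of total_degree])
    case (less m)
    show ?case
    proof (cases "Poly_Mapping.keys m \<subseteq> I \<and> m \<noteq> 0")
      case False
      then show ?thesis using X0 cf_outside by blast
    next
      case True
      \<comment> \<open>The cut-off makes the recursion below an equation of functions on all pairs of indices.\<close>
      define M where "M = (\<lambda>a b. if a \<in> J \<and> b \<in> J then cf (A a b) 0 else 0)"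
      define M' where "M' = (\<lambda>a b. if a \<in> J' \<and> b \<in> J' then cf (A' a b) 0 else 0)"
      have nilM: "nilpotent_mat J M" "nilpotent_mat J' M'"
        using nil by (auto simp: M_def M'_def elim!: nilpotent_mat_cong[rotated])
      define x where "x = (\<lambda>k a b. if a \<in> J \<and> b \<in> J' then cf (X k a b) m else 0)"
      have d0: "of_nat (total_degree m) \<noteq> (0::'k)" using total_degree_pos[of m] True by simp
      have M: "cf (mm J A (X k) a b) m = mm J M (x k) a b" if "a \<in> J" "b \<in> J'" for a b k
      proof -
        have "cf (mm J A (X k) a b) m = (\<Sum>s\<in>{(m1, m2). m1 + m2 = m}. if s = (0, m) then mm J M (x k) a b else 0)"
          unfolding cf_mm
        proof (intro sum.cong refl, clarify)
          fix m1 m2 assume m: "m = m1 + m2"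
          show "mm J (\<lambda>a b. cf (A a b) m1) (\<lambda>a b. cf (X k a b) m2) a b =
             (if (m1, m2) = (0, m1 + m2) then mm J M (x k) a b else 0)"
          proof (cases "m1 = 0")
            case True
            then have "m2 = m" using m by simp
            with True show ?thesis using that by (simp add: M_def x_def mm_def)
          next
            case False
            then have "total_degree m2 < total_degree m" using total_degree_less(1)[OF conjunct1[OF True] m[symmetric] False] by simp
            then have "cf (X k c b) m2 = 0" if "c \<in> J" for c
              using less.IH \<open>b \<in> J'\<close> that by blast
            then show ?thesis using False by (simp add: mm_def)
          qed
        qed
        also have "\<dots> = mm J M (x k) a b" by (simp add: finite_splittings)
        finally show ?thesis .
      qed
      have M': "cf (mm J' (X k) A' a b) m = mm J' (x k) M' a b" if "a \<in> J" "b \<in> J'" for a b k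
      proof -
        have "cf (mm J' (X k) A' a b) m = (\<Sum>s\<in>{(m1, m2). m1 + m2 = m}. if s = (m, 0) then mm J' (x k) M' a b else 0)"
          unfolding cf_mm
        proof (intro sum.cong refl, clarify)
          fix m1 m2 assume m: "m = m1 + m2"
          show "mm J' (\<lambda>a b. cf (X k a b) m1) (\<lambda>a b. cf (A' a b) m2) a b =
             (if (m1, m2) = (m1 + m2, 0) then mm J' (x k) M' a b else 0)"
          proof (cases "m2 = 0")
            case True
            then have "m1 = m" using m by simp
            with True show ?thesis using that by (simp add: M'_def x_def mm_def)
          next
            case False
            then have "total_degree m1 < total_degree m" using total_degree_less(2)[OF conjunct1[OF True] m[symmetric] False] by simp
            then have "cf (X k a c) m1 = 0" if "c \<in> J'" for c
              using less.IH \<open>a \<in> J\<close> that by blast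
            then show ?thesis using False by (simp add: mm_def)
          qed
        qed
        also have "\<dots> = mm J' (x k) M' a b" by (simp add: finite_splittings)
        finally show ?thesis .
      qed
      have rec: "x k = sylvester_op J J' M M' (- 1 / of_nat (total_degree m)) (x (Suc k))" for k
      proof (intro ext)
        fix a b
        show "x k a b = sylvester_op J J' M M' (- 1 / of_nat (total_degree m)) (x (Suc k)) a b"
        proof (cases "a \<in> J \<and> b \<in> J'")
          case True
          have "of_nat (total_degree m) * x k a b + mm J M (x (Suc k)) a b - mm J' (x (Suc k)) M' a b = 0"
            using arg_cong[OF eq[of a b k], of "\<lambda>f. cf f m"] True
            by (simp add: cf_euler M M') (simp add: x_def)
          then have "x k a b = - (mm J M (x (Suc k)) a b - mm J' (x (Suc k)) M' a b) / of_nat (total_degree m)"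
            using d0 by (simp add: field_simps)
          then show ?thesis by (simp add: sylvester_op_def diff_divide_distrib)
        next
          case False
          then show ?thesis
            by (auto simp: x_def sylvester_op_def mm_def M_def M'_def intro!: sum.neutral)
        qed
      qed
      obtain n where "\<forall>X. (sylvester_op J J' M M' (- 1 / of_nat (total_degree m)) ^^ n) X = 0"
        using sylvester_op_nilpotent nilM by blast
      then have "x k = 0" for k using nilpotent_recursion_unique[of n _ x] rec by blast
      then have x0: "x k a b = 0" for k a b by simp
      show ?thesis
      proof (intro allI ballI)
        fix k a b assume "a \<in> J" "b \<in> J'"
        with x0[of k a b] show "cf (X k a b) m = 0" by (simp add: x_def)
      qed
    qed
  qed
  then show ?thesis using assms(5,6) by (intro cf_eqI) simp
qed

end


lemma fps_mult_nth_mm: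
  "fps_nth (mm J P Q a c) k =
     (\<Sum>i=0..k. mm J (\<lambda>a b. fps_nth (P a b) i) (\<lambda>a b. fps_nth (Q a b) (k - i)) a c)"
proof -
  have "fps_nth (mm J P Q a c) k = (\<Sum>b\<in>J. \<Sum>i=0..k. fps_nth (P a b) i * fps_nth (Q b c) (k - i))"
    by (simp add: mm_def fps_sum_nth fps_mult_nth)
  also have "\<dots> = (\<Sum>i=0..k. \<Sum>b\<in>J. fps_nth (P a b) i * fps_nth (Q b c) (k - i))"
    by (rule sum.swap)
  finally show ?thesis by (simp add: mm_def)
qed

lemma fps_nth_mm_const_left:
  "fps_nth (mm J (\<lambda>a b. fps_const (A a b)) Q a c) k = mm J A (\<lambda>a b. fps_nth (Q a b) k) a c"
  by (simp add: mm_def fps_sum_nth)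

lemma fps_nth_mm_const_right:
  "fps_nth (mm J Q (\<lambda>a b. fps_const (A a b)) a c) k = mm J (\<lambda>a b. fps_nth (Q a b) k) A a c"
  by (simp add: mm_def fps_sum_nth)

context power_series_ring
begin

lemma ex_fps_cf:
  assumes "\<And>m k. c m k \<noteq> 0 \<Longrightarrow> Poly_Mapping.keys m \<subseteq> I"
  shows "\<exists>f. \<forall>m k. cf (fps_nth f k) m = c m k"
  by (rule exI[of _ "Abs_fps (\<lambda>k. inv cf (\<lambda>m. c m k))"]) (simp add: cf_inv assms)

lemma cf_fps_nth_mm:
  "cf (fps_nth (mm J P Q a c) k) m =
     (\<Sum>(m1, m2)\<in>{(m1, m2). m1 + m2 = m}. \<Sum>i=0..k.
        mm J (\<lambda>a b. cf (fps_nth (P a b) i) m1) (\<lambda>a b. cf (fps_nth (Q a b) (k - i)) m2) a c)"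
proof -
  have "cf (fps_nth (mm J P Q a c) k) m =
      (\<Sum>i=0..k. \<Sum>s\<in>{(m1, m2). m1 + m2 = m}.
        mm J (\<lambda>a b. cf (fps_nth (P a b) i) (fst s)) (\<lambda>a b. cf (fps_nth (Q a b) (k - i)) (snd s)) a c)"
    by (simp add: fps_mult_nth_mm cf_sum cf_mm case_prod_beta)
  also have "\<dots> = (\<Sum>s\<in>{(m1, m2). m1 + m2 = m}. \<Sum>i=0..k.
        mm J (\<lambda>a b. cf (fps_nth (P a b) i) (fst s)) (\<lambda>a b. cf (fps_nth (Q a b) (k - i)) (snd s)) a c)"
    by (rule sum.swap)
  finally show ?thesis by (simp add: case_prod_beta)
qed

text \<open>
  \<open>P f m\<close> stands for the equation at the monomial \<open>m\<close>. An equation between products of power series only sees values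
  at the parts of splittings of \<open>m\<close>, and a part other than \<open>m\<close> itself has smaller degree. So the unknown coefficient at
  \<open>m\<close> can be chosen once those of smaller degree are known. The default \<open>z\<close> at monomials in foreign variables makes
  the result a power series.
\<close>

lemma monomial_recursion:
  fixes P :: "(('i \<Rightarrow>\<^sub>0 nat) \<Rightarrow> 'y) \<Rightarrow> ('i \<Rightarrow>\<^sub>0 nat) \<Rightarrow> bool"
  assumes local: "\<And>f g m. Poly_Mapping.keys m \<subseteq> I \<Longrightarrow>
      (\<And>m1 m2. m1 + m2 = m \<Longrightarrow> f m1 = g m1 \<and> f m2 = g m2) \<Longrightarrow> P f m \<Longrightarrow> P g m"
    and step: "\<And>f m. Poly_Mapping.keys m \<subseteq> I \<Longrightarrow>
      (\<And>n. Poly_Mapping.keys n \<subseteq> I \<Longrightarrow> total_degree n < total_degree m \<Longrightarrow> P f n) \<Longrightarrow> \<exists>r. P (f(m := r)) m"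
  shows "\<exists>f. (\<forall>m. Poly_Mapping.keys m \<subseteq> I \<longrightarrow> P f m) \<and> (\<forall>m. \<not> Poly_Mapping.keys m \<subseteq> I \<longrightarrow> f m = z)"
proof -
  define R where "R = (\<lambda>f m r. if Poly_Mapping.keys m \<subseteq> I then P (f(m := r)) m else r = z)"
  have loc: "P (f(m := r)) m \<longleftrightarrow> P (g(m := r)) m"
    if eq: "\<And>n. (n, m) \<in> measure total_degree \<Longrightarrow> f n = g n" and m: "Poly_Mapping.keys m \<subseteq> I" for f g m r
  proof -
    have "(f(m := r)) m1 = (g(m := r)) m1 \<and> (f(m := r)) m2 = (g(m := r)) m2" if "m1 + m2 = m" for m1 m2
    proof -
      have "m1 = m \<or> total_degree m1 < total_degree m" "m2 = m \<or> total_degree m2 < total_degree m"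
        using total_degree_less[OF m that] that by fastforce+
      then show ?thesis using eq by auto
    qed
    then show ?thesis
      using local[OF m, of "f(m := r)" "g(m := r)"] local[OF m, of "g(m := r)" "f(m := r)"] by metis
  qed
  have "\<exists>f. \<forall>m. R f m (f m)"
  proof (rule dependent_wf_choice[of "measure total_degree"])
    show "R f m r = R g m r" if "\<And>n. (n, m) \<in> measure total_degree \<Longrightarrow> f n = g n" for f g m r
      using loc[OF that] by (simp add: R_def)
    show "\<exists>r. R f m r" if "\<And>n. (n, m) \<in> measure total_degree \<Longrightarrow> R f n (f n)" for f m
    proof (cases "Poly_Mapping.keys m \<subseteq> I")
      case True
      have "P f n" if "Poly_Mapping.keys n \<subseteq> I" "total_degree n < total_degree m" for n
        using \<open>\<And>n. (n, m) \<in> measure total_degree \<Longrightarrow> R f n (f n)\<close>[of n] that by (simp add: R_def)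
      from step[OF True this] show ?thesis using True by (simp add: R_def)
    qed (simp add: R_def)
  qed simp
  then obtain f where f: "\<And>m. R f m (f m)" by blast
  have "P f m" if "Poly_Mapping.keys m \<subseteq> I" for m
    using f[of m] that by (simp add: R_def)
  moreover have "f m = z" if "\<not> Poly_Mapping.keys m \<subseteq> I" for m
    using f[of m] that by (simp add: R_def)
  ultimately show ?thesis by blast
qed

text \<open>
  In a recursion the unknown coefficient occurs in the two extreme splittings only.
\<close>

lemma sum_splittings_ends:
  assumes "m \<noteq> 0"
  shows "(\<Sum>s\<in>{(m1, m2). m1 + m2 = (m :: 'i \<Rightarrow>\<^sub>0 nat)}. h s) =
    h (0, m) + h (m, 0) + (\<Sum>s\<in>{(m1, m2). m1 + m2 = m \<and> m1 \<noteq> 0 \<and> m2 \<noteq> 0}. h s)"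
proof -
  have "{(m1, m2). m1 + m2 = m} =
      insert (0, m) (insert (m, 0) {(m1, m2). m1 + m2 = m \<and> m1 \<noteq> 0 \<and> m2 \<noteq> 0})"
    by (auto simp: algebra_simps)
  moreover have "finite {(m1, m2). m1 + m2 = m \<and> m1 \<noteq> 0 \<and> m2 \<noteq> 0}"
    by (rule finite_subset[OF _ finite_splittings[of m]]) auto
  ultimately show ?thesis using assms by (simp add: add.assoc)
qed

text \<open>
  The equation for \<open>Q P = 1\<close> at a monomial \<open>m \<noteq> 0\<close> expresses the coefficient of \<open>Q\<close> at \<open>m\<close> by those of lower degree,
  because \<open>P\<close> is the identity matrix at the closed point.
\<close>

lemma left_inverse_exists:
  fixes P :: "'a \<Rightarrow> 'a \<Rightarrow> 'r fps"
  assumes "finite J"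
    and P0: "\<And>a b k. a \<in> J \<Longrightarrow> b \<in> J \<Longrightarrow> cf (fps_nth (P a b) k) 0 = (if a = b \<and> k = 0 then 1 else 0)"
  shows "\<exists>Q. \<forall>a\<in>J. \<forall>b\<in>J. mm J Q P a b = one_mat a b"
proof -
  define p where "p = (\<lambda>m k a b. cf (fps_nth (P a b) k) m)"
  define S where "S = (\<lambda>(q :: ('i \<Rightarrow>\<^sub>0 nat) \<Rightarrow> nat \<Rightarrow> 'a \<Rightarrow> 'a \<Rightarrow> 'k) m k a b.
     \<Sum>s\<in>{(m1, m2). m1 + m2 = m}. \<Sum>i=0..k. mm J (q (fst s) i) (p (snd s) (k - i)) a b)"
  define E where "E = (\<lambda>q m. \<forall>k. \<forall>a\<in>J. \<forall>b\<in>J. S q m k a b = (if m = 0 \<and> k = 0 \<and> a = b then 1 else 0))"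
  have p0: "mm J y (p 0 k) a b = (if k = 0 then y a b else 0)"
    if "b \<in> J" for y a b k
  proof (cases "k = 0")
    case True
    have "mm J y (p 0 0) a b = mm J y one_mat a b"
      using P0 that by (intro mm_cong) (auto simp: p_def one_mat_def)
    then show ?thesis using True that assms(1) by (simp add: mm_one_right)
  qed (use P0 that in \<open>simp add: mm_def p_def\<close>)
  have end_term: "(\<Sum>i=0..k. mm J (y i) (p 0 (k - i)) a b) = y k a b" if "b \<in> J" for y k a b
  proof -
    have "(\<Sum>i=0..k. mm J (y i) (p 0 (k - i)) a b) = (\<Sum>i=0..k. if i = k then y k a b else 0)"
      using that by (intro sum.cong) (auto simp: p0)
    then show ?thesis by simp
  qed
  have "\<exists>q. (\<forall>m. Poly_Mapping.keys m \<subseteq> I \<longrightarrow> E q m) \<and> (\<forall>m. \<not> Poly_Mapping.keys m \<subseteq> I \<longrightarrow> q m = (\<lambda>_ _ _. 0))"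
  proof (rule monomial_recursion)
    fix f g m assume "\<And>m1 m2. m1 + m2 = m \<Longrightarrow> f m1 = g m1 \<and> f m2 = g m2" "E f m"
    moreover from this(1) have "S f m = S g m"
      unfolding S_def by (intro ext sum.cong refl) auto
    ultimately show "E g m" by (simp add: E_def)
  next
    fix f m
    show "\<exists>r. E (f(m := r)) m"
    proof (cases "m = 0")
      case True
      have "E (f(m := \<lambda>k a b. if k = 0 \<and> a = b then 1 else 0)) m"
        unfolding E_def S_def True splittings_zero by (auto simp: end_term)
      then show ?thesis by blast
    next
      case False
      define r where "r = (\<lambda>k a b. - ((\<Sum>i=0..k. mm J (f 0 i) (p m (k - i)) a b) +
         (\<Sum>s\<in>{(m1, m2). m1 + m2 = m \<and> m1 \<noteq> 0 \<and> m2 \<noteq> 0}. \<Sum>i=0..k. mm J (f (fst s) i) (p (snd s) (k - i)) a b)))"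
      have rest: "(\<Sum>s\<in>{(m1, m2). m1 + m2 = m \<and> m1 \<noteq> 0 \<and> m2 \<noteq> 0}. \<Sum>i=0..k. mm J ((f(m := r)) (fst s) i) (p (snd s) (k - i)) a b)
        = (\<Sum>s\<in>{(m1, m2). m1 + m2 = m \<and> m1 \<noteq> 0 \<and> m2 \<noteq> 0}. \<Sum>i=0..k. mm J (f (fst s) i) (p (snd s) (k - i)) a b)" for k a b
        by (intro sum.cong) auto
      have "E (f(m := r)) m"
        unfolding E_def S_def sum_splittings_ends[OF False] rest
        using False by (auto simp: end_term) (simp add: r_def)
      then show ?thesis by blast
    qed
  qed
  then obtain q where q: "\<And>m. Poly_Mapping.keys m \<subseteq> I \<Longrightarrow> E q m"
    and q0: "\<And>m. \<not> Poly_Mapping.keys m \<subseteq> I \<Longrightarrow> q m = (\<lambda>_ _ _. 0)" by blast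
  have "\<exists>f. \<forall>m k. cf (fps_nth f k) m = q m k a b" for a b
    by (rule ex_fps_cf) (metis q0)
  then obtain Q where Q: "\<And>a b m k. cf (fps_nth (Q a b) k) m = q m k a b" by metis
  have "mm J Q P a b = one_mat a b" if "a \<in> J" "b \<in> J" for a b
  proof (intro fps_ext cf_eqI)
    fix k m
    show "cf (fps_nth (mm J Q P a b) k) m = cf (fps_nth (one_mat a b) k) m"
    proof (cases "Poly_Mapping.keys m \<subseteq> I")
      case True
      have "cf (fps_nth (mm J Q P a b) k) m = S q m k a b"
        by (simp add: cf_fps_nth_mm S_def Q p_def case_prod_beta)
      also have "\<dots> = (if m = 0 \<and> k = 0 \<and> a = b then 1 else 0)"
        using q[OF True] that by (simp add: E_def)
      finally show ?thesis by (simp add: one_mat_def cf_one)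
    qed (simp add: cf_outside)
  qed
  then show ?thesis by blast
qed

text \<open>
  The transpose of a left inverse of the transpose is a right inverse, and a left and a right inverse agree.
\<close>

lemma inverse_exists:
  fixes P :: "'a \<Rightarrow> 'a \<Rightarrow> 'r fps"
  assumes fin: "finite J"
    and P0: "\<And>a b k. a \<in> J \<Longrightarrow> b \<in> J \<Longrightarrow> cf (fps_nth (P a b) k) 0 = (if a = b \<and> k = 0 then 1 else 0)"
  shows "\<exists>Q. \<forall>a\<in>J. \<forall>b\<in>J. mm J Q P a b = one_mat a b \<and> mm J P Q a b = one_mat a b"
proof -
  obtain Q where Q: "\<And>a b. a \<in> J \<Longrightarrow> b \<in> J \<Longrightarrow> mm J Q P a b = one_mat a b"
    using left_inverse_exists[of J P, OF fin P0] by blast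
  obtain S where S: "\<And>a b. a \<in> J \<Longrightarrow> b \<in> J \<Longrightarrow> mm J S (\<lambda>a b. P b a) a b = one_mat a b"
  proof -
    have "\<exists>S. \<forall>a\<in>J. \<forall>b\<in>J. mm J S (\<lambda>a b. P b a) a b = one_mat a b"
      by (rule left_inverse_exists[OF fin]) (auto simp: P0)
    then show ?thesis using that by blast
  qed
  define S' where "S' = (\<lambda>a b. S b a)"
  have S': "mm J P S' a b = one_mat a b" if "a \<in> J" "b \<in> J" for a b
    using S[OF that(2,1)] by (simp add: mm_def S'_def mult.commute one_mat_def eq_commute)
  have "Q a b = S' a b" if "a \<in> J" "b \<in> J" for a b
  proof -
    have "Q a b = mm J Q (mm J P S') a b"
      using fin that S' by (subst mm_cong[where Q' = one_mat]) (auto simp: mm_one_right)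
    also have "\<dots> = mm J (mm J Q P) S' a b" by (simp add: mm_assoc)
    also have "\<dots> = S' a b"
      using fin that Q by (subst mm_cong[where P' = one_mat]) (auto simp: mm_one_left)
    finally show ?thesis .
  qed
  then have "mm J P Q a b = one_mat a b" if "a \<in> J" "b \<in> J" for a b
    using S' that by (subst mm_cong[where Q' = S']) auto
  with Q show ?thesis by blast
qed

text \<open>
  At the closed point \<open>\<theta> U\<close> vanishes and \<open>A\<close> is a matrix \<open>M\<close> over \<open>k\<close>. The coefficient of \<open>u\<close> in the flatness
  equation is therefore \<open>[G, M] = M\<close>, with \<open>G\<close> the \<open>u\<close>-linear part of \<open>U\<close>.
\<close>

lemma residue_nilpotent:
  fixes U A :: "'a \<Rightarrow> 'a \<Rightarrow> 'r fps"
  assumes "finite J"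
    and flat: "\<And>a b. a \<in> J \<Longrightarrow> b \<in> J \<Longrightarrow>
      fps_X ^ 2 * fps_deriv (A a b) + mm J U A a b
        - (fps_X * fps_map euler (U a b) + mm J A U a b) = fps_X * A a b"
    and A0: "\<And>a b k. a \<in> J \<Longrightarrow> b \<in> J \<Longrightarrow> k > 0 \<Longrightarrow> cf (fps_nth (A a b) k) 0 = 0"
  shows "nilpotent_mat J (\<lambda>a b. cf (fps_nth (A a b) 0) 0)"
proof (rule nilpotent_mat_of_commutator[OF assms(1)])
  fix a b assume ab: "a \<in> J" "b \<in> J"
  let ?M = "\<lambda>a b. cf (fps_nth (A a b) 0) 0" and ?G = "\<lambda>a b. cf (fps_nth (U a b) 1) 0"
  have 1: "{0..Suc 0} = {0, Suc 0}" by auto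
  have "mm J (\<lambda>a b. cf (fps_nth (U a b) 0) 0) (\<lambda>a b. cf (fps_nth (A a b) 1) 0) a b = 0"
    "mm J (\<lambda>a b. cf (fps_nth (A a b) 1) 0) (\<lambda>a b. cf (fps_nth (U a b) 0) 0) a b = 0"
    using A0 ab by (simp_all add: mm_def)
  then have UA: "cf (fps_nth (mm J U A a b) 1) 0 = mm J ?G ?M a b"
    "cf (fps_nth (mm J A U a b) 1) 0 = mm J ?M ?G a b"
    by (simp_all add: cf_fps_nth_mm splittings_zero 1)
  have "cf (fps_nth (fps_X ^ 2 * fps_deriv (A a b) + mm J U A a b
        - (fps_X * fps_map euler (U a b) + mm J A U a b)) 1) 0 = cf (fps_nth (fps_X * A a b) 1) 0"
    using flat[OF ab] by simp
  then show "mm J ?G ?M a b - mm J ?M ?G a b = ?M a b"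
    using UA by (simp add: cf_euler fps_X_power_mult_nth del: One_nat_def)
qed

text \<open>
  At a monomial \<open>m\<close> of degree \<open>d > 0\<close> and in degree \<open>k\<close> in \<open>u\<close> the equation reads
  \<open>d g_(m,k-1) + M g_(m,k) - g_(m,k) M + C_k = 0\<close> for \<open>k > 0\<close>, with \<open>C\<close> known from lower degrees, and for \<open>k = 0\<close> it has
  the unknown \<open>B_m\<close> on the right-hand side instead of the first term on the left. The equations for \<open>k > 0\<close> determine
  \<open>g_m\<close> by a descending recursion with a nilpotent operator, and the one for \<open>k = 0\<close> defines \<open>B_m\<close>.
\<close>

lemma normal_form_exists:
  fixes A :: "'a \<Rightarrow> 'a \<Rightarrow> 'r fps"
  assumes "finite J"
    and nil: "nilpotent_mat J (\<lambda>a b. cf (fps_nth (A a b) 0) 0)"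
    and A0: "\<And>a b k. a \<in> J \<Longrightarrow> b \<in> J \<Longrightarrow> k > 0 \<Longrightarrow> cf (fps_nth (A a b) k) 0 = 0"
  shows "\<exists>g B. (\<forall>a\<in>J. \<forall>b\<in>J. \<forall>k. cf (fps_nth (g a b) k) 0 = (if a = b \<and> k = 0 then 1 else 0)) \<and>
    (\<forall>a\<in>J. \<forall>b\<in>J. fps_X * fps_map euler (g a b) + mm J A g a b = mm J g (\<lambda>a b. fps_const (B a b)) a b)"
proof -
  define \<alpha> where "\<alpha> = (\<lambda>m k a b. cf (fps_nth (A a b) k) m)"
  define M where "M = \<alpha> 0 0"
  \<comment> \<open>An unknown assigns to each monomial the pair of the \<open>u\<close>-expansion of the coefficient of \<open>g\<close> and the coefficient of \<open>B\<close>.\<close>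
  define D where "D = (\<lambda>(f :: ('i \<Rightarrow>\<^sub>0 nat) \<Rightarrow> (nat \<Rightarrow> 'a \<Rightarrow> 'a \<Rightarrow> 'k) \<times> ('a \<Rightarrow> 'a \<Rightarrow> 'k)) k a b s.
     (\<Sum>i=0..k. mm J (\<alpha> (fst s) i) (fst (f (snd s)) (k - i)) a b)
       - mm J (fst (f (fst s)) k) (snd (f (snd s))) a b)"
  define E where "E = (\<lambda>f m.
     (m = 0 \<longrightarrow> f m = (\<lambda>k a b. if k = 0 \<and> a = b then 1 else 0, M)) \<and>
     (\<forall>k. \<forall>a\<in>J. \<forall>b\<in>J. (if k = 0 then 0 else of_nat (total_degree m) * fst (f m) (k - 1) a b)
        + (\<Sum>s\<in>{(m1, m2). m1 + m2 = m}. D f k a b s) = 0))"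
  have \<alpha>0: "(\<Sum>i=0..k. mm J (\<alpha> 0 i) (y (k - i)) a b) = mm J M (y k) a b" if "a \<in> J" for y k a b
  proof -
    have "(\<Sum>i=0..k. mm J (\<alpha> 0 i) (y (k - i)) a b) = (\<Sum>i=0..k. if i = 0 then mm J M (y k) a b else 0)"
      using A0 that by (intro sum.cong) (auto simp: \<alpha>_def M_def mm_def)
    then show ?thesis by simp
  qed
  have one: "mm J (\<lambda>a b. if k = (0::nat) \<and> a = b then 1 else 0) y a b = (if k = 0 then y a b else 0)"
    "mm J y (\<lambda>a b. if k = 0 \<and> a = b then 1 else 0) a b = (if k = 0 then y a b else 0)"
    if "a \<in> J" "b \<in> J" for a b k and y :: "'a \<Rightarrow> 'a \<Rightarrow> 'k"
    using mm_one_left[of J a y b] mm_one_right[of J b y a] that assms(1)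
    by (auto simp: one_mat_def mm_def fun_eq_iff)
  have "\<exists>f. (\<forall>m. Poly_Mapping.keys m \<subseteq> I \<longrightarrow> E f m) \<and>
      (\<forall>m. \<not> Poly_Mapping.keys m \<subseteq> I \<longrightarrow> f m = (\<lambda>_ _ _. 0, \<lambda>_ _. 0))"
  proof (rule monomial_recursion)
    fix f g m assume eq: "\<And>m1 m2. m1 + m2 = m \<Longrightarrow> f m1 = g m1 \<and> f m2 = g m2" and Ef: "E f m"
    have sums: "(\<Sum>s\<in>{(m1, m2). m1 + m2 = m}. D f k a b s) = (\<Sum>s\<in>{(m1, m2). m1 + m2 = m}. D g k a b s)" for k a b
      unfolding D_def using eq by (intro sum.cong refl) auto
    have fm: "f m = g m" using eq[of 0 m] by simp
    show "E g m" using Ef unfolding E_def sums fm .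
  next
    fix f m assume keys: "Poly_Mapping.keys m \<subseteq> I"
      and IH: "\<And>n. Poly_Mapping.keys n \<subseteq> I \<Longrightarrow> total_degree n < total_degree m \<Longrightarrow> E f n"
    show "\<exists>r. E (f(m := r)) m"
    proof (cases "m = 0")
      case True
      define y where "y = (\<lambda>(k::nat) (a::'a) b. if k = 0 \<and> a = b then (1::'k) else 0)"
      have "D (f(0 := (y, M))) k a b (0, 0) = 0" if "a \<in> J" "b \<in> J" for k a b
        using \<alpha>0[OF that(1), of y k b] one[OF that] unfolding D_def y_def by simp
      then have "E (f(0 := (y, M))) 0"
        unfolding E_def splittings_zero by (auto simp: y_def)
      then have "E (f(m := (y, M))) m" using True by simp
      then show ?thesis by blast
    next
      case False
      have d0: "of_nat (total_degree m) \<noteq> (0::'k)" using total_degree_pos[OF keys False] by simp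
      have "E f 0" using IH[of 0] total_degree_pos[OF keys False] by simp
      then have f0: "f 0 = (\<lambda>k a b. if k = 0 \<and> a = b then 1 else 0, M)" by (simp add: E_def)
      define C where "C = (\<lambda>k a b. (\<Sum>i=0..k. mm J (\<alpha> m i) (fst (f 0) (k - i)) a b)
        + (\<Sum>s\<in>{(m1, m2). m1 + m2 = m \<and> m1 \<noteq> 0 \<and> m2 \<noteq> 0}. D f k a b s))"
      define N where "N = sylvester_op J J M M (- 1 / of_nat (total_degree m))"
      obtain n where n: "\<And>X. (N ^^ n) X = 0"
        using sylvester_op_nilpotent[OF nil nil] unfolding N_def M_def \<alpha>_def by blast
      obtain y where y: "\<And>k. y k = (\<lambda>a b. - C (Suc k) a b / of_nat (total_degree m)) + N (y (Suc k))"
        using nilpotent_recursion_solvable[of n N "\<lambda>k a b. - C (Suc k) a b / of_nat (total_degree m)"] n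
        by (auto simp: N_def sylvester_op_diff)
      define \<beta> where "\<beta> = (\<lambda>a b. C 0 a b + mm J M (y 0) a b - mm J (y 0) M a b)"
      define h where "h = f(m := (y, \<beta>))"
      have rest: "(\<Sum>s\<in>{(m1, m2). m1 + m2 = m \<and> m1 \<noteq> 0 \<and> m2 \<noteq> 0}. D h k a b s) =
          (\<Sum>s\<in>{(m1, m2). m1 + m2 = m \<and> m1 \<noteq> 0 \<and> m2 \<noteq> 0}. D f k a b s)" for k a b
        unfolding D_def h_def by (intro sum.cong) auto
      have ends: "(\<Sum>s\<in>{(m1, m2). m1 + m2 = m}. D h k a b s) =
         C k a b + mm J M (y k) a b - mm J (y k) M a b - (if k = 0 then \<beta> a b else 0)"
        if "a \<in> J" "b \<in> J" for k a b
      proof -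
        have 1: "D h k a b (0, m) = mm J M (y k) a b - (if k = 0 then \<beta> a b else 0)"
          using that False by (simp add: D_def h_def \<alpha>0 f0 one)
        have 2: "D h k a b (m, 0) = (\<Sum>i=0..k. mm J (\<alpha> m i) (fst (f 0) (k - i)) a b) - mm J (y k) M a b"
          using that False by (simp add: D_def h_def f0)
        show ?thesis unfolding sum_splittings_ends[OF False] rest 1 2 by (simp add: C_def)
      qed
      have "E h m"
        unfolding E_def
      proof (intro conjI impI allI ballI)
        fix k a b assume ab: "a \<in> J" "b \<in> J"
        show "(if k = 0 then 0 else of_nat (total_degree m) * fst (h m) (k - 1) a b)
            + (\<Sum>s\<in>{(m1, m2). m1 + m2 = m}. D h k a b s) = 0"
        proof (cases k)
          case 0
          then show ?thesis unfolding ends[OF ab] by (simp add: \<beta>_def)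
        next
          case (Suc j)
          have "y j a b = - C k a b / of_nat (total_degree m)
              + (- 1 / of_nat (total_degree m)) * (mm J M (y k) a b - mm J (y k) M a b)"
            using fun_cong[OF fun_cong[OF y[of j]], of a b] by (simp add: Suc N_def sylvester_op_def)
          also have "\<dots> = (- C k a b - (mm J M (y k) a b - mm J (y k) M a b)) / of_nat (total_degree m)"
            by (simp add: diff_divide_distrib)
          finally have "of_nat (total_degree m) * y j a b = - C k a b - (mm J M (y k) a b - mm J (y k) M a b)"
            using d0 by simp
          then show ?thesis unfolding ends[OF ab] by (simp add: Suc h_def)
        qed
      qed (use False in simp)
      then show ?thesis unfolding h_def by blast
    qed
  qed
  then obtain f where f: "\<And>m. Poly_Mapping.keys m \<subseteq> I \<Longrightarrow> E f m"
    and f0: "\<And>m. \<not> Poly_Mapping.keys m \<subseteq> I \<Longrightarrow> f m = (\<lambda>_ _ _. 0, \<lambda>_ _. 0)" by blast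
  have "\<exists>c. \<forall>m k. cf (fps_nth c k) m = fst (f m) k a b" for a b
    by (rule ex_fps_cf) (metis f0 fst_conv)
  then obtain g where g: "\<And>a b m k. cf (fps_nth (g a b) k) m = fst (f m) k a b" by metis
  define B where "B = (\<lambda>a b. inv cf (\<lambda>m. snd (f m) a b))"
  have B: "cf (B a b) m = snd (f m) a b" for a b m
    unfolding B_def by (rule cf_inv) (metis f0 snd_conv)
  show ?thesis
  proof (intro exI[of _ g] exI[of _ B] conjI ballI allI)
    fix a b k assume "a \<in> J" "b \<in> J"
    show "cf (fps_nth (g a b) k) 0 = (if a = b \<and> k = 0 then 1 else 0)"
      using f[of 0] by (simp add: g E_def)
  next
    fix a b assume ab: "a \<in> J" "b \<in> J"
    show "fps_X * fps_map euler (g a b) + mm J A g a b = mm J g (\<lambda>a b. fps_const (B a b)) a b"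
    proof (intro fps_ext cf_eqI)
      fix k m
      show "cf (fps_nth (fps_X * fps_map euler (g a b) + mm J A g a b) k) m =
          cf (fps_nth (mm J g (\<lambda>a b. fps_const (B a b)) a b) k) m"
      proof (cases "Poly_Mapping.keys m \<subseteq> I")
        case True
        have "cf (fps_nth (mm J A g a b) k) m - cf (fps_nth (mm J g (\<lambda>a b. fps_const (B a b)) a b) k) m
            = (\<Sum>s\<in>{(m1, m2). m1 + m2 = m}. D f k a b s)"
          by (simp add: cf_fps_nth_mm fps_nth_mm_const_right cf_mm D_def g B \<alpha>_def case_prod_beta sum_subtractf)
        moreover have "cf (fps_nth (fps_X * fps_map euler (g a b)) k) m =
            (if k = 0 then 0 else of_nat (total_degree m) * fst (f m) (k - 1) a b)"
          by (simp add: cf_euler g)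
        moreover have "(if k = 0 then 0 else of_nat (total_degree m) * fst (f m) (k - 1) a b)
            + (\<Sum>s\<in>{(m1, m2). m1 + m2 = m}. D f k a b s) = 0"
          using f[OF True] ab unfolding E_def by blast
        ultimately show ?thesis by (simp add: algebra_simps)
      qed (simp add: cf_outside)
    qed
  qed
qed

end


section \<open>Coefficientwise maps of Laurent series\<close>

lemma fls_map_nth:
  assumes "\<phi> 0 = 0" shows "fls_nth (fls_map \<phi> f) n = \<phi> (fls_nth f n)"
  unfolding fls_map_def
  by (rule nth_Abs_fls_lower_bound[of "fls_subdegree f"]) (simp add: assms)

text \<open>
  The bounds need not be the subdegrees: a coefficientwise map may raise the subdegree, and then both sides of a
  product rule have to be summed over the same range.
\<close>

lemma fls_times_nth_from_bounds:
  fixes f g :: "'a::comm_ring_1 fls"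
  assumes "\<And>n. n < p \<Longrightarrow> fls_nth f n = 0" "\<And>n. n < q \<Longrightarrow> fls_nth g n = 0"
  shows "fls_nth (f * g) n = (\<Sum>i=p..n - q. fls_nth f i * fls_nth g (n - i))"
proof (cases "f = 0 \<or> g = 0")
  case False
  then have "p \<le> fls_subdegree f" "q \<le> fls_subdegree g"
    using assms by (meson fls_subdegree_geI)+
  then show ?thesis
    unfolding fls_times_nth(2) by (intro sum.mono_neutral_left) (auto intro: fls_eq0_below_subdegree)
qed auto

lemma fls_map_add: "\<phi> 0 = 0 \<Longrightarrow> (\<And>x y. \<phi> (x + y) = \<phi> x + \<phi> y) \<Longrightarrow> fls_map \<phi> (f + g) = fls_map \<phi> f + fls_map \<phi> g"
  by (rule fls_eqI) (simp add: fls_map_nth)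

lemma fls_map_derivation:
  fixes f g :: "'a::comm_ring_1 fls"
  assumes 0: "\<phi> 0 = 0" and add: "\<And>x y. \<phi> (x + y) = \<phi> x + \<phi> y"
    and mult: "\<And>x y. \<phi> (x * y) = \<phi> x * y + x * \<phi> y"
  shows "fls_map \<phi> (f * g) = fls_map \<phi> f * g + f * fls_map \<phi> g"
proof (rule fls_eqI)
  fix n
  let ?p = "fls_subdegree f" and ?q = "fls_subdegree g"
  have sum: "\<phi> (sum h A) = (\<Sum>x\<in>A. \<phi> (h x))" for h and A :: "int set"
    by (induction A rule: infinite_finite_induct) (simp_all add: 0 add)
  have "fls_nth (fls_map \<phi> f * g) n = (\<Sum>i=?p..n - ?q. fls_nth (fls_map \<phi> f) i * fls_nth g (n - i))"
    "fls_nth (f * fls_map \<phi> g) n = (\<Sum>i=?p..n - ?q. fls_nth f i * fls_nth (fls_map \<phi> g) (n - i))"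
    by (rule fls_times_nth_from_bounds; simp add: fls_map_nth 0)+
  then show "fls_nth (fls_map \<phi> (f * g)) n = fls_nth (fls_map \<phi> f * g + f * fls_map \<phi> g) n"
    by (simp add: fls_map_nth 0 fls_times_nth(2) sum mult sum.distrib)
qed

lemma fls_map_hom_mult:
  fixes f g :: "'a::comm_ring_1 fls" and \<phi> :: "'a \<Rightarrow> 'b::comm_ring_1"
  assumes 0: "\<phi> 0 = 0" and add: "\<And>x y. \<phi> (x + y) = \<phi> x + \<phi> y"
    and mult: "\<And>x y. \<phi> (x * y) = \<phi> x * \<phi> y"
  shows "fls_map \<phi> (f * g) = fls_map \<phi> f * fls_map \<phi> g"
proof (rule fls_eqI)
  fix n
  let ?p = "fls_subdegree f" and ?q = "fls_subdegree g"
  have sum: "\<phi> (sum h A) = (\<Sum>x\<in>A. \<phi> (h x))" for h and A :: "int set"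
    by (induction A rule: infinite_finite_induct) (simp_all add: 0 add)
  have "fls_nth (fls_map \<phi> f * fls_map \<phi> g) n =
      (\<Sum>i=?p..n - ?q. fls_nth (fls_map \<phi> f) i * fls_nth (fls_map \<phi> g) (n - i))"
    by (rule fls_times_nth_from_bounds; simp add: fls_map_nth 0)
  then show "fls_nth (fls_map \<phi> (f * g)) n = fls_nth (fls_map \<phi> f * fls_map \<phi> g) n"
    by (simp add: fls_map_nth 0 fls_times_nth(2) sum mult)
qed

lemma fls_map_fps_to_fls: "\<phi> 0 = 0 \<Longrightarrow> fls_map \<phi> (fps_to_fls f) = fps_to_fls (fps_map \<phi> f)"
  by (rule fls_eqI) (simp add: fls_map_nth)

lemma fls_map_const: "\<phi> 0 = 0 \<Longrightarrow> fls_map \<phi> (fls_const c) = fls_const (\<phi> c)"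
  by (rule fls_eqI) (simp add: fls_map_nth)

lemma fps_to_fls_mult: "fps_to_fls (f * g) = fps_to_fls f * fps_to_fls (g :: 'a::comm_ring_1 fps)"
  by (simp add: fls_times_fps_to_fls)

lemma fps_to_fls_sum: "fps_to_fls (sum f A) = (\<Sum>x\<in>A. fps_to_fls (f x :: 'a::comm_ring_1 fps))"
  by (induction A rule: infinite_finite_induct) simp_all

lemma fps_to_fls_mm:
  "fps_to_fls (mm J P Q a c) = mm J (\<lambda>a b. fps_to_fls (P a b)) (\<lambda>a b. fps_to_fls (Q a b)) a c"
  by (simp add: mm_def fps_to_fls_sum fps_to_fls_mult)

lemma fps_to_fls_X: "fps_to_fls fps_X = (fls_X :: 'a::comm_ring_1 fls)"
  by (rule fls_eqI) auto

section \<open>Linear combinations and connection matrices\<close>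

text \<open>
  These facts are used for Laurent series and for power series as scalars, over the base and at the closed
  point.
\<close>

locale lin_module = module scale
  for scale :: "'a::comm_ring_1 \<Rightarrow> 'b::ab_group_add \<Rightarrow> 'b"
begin

definition lincomb :: "'j set \<Rightarrow> ('j \<Rightarrow> 'b) \<Rightarrow> ('j \<Rightarrow> 'a) \<Rightarrow> 'b" where
  "lincomb J b c = (\<Sum>j\<in>J. scale (c j) (b j))"

definition indep :: "'j set \<Rightarrow> ('j \<Rightarrow> 'b) \<Rightarrow> bool" where
  "indep J b \<longleftrightarrow> finite J \<and> (\<forall>c. lincomb J b c = 0 \<longrightarrow> (\<forall>j\<in>J. c j = 0))"

lemma lincomb_cong: "(\<And>j. j \<in> J \<Longrightarrow> c j = d j) \<Longrightarrow> (\<And>j. j \<in> J \<Longrightarrow> b j = b' j) \<Longrightarrow> lincomb J b c = lincomb J b' d"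
  by (simp add: lincomb_def)

lemma lincomb_add: "lincomb J b c + lincomb J b d = lincomb J b (\<lambda>j. c j + d j)"
  by (simp add: lincomb_def scale_left_distrib sum.distrib)

lemma lincomb_diff: "lincomb J b c - lincomb J b d = lincomb J b (\<lambda>j. c j - d j)"
  by (simp add: lincomb_def scale_left_diff_distrib sum_subtractf)

lemma lincomb_scale: "scale f (lincomb J b c) = lincomb J b (\<lambda>j. f * c j)"
  by (simp add: lincomb_def scale_sum_right)

lemma lincomb_zero: "lincomb J b (\<lambda>j. 0) = 0"
  by (simp add: lincomb_def)

lemma lincomb_single:
  "finite J \<Longrightarrow> l \<in> J \<Longrightarrow> lincomb J b (\<lambda>j. if j = l then 1 else 0) = b l"
  by (simp add: lincomb_def if_distrib[of "\<lambda>f. scale f _"] cong: if_cong)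

lemma lincomb_eqD:
  assumes "indep J b" "lincomb J b c = lincomb J b d" "j \<in> J" shows "c j = d j"
proof -
  have "lincomb J b (\<lambda>j. c j - d j) = 0" using assms(2) by (simp flip: lincomb_diff)
  then show ?thesis using assms by (auto simp: indep_def)
qed

lemma lincomb_lincomb:
  "lincomb L (\<lambda>l. lincomb J b (\<lambda>j. P j l)) c = lincomb J b (\<lambda>j. \<Sum>l\<in>L. P j l * c l)"
proof -
  have "lincomb L (\<lambda>l. lincomb J b (\<lambda>j. P j l)) c = (\<Sum>l\<in>L. \<Sum>j\<in>J. scale (P j l * c l) (b j))"
    by (simp add: lincomb_def scale_sum_right mult.commute)
  also have "\<dots> = (\<Sum>j\<in>J. \<Sum>l\<in>L. scale (P j l * c l) (b j))" by (rule sum.swap)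
  finally show ?thesis by (simp add: lincomb_def scale_sum_left)
qed

lemma lincomb_mm:
  "lincomb L (\<lambda>l. lincomb J b (\<lambda>j. P j l)) (\<lambda>l. Q l m) = lincomb J b (\<lambda>j. mm L P Q j m)"
  by (simp add: lincomb_lincomb mm_def)

lemma additive_zero_sum:
  assumes "\<And>v w. D (v + w) = D v + (D w :: 'b)"
  shows "D 0 = 0" "D (sum f A) = (\<Sum>x\<in>A. D (f x))"
proof -
  show 0: "D 0 = 0" using assms[of 0 0] by simp
  show "D (sum f A) = (\<Sum>x\<in>A. D (f x))"
    by (induction A rule: infinite_finite_induct) (simp_all add: 0 assms)
qed

lemma covariant_derivative_lincomb:
  assumes D: "covariant_derivative scale \<delta> D"
    and "\<And>l. l \<in> L \<Longrightarrow> D (b l) = lincomb J e (\<lambda>j. \<Gamma> j l)"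
  shows "D (lincomb L b c) = lincomb L b (\<lambda>l. \<delta> (c l)) + lincomb J e (\<lambda>j. \<Sum>l\<in>L. \<Gamma> j l * c l)"
proof -
  have add: "D (v + w) = D v + D w" and leib: "D (scale f v) = scale (\<delta> f) v + scale f (D v)" for f v w
    using D by (auto simp: covariant_derivative_def)
  have "D (lincomb L b c) = (\<Sum>l\<in>L. scale (\<delta> (c l)) (b l) + scale (c l) (D (b l)))"
    by (simp add: lincomb_def additive_zero_sum(2)[of D, OF add] leib)
  also have "\<dots> = lincomb L b (\<lambda>l. \<delta> (c l)) + lincomb L (\<lambda>l. lincomb J e (\<lambda>j. \<Gamma> j l)) c"
    using assms(2) by (simp add: lincomb_def[of L] sum.distrib)
  finally show ?thesis by (simp add: lincomb_lincomb)
qed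

lemma covariant_derivative_matrix:
  assumes "covariant_derivative scale \<delta> D"
    and "\<And>j. j \<in> J \<Longrightarrow> D (b j) = lincomb J b (\<lambda>i. \<Gamma> i j)"
  shows "D (lincomb J b (\<lambda>j. P j l)) = lincomb J b (\<lambda>j. \<delta> (P j l) + mm J \<Gamma> P j l)"
  using covariant_derivative_lincomb[OF assms, where c = "\<lambda>j. P j l"] by (simp add: lincomb_add mm_def)

text \<open>
  This is \<open>\<nabla> b' = b (\<delta> g + \<Gamma> g)\<close> compared with \<open>\<nabla> b' = b' B = b g B\<close>.
\<close>

lemma gauge_transformation:
  assumes "indep J b" "covariant_derivative scale \<delta> D"
    and "\<And>j. j \<in> J \<Longrightarrow> D (b j) = lincomb J b (\<lambda>i. \<Gamma> i j)"
    and "\<And>l. l \<in> L \<Longrightarrow> b' l = lincomb J b (\<lambda>j. g j l)"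
    and "\<And>l. l \<in> L \<Longrightarrow> D (b' l) = lincomb L b' (\<lambda>i. B i l)"
    and "j \<in> J" "l \<in> L"
  shows "\<delta> (g j l) + mm J \<Gamma> g j l = mm L g B j l"
proof -
  have "lincomb J b (\<lambda>j. \<delta> (g j l) + mm J \<Gamma> g j l) = D (b' l)"
    using covariant_derivative_matrix[OF assms(2,3), where P = g and l = l] assms(4)[OF assms(7)] by simp
  also have "\<dots> = lincomb L (\<lambda>l. lincomb J b (\<lambda>j. g j l)) (\<lambda>i. B i l)"
    using assms(5)[OF assms(7)] assms(4) by (simp cong: lincomb_cong)
  also have "\<dots> = lincomb J b (\<lambda>j. mm L g B j l)" by (rule lincomb_mm)
  finally show ?thesis using lincomb_eqD[OF assms(1)] assms(6) by blast
qed

text \<open>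
  Commutators are allowed to be a multiple of the second operator, because \<open>u\<^sup>2 \<nabla>\<close> along \<open>\<partial>/\<partial>u\<close> and \<open>u \<nabla>\<close> along \<open>\<xi>\<close>
  do not commute although the connection is flat.
\<close>

lemma curvature_matrix:
  assumes "indep J b" "covariant_derivative scale \<delta>\<^sub>1 D\<^sub>1" "covariant_derivative scale \<delta>\<^sub>2 D\<^sub>2"
    and D1: "\<And>j. j \<in> J \<Longrightarrow> D\<^sub>1 (b j) = lincomb J b (\<lambda>i. \<Gamma>\<^sub>1 i j)"
    and D2: "\<And>j. j \<in> J \<Longrightarrow> D\<^sub>2 (b j) = lincomb J b (\<lambda>i. \<Gamma>\<^sub>2 i j)"
    and comm: "\<And>v. D\<^sub>1 (D\<^sub>2 v) - D\<^sub>2 (D\<^sub>1 v) = scale f (D\<^sub>2 v)"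
    and "i \<in> J" "j \<in> J"
  shows "\<delta>\<^sub>1 (\<Gamma>\<^sub>2 i j) + mm J \<Gamma>\<^sub>1 \<Gamma>\<^sub>2 i j - (\<delta>\<^sub>2 (\<Gamma>\<^sub>1 i j) + mm J \<Gamma>\<^sub>2 \<Gamma>\<^sub>1 i j) = f * \<Gamma>\<^sub>2 i j"
proof -
  have "D\<^sub>1 (D\<^sub>2 (b j)) = lincomb J b (\<lambda>i. \<delta>\<^sub>1 (\<Gamma>\<^sub>2 i j) + mm J \<Gamma>\<^sub>1 \<Gamma>\<^sub>2 i j)"
    unfolding D2[OF assms(8)] by (rule covariant_derivative_matrix[OF assms(2)]) (rule D1)
  moreover have "D\<^sub>2 (D\<^sub>1 (b j)) = lincomb J b (\<lambda>i. \<delta>\<^sub>2 (\<Gamma>\<^sub>1 i j) + mm J \<Gamma>\<^sub>2 \<Gamma>\<^sub>1 i j)"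
    unfolding D1[OF assms(8)] by (rule covariant_derivative_matrix[OF assms(3)]) (rule D2)
  ultimately have "lincomb J b (\<lambda>i. (\<delta>\<^sub>1 (\<Gamma>\<^sub>2 i j) + mm J \<Gamma>\<^sub>1 \<Gamma>\<^sub>2 i j) - (\<delta>\<^sub>2 (\<Gamma>\<^sub>1 i j) + mm J \<Gamma>\<^sub>2 \<Gamma>\<^sub>1 i j))
      = D\<^sub>1 (D\<^sub>2 (b j)) - D\<^sub>2 (D\<^sub>1 (b j))"
    by (simp add: lincomb_diff)
  also have "\<dots> = lincomb J b (\<lambda>i. f * \<Gamma>\<^sub>2 i j)"
    unfolding comm by (simp add: D2[OF assms(8)] lincomb_scale)
  finally show ?thesis using lincomb_eqD[OF assms(1) _ assms(7)] by blast
qed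

lemma covariant_derivative_unique:
  assumes "covariant_derivative scale \<delta> D" "covariant_derivative scale \<delta> D'"
    and "\<And>v. \<exists>c. v = lincomb J b c" "\<And>j. j \<in> J \<Longrightarrow> D (b j) = 0" "\<And>j. j \<in> J \<Longrightarrow> D' (b j) = 0"
  shows "D = D'"
proof
  fix v
  obtain c where v: "v = lincomb J b c" using assms(3) by blast
  show "D v = D' v"
    using covariant_derivative_lincomb[OF assms(1), of J b J b "\<lambda>_ _. 0" c]
      covariant_derivative_lincomb[OF assms(2), of J b J b "\<lambda>_ _. 0" c] assms(4,5)
    by (simp add: v lincomb_zero)
qed

end

section \<open>Lattices and their frames\<close>

text \<open>
  A basis indexed by a separate set, which makes it possible to give a lift, or a gauge transform, of a frame
  the same index set.
\<close>

definition frame ::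
  "('a::comm_ring_1 fls \<Rightarrow> 'v::ab_group_add \<Rightarrow> 'v) \<Rightarrow> 'v set \<Rightarrow> 'j set \<Rightarrow> ('j \<Rightarrow> 'v) \<Rightarrow> bool" where
  "frame sc H J b \<longleftrightarrow> lin_module.indep sc J b \<and> (\<forall>v. \<exists>c. v = lin_module.lincomb sc J b c) \<and>
     H = range (\<lambda>a. lin_module.lincomb sc J b (\<lambda>j. fps_to_fls (a j)))"

locale laurent_module = lin_module sc for sc :: "'a::comm_ring_1 fls \<Rightarrow> 'v::ab_group_add \<Rightarrow> 'v"
begin

text \<open>
  The action of regular scalars. On regular operators, matrices over power series in \<open>u\<close> suffice, and their
  coefficients start in degree \<open>0\<close>.
\<close>

definition reg_scale :: "'a fps \<Rightarrow> 'v \<Rightarrow> 'v" where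
  "reg_scale a = sc (fps_to_fls a)"

sublocale reg: lin_module reg_scale
  by unfold_locales (simp_all add: reg_scale_def algebra_simps fps_to_fls_mult)

lemma reg_lincomb: "reg.lincomb J b a = lincomb J b (\<lambda>j. fps_to_fls (a j))"
  by (simp add: reg.lincomb_def lincomb_def reg_scale_def)

lemma indep_reg: "indep J b \<Longrightarrow> reg.indep J b"
  by (fastforce simp: indep_def reg.indep_def reg_lincomb)

lemma covariant_derivative_reg:
  assumes "covariant_derivative sc \<delta> D" "\<And>a. \<delta> (fps_to_fls a) = fps_to_fls (\<delta>' a)"
  shows "covariant_derivative reg_scale \<delta>' D"
  using assms by (simp add: covariant_derivative_def reg_scale_def)

lemma frame_reg_indep: "frame sc H J b \<Longrightarrow> reg.indep J b"
  by (simp add: frame_def indep_reg)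

lemma frame_in: "frame sc H J b \<Longrightarrow> j \<in> J \<Longrightarrow> b j \<in> H"
proof -
  assume f: "frame sc H J b" and j: "j \<in> J"
  then have "b j = lincomb J b (\<lambda>i. fps_to_fls (if i = j then 1 else 0))"
    using lincomb_single[of J j b] by (simp add: frame_def indep_def if_distrib[of fps_to_fls] cong: if_cong)
  also have "\<dots> \<in> H" using f by (auto simp: frame_def)
  finally show ?thesis .
qed

lemma frame_lattice: "frame sc H J b \<Longrightarrow> h \<in> H \<longleftrightarrow> (\<exists>a. h = reg.lincomb J b a)"
  by (auto simp: frame_def reg_lincomb)

lemma frame_scale: "frame sc H J b \<Longrightarrow> h \<in> H \<Longrightarrow> reg_scale a h \<in> H"
  by (metis frame_lattice reg.lincomb_scale)

lemma frame_matrix: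
  assumes "frame sc H J b" "\<And>l. l \<in> L \<Longrightarrow> w l \<in> H"
  shows "\<exists>P. \<forall>l\<in>L. w l = reg.lincomb J b (\<lambda>j. P j l)"
proof -
  have "\<forall>l\<in>L. \<exists>a. w l = reg.lincomb J b a" using assms frame_lattice by blast
  then obtain a where "\<forall>l\<in>L. w l = reg.lincomb J b (a l)" by metis
  then show ?thesis by (intro exI[of _ "\<lambda>j l. a l j"]) simp
qed

text \<open>
  Mutually inverse matrices over power series give inverse substitutions both for Laurent series coordinates and for
  coordinates in the lattice.
\<close>

lemma frame_change:
  assumes "frame sc H J b" "finite L"
    and b': "\<And>l. l \<in> L \<Longrightarrow> b' l = reg.lincomb J b (\<lambda>j. P j l)"
    and PP': "\<And>i j. i \<in> J \<Longrightarrow> j \<in> J \<Longrightarrow> mm L P P' i j = one_mat i j"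
    and P'P: "\<And>i j. i \<in> L \<Longrightarrow> j \<in> L \<Longrightarrow> mm J P' P i j = one_mat i j"
  shows "frame sc H L b'"
proof -
  have fin: "finite J" using assms(1) by (simp add: frame_def indep_def)
  define p where "p = (\<lambda>j l. fps_to_fls (P j l))"
  define p' where "p' = (\<lambda>j l. fps_to_fls (P' j l))"
  have pp': "mm L p p' i j = one_mat i j" if "i \<in> J" "j \<in> J" for i j
    using PP'[OF that] unfolding p_def p'_def by (simp flip: fps_to_fls_mm) (simp add: one_mat_def)
  have p'p: "mm J p' p i j = one_mat i j" if "i \<in> L" "j \<in> L" for i j
    using P'P[OF that] unfolding p_def p'_def by (simp flip: fps_to_fls_mm) (simp add: one_mat_def)
  have lc: "lincomb L b' c = lincomb J b (\<lambda>j. \<Sum>l\<in>L. p j l * c l)" for c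
    unfolding lincomb_lincomb[symmetric] using b'
    by (intro lincomb_cong) (simp_all add: p_def reg_lincomb)
  have inv1: "(\<Sum>l\<in>L. p j l * (\<Sum>i\<in>J. p' l i * c i)) = c j" if "j \<in> J" for c j
  proof -
    \<comment> \<open>A coordinate vector is a matrix with one column.\<close>
    have "(\<Sum>l\<in>L. p j l * (\<Sum>i\<in>J. p' l i * c i)) = mm J (mm L p p') (\<lambda>i (_::unit). c i) j ()"
      by (simp add: mm_assoc) (simp add: mm_def)
    also have "\<dots> = mm J one_mat (\<lambda>i (_::unit). c i) j ()"
      using pp' that by (intro mm_cong) auto
    finally show ?thesis using fin that by (simp add: mm_one_left)
  qed
  have inv2: "(\<Sum>l\<in>J. p' j l * (\<Sum>i\<in>L. p l i * c i)) = c j" if "j \<in> L" for c j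
  proof -
    have "(\<Sum>l\<in>J. p' j l * (\<Sum>i\<in>L. p l i * c i)) = mm L (mm J p' p) (\<lambda>i (_::unit). c i) j ()"
      by (simp add: mm_assoc) (simp add: mm_def)
    also have "\<dots> = mm L one_mat (\<lambda>i (_::unit). c i) j ()"
      using p'p that by (intro mm_cong) auto
    finally show ?thesis using \<open>finite L\<close> that by (simp add: mm_one_left)
  qed
  have "indep L b'"
    unfolding indep_def
  proof (intro conjI allI impI ballI)
    fix c l assume "lincomb L b' c = 0" "l \<in> L"
    then have "\<forall>j\<in>J. (\<Sum>l\<in>L. p j l * c l) = 0"
      using assms(1) by (auto simp: frame_def indep_def lc)
    then show "c l = 0" using inv2[OF \<open>l \<in> L\<close>, of c] by simp
  qed (rule assms(2))
  moreover have expand: "lincomb J b c = lincomb L b' (\<lambda>l. \<Sum>i\<in>J. p' l i * c i)" for c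
    unfolding lc by (intro lincomb_cong) (simp_all add: inv1)
  then have "\<exists>c. v = lincomb L b' c" for v
    using assms(1) unfolding frame_def by metis
  moreover have "H = range (\<lambda>a. lincomb L b' (\<lambda>j. fps_to_fls (a j)))"
  proof (intro set_eqI iffI)
    fix h assume "h \<in> H"
    then obtain a where "h = lincomb J b (\<lambda>j. fps_to_fls (a j))" using assms(1) by (auto simp: frame_def)
    then have "h = lincomb L b' (\<lambda>l. fps_to_fls (\<Sum>i\<in>J. P' l i * a i))"
      by (simp add: expand p'_def fps_to_fls_sum fps_to_fls_mult)
    then show "h \<in> range (\<lambda>a. lincomb L b' (\<lambda>j. fps_to_fls (a j)))" by simp
  next
    fix h assume "h \<in> range (\<lambda>a. lincomb L b' (\<lambda>j. fps_to_fls (a j)))"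
    then obtain a where "h = lincomb L b' (\<lambda>j. fps_to_fls (a j))" by blast
    then have "h = lincomb J b (\<lambda>j. fps_to_fls (\<Sum>l\<in>L. P j l * a l))"
      by (simp add: lc p_def fps_to_fls_sum fps_to_fls_mult)
    then show "h \<in> H" using assms(1) by (auto simp: frame_def)
  qed
  ultimately show ?thesis by (simp add: frame_def)
qed

text \<open>
  Substituting one expansion into the other and comparing coordinates shows that the two matrices are mutually
  inverse.
\<close>

lemma transition_matrices:
  assumes "frame sc H J b" "frame sc H L b'"
  shows "\<exists>P P'. (\<forall>l\<in>L. b' l = reg.lincomb J b (\<lambda>j. P j l)) \<and>
    (\<forall>j\<in>J. b j = reg.lincomb L b' (\<lambda>l. P' l j)) \<and>
    (\<forall>i\<in>J. \<forall>j\<in>J. mm L P P' i j = one_mat i j) \<and> (\<forall>i\<in>L. \<forall>j\<in>L. mm J P' P i j = one_mat i j)"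
proof -
  obtain P where P: "\<And>l. l \<in> L \<Longrightarrow> b' l = reg.lincomb J b (\<lambda>j. P j l)"
    using frame_matrix[OF assms(1), of L b'] frame_in[OF assms(2)] by blast
  obtain P' where P': "\<And>j. j \<in> J \<Longrightarrow> b j = reg.lincomb L b' (\<lambda>l. P' l j)"
    using frame_matrix[OF assms(2), of J b] frame_in[OF assms(1)] by blast
  have ind: "reg.indep J b" "reg.indep L b'" using assms indep_reg by (auto simp: frame_def)
  then have fin: "finite J" "finite L" by (auto simp: reg.indep_def)
  have one: "reg.lincomb N c (\<lambda>i. one_mat i j) = c j" if "finite N" "j \<in> N" for N c j
    using reg.lincomb_single[OF that, of c] by (simp add: one_mat_def)
  have "mm L P P' i j = one_mat i j" if "i \<in> J" "j \<in> J" for i j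
  proof -
    have "reg.lincomb J b (\<lambda>i. mm L P P' i j) = reg.lincomb L b' (\<lambda>l. P' l j)"
      unfolding reg.lincomb_mm[symmetric] using P by (intro reg.lincomb_cong) simp_all
    also have "\<dots> = reg.lincomb J b (\<lambda>i. one_mat i j)"
      using that fin by (simp add: one P'[symmetric])
    finally show ?thesis by (rule reg.lincomb_eqD[OF ind(1) _ that(1)])
  qed
  moreover have "mm J P' P i j = one_mat i j" if "i \<in> L" "j \<in> L" for i j
  proof -
    have "reg.lincomb L b' (\<lambda>i. mm J P' P i j) = reg.lincomb J b (\<lambda>l. P l j)"
      unfolding reg.lincomb_mm[symmetric] using P' by (intro reg.lincomb_cong) simp_all
    also have "\<dots> = reg.lincomb L b' (\<lambda>i. one_mat i j)"
      using that fin by (simp add: one P[symmetric])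
    finally show ?thesis by (rule reg.lincomb_eqD[OF ind(2) _ that(1)])
  qed
  ultimately show ?thesis using P P' by blast
qed

lemma frame_inj: "frame sc H J b \<Longrightarrow> inj_on b J"
proof (rule inj_onI, rule ccontr)
  fix i j assume f: "frame sc H J b" and ij: "i \<in> J" "j \<in> J" "b i = b j" "i \<noteq> j"
  have ind: "indep J b" and fin: "finite J" using f by (auto simp: frame_def indep_def)
  have "lincomb J b (\<lambda>l. if l = i then 1 else 0) = lincomb J b (\<lambda>l. if l = j then 1 else 0)"
    using ij fin by (simp add: lincomb_single)
  from lincomb_eqD[OF ind this ij(1)] ij(4) show False by simp
qed

lemma frame_id_iff: "frame sc H E (\<lambda>e. e) \<longleftrightarrow> bundle_basis sc H E"
proof (cases "finite E")
  case True
  have "indep E (\<lambda>e. e) \<longleftrightarrow> \<not> dependent E"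
    using True by (auto simp: indep_def dependent_finite lincomb_def)
  moreover have "(\<forall>v. \<exists>c. v = lincomb E (\<lambda>e. e) c) \<longleftrightarrow> span E = UNIV"
    using True by (auto simp: span_finite lincomb_def set_eq_iff image_iff)
  ultimately show ?thesis using True by (simp add: frame_def bundle_basis_def lincomb_def)
qed (simp add: frame_def bundle_basis_def indep_def)

lemma lincomb_image:
  "inj_on b J \<Longrightarrow> lincomb (b ` J) (\<lambda>e. e) c = lincomb J b (\<lambda>j. c (b j))"
  by (simp add: lincomb_def sum.reindex)

lemma frame_image:
  assumes "frame sc H J b" shows "frame sc H (b ` J) (\<lambda>e. e)"
proof -
  have inj: "inj_on b J" by (rule frame_inj[OF assms])
  have pull: "lincomb J b c = lincomb (b ` J) (\<lambda>e. e) (\<lambda>e. c (the_inv_into J b e))" for c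
    unfolding lincomb_image[OF inj] by (intro lincomb_cong) (simp_all add: the_inv_into_f_f[OF inj])
  have "indep (b ` J) (\<lambda>e. e)"
    using assms unfolding frame_def indep_def lincomb_image[OF inj] by fastforce
  moreover have "\<exists>c. v = lincomb (b ` J) (\<lambda>e. e) c" for v
    using assms unfolding frame_def by (metis pull)
  moreover have "range (\<lambda>a. lincomb J b (\<lambda>j. fps_to_fls (a j)))
      = range (\<lambda>a. lincomb (b ` J) (\<lambda>e. e) (\<lambda>j. fps_to_fls (a j)))"
  proof (intro set_eqI iffI)
    fix h assume "h \<in> range (\<lambda>a. lincomb J b (\<lambda>j. fps_to_fls (a j)))"
    then show "h \<in> range (\<lambda>a. lincomb (b ` J) (\<lambda>e. e) (\<lambda>j. fps_to_fls (a j)))" using pull by auto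
  qed (auto simp: lincomb_image[OF inj])
  ultimately show ?thesis using assms by (simp add: frame_def)
qed

text \<open>
  Differentiate the coordinates.
\<close>

lemma flat_connection_exists:
  assumes f: "frame sc H J b" and add: "\<And>f g. \<delta> (f + g) = \<delta> f + \<delta> g"
    and mult: "\<And>f g. \<delta> (f * g) = \<delta> f * g + f * \<delta> g"
  shows "\<exists>D. covariant_derivative sc \<delta> D \<and> (\<forall>c. D (lincomb J b c) = lincomb J b (\<lambda>j. \<delta> (c j)))"
proof -
  define co where "co = (\<lambda>v. SOME c. v = lincomb J b c)"
  have co: "lincomb J b (co v) = v" for v
    using f unfolding frame_def co_def by (metis (mono_tags, lifting) someI_ex)
  define D where "D = (\<lambda>v. lincomb J b (\<lambda>j. \<delta> (co v j)))"
  have D: "D (lincomb J b c) = lincomb J b (\<lambda>j. \<delta> (c j))" for c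
  proof -
    have "co (lincomb J b c) j = c j" if "j \<in> J" for j
      using f that by (intro lincomb_eqD[of J b]) (auto simp: frame_def co)
    then show ?thesis unfolding D_def by (intro lincomb_cong) auto
  qed
  have "covariant_derivative sc \<delta> D"
    unfolding covariant_derivative_def
  proof (intro conjI allI)
    fix v w
    show "D (v + w) = D v + D w"
      using D[of "\<lambda>j. co v j + co w j"] by (simp add: co add D_def flip: lincomb_add)
  next
    fix f v
    have "D (sc f v) = lincomb J b (\<lambda>j. \<delta> f * co v j + f * \<delta> (co v j))"
      using D[of "\<lambda>j. f * co v j"] by (simp add: co mult flip: lincomb_scale)
    then show "D (sc f v) = sc (\<delta> f) v + sc f (D v)"
      by (simp add: D_def co flip: lincomb_add lincomb_scale)
  qed
  with D show ?thesis by blast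
qed

end


section \<open>Restriction to the closed point\<close>

text \<open>
  Applying the connection to \<open>w' = w P\<close> gives \<open>w (dP/du) = 0\<close>.
\<close>

lemma (in laurent_module) flat_transition_constant:
  fixes D :: "'v \<Rightarrow> 'v"
  assumes "reg.indep J w" "covariant_derivative sc fls_deriv D"
    and "\<And>j. j \<in> J \<Longrightarrow> D (w j) = 0" and "\<And>l. l \<in> L \<Longrightarrow> D (w' l) = 0"
    and "\<And>l. l \<in> L \<Longrightarrow> w' l = reg.lincomb J w (\<lambda>j. P j l)"
    and "j \<in> J" "l \<in> L"
  shows "fps_deriv (P j l) = 0"
proof -
  have D: "covariant_derivative reg_scale fps_deriv D"
    using assms(2) by (rule covariant_derivative_reg) (simp add: fls_deriv_fps_to_fls)
  have "D (reg.lincomb J w (\<lambda>j. P j l)) = reg.lincomb J w (\<lambda>j. fps_deriv (P j l) + mm J (\<lambda>_ _. 0) P j l)"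
    using D by (rule reg.covariant_derivative_matrix) (simp add: assms(3) reg.lincomb_zero)
  then have "reg.lincomb J w (\<lambda>j. fps_deriv (P j l)) = reg.lincomb J w (\<lambda>j. 0)"
    using assms(4,5)[OF assms(7)] by (simp add: mm_def reg.lincomb_zero)
  from reg.lincomb_eqD[OF assms(1) this assms(6)] show ?thesis .
qed

locale restricted_bundle = power_series_ring I cf + laurent_module sc + base: laurent_module scb
  for I :: "'i set" and cf :: "'r::comm_ring_1 \<Rightarrow> ('i \<Rightarrow>\<^sub>0 nat) \<Rightarrow> 'k::field_char_0"
    and sc :: "'r fls \<Rightarrow> 'v::ab_group_add \<Rightarrow> 'v" and scb :: "'k fls \<Rightarrow> 'w::ab_group_add \<Rightarrow> 'w" +
  fixes \<rho> :: "'v \<Rightarrow> 'w"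
  assumes restriction: "restriction_map cf sc scb \<rho>"
begin

abbreviation ev :: "'r fls \<Rightarrow> 'k fls" where "ev \<equiv> fls_map (eval_b cf)"

lemma eval_b_0 [simp]: "eval_b cf 0 = 0"
  by (simp add: eval_b_def)

lemma ev_nth [simp]: "fls_nth (ev f) n = cf (fls_nth f n) 0"
  by (simp add: fls_map_nth) (simp add: eval_b_def)

lemma ev_add: "ev (f + g) = ev f + ev g"
  by (rule fls_eqI) simp

lemma ev_mult: "ev (f * g) = ev f * ev g"
  by (rule fls_map_hom_mult) (simp_all add: eval_b_def)

lemma ev_0 [simp]: "ev 0 = 0"
  by (rule fls_eqI) simp

lemma ev_fps: "ev (fps_to_fls a) = fps_to_fls (fps_map (eval_b cf) a)"
  by (rule fls_map_fps_to_fls) simp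

lemma ev_lift: "ev (fls_map cst c) = c"
  by (rule fls_eqI) (simp add: fls_map_nth)

lemma rho_add: "\<rho> (v + w) = \<rho> v + \<rho> w"
  and rho_scale: "\<rho> (sc f v) = scb (ev f) (\<rho> v)"
  and rho_surj: "surj \<rho>"
  and rho_kernel: "\<rho> v = 0 \<longleftrightarrow> v \<in> span {sc f w | f w. ev f = 0}"
  using restriction unfolding restriction_map_def by blast+

lemma rho_0 [simp]: "\<rho> 0 = 0"
  using rho_add[of 0 0] by simp

lemma rho_diff: "\<rho> (v - w) = \<rho> v - \<rho> w"
  using rho_add[of "v - w" w] by (simp add: algebra_simps)

lemma rho_sum: "\<rho> (sum f A) = (\<Sum>x\<in>A. \<rho> (f x))"
  by (induction A rule: infinite_finite_induct) (simp_all add: rho_add)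

lemma rho_lincomb: "\<rho> (lincomb J b c) = base.lincomb J (\<lambda>j. \<rho> (b j)) (\<lambda>j. ev (c j))"
  by (simp add: lincomb_def base.lincomb_def rho_sum rho_scale)

lemma rho_reg_lincomb:
  "\<rho> (reg.lincomb J b a) = base.reg.lincomb J (\<lambda>j. \<rho> (b j)) (\<lambda>j. fps_map (eval_b cf) (a j))"
  by (simp add: reg_lincomb base.reg_lincomb rho_lincomb ev_fps)

text \<open>
  The sections all of whose coordinates vanish at the closed point form a submodule that contains the generators
  of the kernel of \<open>\<rho>\<close>.
\<close>

lemma rho_zero_coordinates:
  assumes "frame sc H J b" "\<rho> (lincomb J b c) = 0" "j \<in> J"
  shows "ev (c j) = 0"
proof -
  have "\<exists>c. v = lincomb J b c \<and> (\<forall>j\<in>J. ev (c j) = 0)" if "v \<in> span {sc f w | f w. ev f = 0}" for v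
    using that
  proof (induction rule: span_induct_alt)
    case base
    show ?case by (rule exI[of _ "\<lambda>_. 0"]) (simp add: lincomb_zero)
  next
    case (step x v w)
    obtain f u where v: "v = sc f u" "ev f = 0" using step by blast
    obtain d where u: "u = lincomb J b d" using assms(1) by (auto simp: frame_def)
    obtain d' where w: "w = lincomb J b d'" "\<forall>j\<in>J. ev (d' j) = 0" using step by blast
    have "sc x v + w = lincomb J b (\<lambda>j. x * (f * d j) + d' j)"
      by (simp only: v u w lincomb_scale lincomb_add)
    moreover have "\<forall>j\<in>J. ev (x * (f * d j) + d' j) = 0" using v w by (simp add: ev_add ev_mult)
    ultimately show ?case by blast
  qed
  then obtain d where "lincomb J b c = lincomb J b d" "\<forall>j\<in>J. ev (d j) = 0"
    using assms(2) rho_kernel by blast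
  then show ?thesis
    using lincomb_eqD[of J b c d j] assms by (simp add: frame_def)
qed

text \<open>
  Coefficients over \<open>k\<close> lift to constants, so a relation at the closed point lifts to a section in the kernel of
  \<open>\<rho>\<close>.
\<close>

lemma rho_frame:
  assumes "frame sc H J b" shows "frame scb (\<rho> ` H) J (\<lambda>j. \<rho> (b j))"
  unfolding frame_def
proof (intro conjI allI)
  show "base.indep J (\<lambda>j. \<rho> (b j))"
    unfolding base.indep_def
  proof (intro conjI allI impI ballI)
    show "finite J" using assms by (simp add: frame_def indep_def)
    fix c j assume "base.lincomb J (\<lambda>j. \<rho> (b j)) c = 0" "j \<in> J"
    then have "\<rho> (lincomb J b (\<lambda>j. fls_map cst (c j))) = 0" by (simp add: rho_lincomb ev_lift)
    from rho_zero_coordinates[OF assms this \<open>j \<in> J\<close>] show "c j = 0" by (simp add: ev_lift)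
  qed
next
  fix w
  obtain v where "w = \<rho> v" using rho_surj by blast
  moreover obtain c where "v = lincomb J b c" using assms by (auto simp: frame_def)
  ultimately show "\<exists>c. w = base.lincomb J (\<lambda>j. \<rho> (b j)) c" by (auto simp: rho_lincomb)
next
  show "\<rho> ` H = range (\<lambda>a. base.lincomb J (\<lambda>j. \<rho> (b j)) (\<lambda>j. fps_to_fls (a j)))"
  proof (intro set_eqI iffI)
    fix w assume "w \<in> \<rho> ` H"
    then obtain a where "w = \<rho> (lincomb J b (\<lambda>j. fps_to_fls (a j)))" using assms by (auto simp: frame_def)
    then show "w \<in> range (\<lambda>a. base.lincomb J (\<lambda>j. \<rho> (b j)) (\<lambda>j. fps_to_fls (a j)))"
      by (simp add: rho_lincomb ev_fps)
  next
    fix w assume "w \<in> range (\<lambda>a. base.lincomb J (\<lambda>j. \<rho> (b j)) (\<lambda>j. fps_to_fls (a j)))"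
    then obtain a where "w = base.lincomb J (\<lambda>j. \<rho> (b j)) (\<lambda>j. fps_to_fls (a j))" by blast
    then have "w = \<rho> (lincomb J b (\<lambda>j. fps_to_fls (fps_map cst (a j))))"
      by (simp add: rho_lincomb ev_lift flip: fls_map_fps_to_fls)
    then show "w \<in> \<rho> ` H" using assms by (auto simp: frame_def)
  qed
qed

lemma mm_lift: "mm J (\<lambda>a b. fps_map cst (P a b)) (\<lambda>a b. fps_map cst (P' a b)) i j = fps_map cst (mm J P P' i j)"
  by (rule fps_ext) (simp add: mm_def fps_sum_nth fps_mult_nth cst_sum cst_mult)

text \<open>
  The transition matrix at the closed point is invertible over \<open>k[[u]]\<close>, and it stays invertible as a matrix of constants
  over \<open>R[[u]]\<close>.
\<close>

lemma lift_frame: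
  assumes "frame sc H J b" "frame scb (\<rho> ` H) L w"
  shows "\<exists>s. frame sc H L s \<and> (\<forall>l\<in>L. \<rho> (s l) = w l)"
proof -
  obtain P P' where P: "\<forall>l\<in>L. w l = base.reg.lincomb J (\<lambda>j. \<rho> (b j)) (\<lambda>j. P j l)"
    and PP': "\<forall>i\<in>J. \<forall>j\<in>J. mm L P P' i j = one_mat i j" and P'P: "\<forall>i\<in>L. \<forall>j\<in>L. mm J P' P i j = one_mat i j"
    using base.transition_matrices[OF rho_frame[OF assms(1)] assms(2)] by blast
  define s where "s = (\<lambda>l. reg.lincomb J b (\<lambda>j. fps_map cst (P j l)))"
  have "frame sc H L s"
  proof (rule frame_change[OF assms(1)])
    show "finite L" using assms(2) by (simp add: frame_def base.indep_def)
    show "mm L (\<lambda>j l. fps_map cst (P j l)) (\<lambda>j l. fps_map cst (P' j l)) i j = one_mat i j"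
      if "i \<in> J" "j \<in> J" for i j
      unfolding mm_lift using PP' that by (auto simp: one_mat_def intro!: fps_ext)
    show "mm J (\<lambda>j l. fps_map cst (P' j l)) (\<lambda>j l. fps_map cst (P j l)) i j = one_mat i j"
      if "i \<in> L" "j \<in> L" for i j
      unfolding mm_lift using P'P that by (auto simp: one_mat_def intro!: fps_ext)
  qed (simp add: s_def)
  moreover have "\<rho> (s l) = w l" if "l \<in> L" for l
  proof -
    have "fps_map (eval_b cf) (fps_map cst a) = a" for a
      by (rule fps_ext) (simp add: eval_b_def)
    then show ?thesis using P that by (simp add: s_def rho_reg_lincomb)
  qed
  ultimately show ?thesis by blast
qed

text \<open>
  An operator whose derivation preserves the kernel of the evaluation maps sections that vanish at the point to such
  sections, as can be seen on coordinates.
\<close>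

lemma restrict_op_rho:
  assumes "frame sc H J b" "covariant_derivative sc \<delta> D" "\<And>f. ev f = 0 \<Longrightarrow> ev (\<delta> f) = 0"
  shows "restrict_op \<rho> D (\<rho> v) = \<rho> (D v)"
proof -
  have Dadd: "D (v + w) = D v + D w" and Dsc: "D (sc f v) = sc (\<delta> f) v + sc f (D v)" for f v w
    using assms(2) by (auto simp: covariant_derivative_def)
  have ker: "\<rho> (D v) = 0" if "\<rho> v = 0" for v
  proof -
    obtain c where v: "v = lincomb J b c" using assms(1) by (auto simp: frame_def)
    have c: "ev (c j) = 0" if "j \<in> J" for j
      using rho_zero_coordinates[OF assms(1)] \<open>\<rho> v = 0\<close> v that by blast
    have "D v = (\<Sum>j\<in>J. sc (\<delta> (c j)) (b j) + sc (c j) (D (b j)))"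
      by (simp add: v lincomb_def additive_zero_sum(2)[of D, OF Dadd] Dsc)
    then show ?thesis using c assms(3) by (simp add: rho_sum rho_add rho_scale)
  qed
  have Ddiff: "D (v - w) = D v - D w" for v w
    using Dadd[of "v - w" w] by (simp add: algebra_simps)
  have well: "\<rho> (D v) = \<rho> (D w)" if "\<rho> v = \<rho> w" for v w
    using ker[of "v - w"] that by (simp add: rho_diff Ddiff)
  define N where "N = (\<lambda>x. \<rho> (D (SOME v. \<rho> v = x)))"
  have N: "\<forall>v. N (\<rho> v) = \<rho> (D v)"
    unfolding N_def by (metis (mono_tags, lifting) someI well)
  have "restrict_op \<rho> D = N"
    unfolding restrict_op_def
  proof (rule the_equality)
    fix N' assume "\<forall>v. N' (\<rho> v) = \<rho> (D v)"
    then show "N' = N" using N rho_surj by (metis (no_types, lifting) ext surj_def)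
  qed (rule N)
  then show ?thesis using N by simp
qed

end


section \<open>The regular operators of a logarithmic F-bundle\<close>

lemma fls_map_X_power_const:
  fixes \<phi> :: "'a::comm_ring_1 \<Rightarrow> 'a"
  assumes "\<phi> 0 = 0"
  shows "fls_map \<phi> (fls_X ^ n * fls_const a) = fls_X ^ n * fls_const (\<phi> a)"
  by (rule fls_eqI) (simp add: fls_map_nth assms fls_X_power_times_conv_shift)

lemma fls_X_cancel:
  shows fls_X_inv_mult_X: "fls_X_inv * fls_X = (1 :: 'a::comm_ring_1 fls)"
    and fls_X_mult_X_inv: "fls_X * fls_X_inv = (1 :: 'a fls)"
    and "fls_X_inv ^ 2 * fls_X ^ 2 = (1 :: 'a fls)"
    and "fls_X ^ 2 * fls_X_inv ^ 2 = (1 :: 'a fls)"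
    and "fls_X_inv ^ 2 * fls_X = (fls_X_inv :: 'a fls)"
    and "fls_X ^ 2 * fls_X_inv = (fls_X :: 'a fls)"
proof -
  show 1: "fls_X_inv * fls_X = (1 :: 'a fls)"
    by (rule fls_eqI) (simp add: fls_X_inv_times_conv_shift)
  then show 2: "fls_X * fls_X_inv = (1 :: 'a fls)" by (simp add: mult.commute)
  show "fls_X_inv ^ 2 * fls_X ^ 2 = (1 :: 'a fls)" "fls_X ^ 2 * fls_X_inv ^ 2 = (1 :: 'a fls)"
    by (simp_all only: 1 2 power_one flip: power_mult_distrib)
  show "fls_X_inv ^ 2 * fls_X = (fls_X_inv :: 'a fls)" "fls_X ^ 2 * fls_X_inv = (fls_X :: 'a fls)"
    by (simp_all add: power2_eq_square mult.assoc 1 2)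
qed

locale f_bundle = power_series_ring "Q \<union> T" cf + laurent_module sc
  for Q T :: "'i set" and cf :: "'r::comm_ring_1 \<Rightarrow> ('i \<Rightarrow>\<^sub>0 nat) \<Rightarrow> 'k::field_char_0"
    and sc :: "'r fls \<Rightarrow> 'v::ab_group_add \<Rightarrow> 'v" +
  fixes H :: "'v set" and nu :: "'v \<Rightarrow> 'v" and nx :: "'i \<Rightarrow> 'v \<Rightarrow> 'v"
  assumes log_F: "log_F_bundle cf Q T sc H nu nx"
begin

lemma nu_cov: "covariant_derivative sc fls_deriv nu"
  and nx_cov: "i \<in> Q \<union> T \<Longrightarrow> covariant_derivative sc (fls_map (log_field cf Q i)) (nx i)"
  and nu_nx: "i \<in> Q \<union> T \<Longrightarrow> nu (nx i v) = nx i (nu v)"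
  and nx_nx: "i \<in> Q \<union> T \<Longrightarrow> j \<in> Q \<union> T \<Longrightarrow> nx i (nx j v) = nx j (nx i v)"
  and nu_regular: "h \<in> H \<Longrightarrow> sc (fls_X ^ 2) (nu h) \<in> H"
  and nx_regular: "i \<in> Q \<union> T \<Longrightarrow> h \<in> H \<Longrightarrow> sc fls_X (nx i h) \<in> H"
  using log_F unfolding log_F_bundle_def by blast+

lemma nu_add: "nu (v + w) = nu v + nu w"
  and nu_scale: "nu (sc f v) = sc (fls_deriv f) v + sc f (nu v)"
  using nu_cov by (auto simp: covariant_derivative_def)

lemma nx_add: "i \<in> Q \<union> T \<Longrightarrow> nx i (v + w) = nx i v + nx i w"
  and nx_scale: "i \<in> Q \<union> T \<Longrightarrow> nx i (sc f v) = sc (fls_map (log_field cf Q i) f) v + sc f (nx i v)"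
  using nx_cov[of i] by (auto simp: covariant_derivative_def)

text \<open>
  The factor that turns the \<open>i\<close>-th logarithmic frame field into \<open>x_i \<partial>/\<partial>x_i\<close>.
\<close>

definition chi :: "'i \<Rightarrow> 'r" where
  "chi i = (if i \<in> Q then 1 else coord cf i)"

text \<open>
  \<open>u \<nabla>\<close> along \<open>x_i \<partial>/\<partial>x_i\<close>; \<open>eulerD\<close> is \<open>u \<nabla>\<close> along the Euler field and \<open>irrD\<close> is \<open>u\<^sup>2 \<nabla>\<close> along \<open>\<partial>/\<partial>u\<close>.
\<close>

definition logD :: "'i \<Rightarrow> 'v \<Rightarrow> 'v" where
  "logD i v = sc (fls_X * fls_const (chi i)) (nx i v)"

definition eulerD :: "'v \<Rightarrow> 'v" where
  "eulerD v = (\<Sum>i\<in>Q \<union> T. logD i v)"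

definition irrD :: "'v \<Rightarrow> 'v" where
  "irrD v = sc (fls_X ^ 2) (nu v)"

lemma log_field_0 [simp]: "i \<in> Q \<union> T \<Longrightarrow> log_field cf Q i 0 = 0"
  by (auto simp: log_field_def)

lemma chi_log_field: "chi i * log_field cf Q i f = theta i f"
  by (simp add: chi_def log_field_def theta_def)

lemma theta_0 [simp]: "theta i 0 = 0" if "i \<in> Q \<union> T"
  using theta_add[OF that, of 0 0] by simp

lemma log_field_chi_other:
  assumes "i \<in> Q \<union> T" "j \<in> Q \<union> T" "i \<noteq> j" shows "log_field cf Q i (chi j) = 0"
proof -
  have "pderiv_coord cf i (chi j) = 0"
    using assms pderiv_coord_other[of i j] pderiv_cst[of i 1] by (auto simp: chi_def)
  then show ?thesis by (simp add: log_field_def)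
qed

lemma log_field_one: "i \<in> Q \<union> T \<Longrightarrow> log_field cf Q i 1 = 0"
  using pderiv_cst[of i 1] by (simp add: log_field_def)

lemma logD_cov:
  assumes "i \<in> Q \<union> T" shows "covariant_derivative sc (\<lambda>f. fls_X * fls_map (theta i) f) (logD i)"
proof -
  have "fls_const (chi i) * fls_map (log_field cf Q i) f = fls_map (theta i) f" for f
    using assms by (intro fls_eqI) (simp add: fls_map_nth chi_log_field)
  then have "fls_X * fls_const (chi i) * fls_map (log_field cf Q i) f = fls_X * fls_map (theta i) f" for f
    by (simp add: mult.assoc)
  then show ?thesis
    using assms by (simp add: covariant_derivative_def logD_def nx_add nx_scale scale_right_distrib mult.commute)
qed

lemma irrD_cov: "covariant_derivative sc (\<lambda>f. fls_X ^ 2 * fls_deriv f) irrD"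
  by (simp add: covariant_derivative_def irrD_def nu_add nu_scale scale_right_distrib mult.commute)

lemma logD_logD:
  assumes i: "i \<in> Q \<union> T" and j: "j \<in> Q \<union> T"
  shows "logD i (logD j v) = logD j (logD i v)"
proof (cases "i = j")
  case False
  have comp: "logD i (logD j v) = sc (fls_X * fls_const (chi i) * (fls_X * fls_const (chi j))) (nx i (nx j v))"
    if "i \<in> Q \<union> T" "j \<in> Q \<union> T" "i \<noteq> j" for i j
    using that fls_map_X_power_const[of "log_field cf Q i" 1 "chi j"]
    by (simp add: logD_def nx_scale log_field_chi_other)
  show ?thesis
    using comp[OF i j False] comp[OF j i] False nx_nx[OF i j] by (simp add: mult.commute)
qed simp

text \<open>
  The covariant derivatives commute; the right-hand side comes from \<open>u\<^sup>2 \<partial>/\<partial>u\<close> acting on the factor \<open>u\<close>.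
\<close>

lemma irrD_logD:
  assumes i: "i \<in> Q \<union> T"
  shows "irrD (logD i v) - logD i (irrD v) = sc fls_X (logD i v)"
proof -
  have "irrD (logD i v) = sc (fls_X ^ 2 * fls_const (chi i)) (nx i v)
      + sc (fls_X ^ 2 * (fls_X * fls_const (chi i))) (nu (nx i v))"
    by (simp add: irrD_def logD_def nu_scale scale_right_distrib)
  moreover have "logD i (irrD v) = sc (fls_X * fls_const (chi i) * fls_X ^ 2) (nx i (nu v))"
    using i fls_map_X_power_const[of "log_field cf Q i" 2 1]
    by (simp add: irrD_def logD_def nx_scale log_field_one)
  ultimately show ?thesis
    using nu_nx[OF i] by (simp add: logD_def power2_eq_square mult_ac)
qed

lemma logD_add: "i \<in> Q \<union> T \<Longrightarrow> logD i (v + w) = logD i v + logD i w"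
  using logD_cov[of i] by (simp add: covariant_derivative_def)

lemma eulerD_logD: "j \<in> Q \<union> T \<Longrightarrow> eulerD (logD j v) = logD j (eulerD v)"
  by (simp add: eulerD_def additive_zero_sum(2)[of "logD j", OF logD_add] logD_logD)

lemma irrD_eulerD: "irrD (eulerD v) - eulerD (irrD v) = sc fls_X (eulerD v)"
proof -
  have add: "irrD (v + w) = irrD v + irrD w" for v w
    using irrD_cov by (simp add: covariant_derivative_def)
  have "irrD (eulerD v) - eulerD (irrD v) = (\<Sum>i\<in>Q \<union> T. irrD (logD i v) - logD i (irrD v))"
    by (simp add: eulerD_def additive_zero_sum(2)[of irrD, OF add] sum_subtractf)
  then show ?thesis by (simp add: irrD_logD scale_sum_right eulerD_def)
qed

lemma eulerD_cov: "covariant_derivative sc (\<lambda>f. fls_X * fls_map euler f) eulerD"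
proof -
  have "fls_map euler f = (\<Sum>i\<in>Q \<union> T. fls_map (theta i) f)" for f
  proof (rule fls_eqI)
    fix n
    have nth: "fls_nth (sum g A) n = (\<Sum>i\<in>A. fls_nth (g i) n)" for g :: "'i \<Rightarrow> 'r fls" and A
      by (induction A rule: infinite_finite_induct) simp_all
    show "fls_nth (fls_map euler f) n = fls_nth (\<Sum>i\<in>Q \<union> T. fls_map (theta i) f) n"
      by (simp add: nth fls_map_nth euler_def)
  qed
  then show ?thesis
    using logD_cov
    by (simp add: covariant_derivative_def eulerD_def sum.distrib scale_sum_left scale_sum_right sum_distrib_left)
qed

lemma euler_0 [simp]: "euler 0 = 0"
  by (simp add: euler_def)

lemma reg_cov:
  shows irrD_reg: "covariant_derivative reg_scale (\<lambda>a. fps_X ^ 2 * fps_deriv a) irrD"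
    and eulerD_reg: "covariant_derivative reg_scale (\<lambda>a. fps_X * fps_map euler a) eulerD"
    and logD_reg: "i \<in> Q \<union> T \<Longrightarrow> covariant_derivative reg_scale (\<lambda>a. fps_X * fps_map (theta i) a) (logD i)"
  by (rule covariant_derivative_reg,
      (rule irrD_cov eulerD_cov logD_cov; assumption?),
      simp add: fls_deriv_fps_to_fls fps_to_fls_mult fps_to_fls_power fps_to_fls_X fls_map_fps_to_fls)+

lemma logD_lattice:
  assumes "frame sc H J b" "i \<in> Q \<union> T" "h \<in> H" shows "logD i h \<in> H"
proof -
  have "reg_scale (fps_const (chi i)) (sc fls_X (nx i h)) \<in> H"
    using frame_scale[OF assms(1)] nx_regular assms by blast
  then show ?thesis by (simp add: reg_scale_def logD_def mult.commute)
qed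

lemma irrD_lattice: "h \<in> H \<Longrightarrow> irrD h \<in> H"
  by (simp add: irrD_def nu_regular)

lemma logD_matrix:
  assumes "frame sc H J b" "i \<in> Q \<union> T"
  shows "\<exists>A. \<forall>j\<in>J. logD i (b j) = reg.lincomb J b (\<lambda>l. A l j)"
  by (rule frame_matrix[OF assms(1)]) (use logD_lattice[OF assms] frame_in[OF assms(1)] in blast)

lemma irrD_matrix:
  assumes "frame sc H J b"
  shows "\<exists>U. \<forall>j\<in>J. irrD (b j) = reg.lincomb J b (\<lambda>l. U l j)"
  by (rule frame_matrix[OF assms(1)]) (use irrD_lattice frame_in[OF assms(1)] in blast)

lemma eulerD_matrix:
  assumes "\<And>i j. i \<in> Q \<union> T \<Longrightarrow> j \<in> J \<Longrightarrow> logD i (b j) = reg.lincomb J b (\<lambda>l. A i l j)" "j \<in> J"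
  shows "eulerD (b j) = reg.lincomb J b (\<lambda>l. \<Sum>i\<in>Q \<union> T. A i l j)"
proof -
  have "eulerD (b j) = (\<Sum>i\<in>Q \<union> T. \<Sum>l\<in>J. reg_scale (A i l j) (b l))"
    using assms by (simp add: eulerD_def reg.lincomb_def)
  also have "\<dots> = (\<Sum>l\<in>J. \<Sum>i\<in>Q \<union> T. reg_scale (A i l j) (b l))" by (rule sum.swap)
  finally show ?thesis by (simp add: reg.lincomb_def reg.scale_sum_left)
qed

text \<open>
  The relation \<open>[irrD, eulerD] = u eulerD\<close> is the flatness equation from which the nilpotency at the closed point
  was derived.
\<close>

lemma euler_residue_nilpotent:
  assumes f: "frame sc H J b"
    and A: "\<And>j. j \<in> J \<Longrightarrow> eulerD (b j) = reg.lincomb J b (\<lambda>l. A l j)"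
    and A0: "\<And>a b k. a \<in> J \<Longrightarrow> b \<in> J \<Longrightarrow> k > 0 \<Longrightarrow> cf (fps_nth (A a b) k) 0 = 0"
  shows "nilpotent_mat J (\<lambda>a b. cf (fps_nth (A a b) 0) 0)"
proof -
  obtain U where U: "\<forall>j\<in>J. irrD (b j) = reg.lincomb J b (\<lambda>l. U l j)"
    using irrD_matrix[OF f] by blast
  have ind: "reg.indep J b" using f by (rule frame_reg_indep)
  show ?thesis
  proof (rule residue_nilpotent[OF _ _ A0])
    show "finite J" using ind by (simp add: reg.indep_def)
    fix i j assume "i \<in> J" "j \<in> J"
    then show "fps_X ^ 2 * fps_deriv (A i j) + mm J U A i j
        - (fps_X * fps_map euler (U i j) + mm J A U i j) = fps_X * A i j"
      using U A irrD_eulerD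
      by (intro reg.curvature_matrix[OF ind irrD_reg eulerD_reg]) (simp_all add: reg_scale_def fps_to_fls_X)
  qed
qed

text \<open>
  The flat frames of framings. Poles in \<open>u\<close> are cleared, and \<open>x_i \<partial>/\<partial>x_i\<close> replaces the logarithmic
  frame field in every direction.
\<close>

definition normal_frame :: "'j set \<Rightarrow> ('j \<Rightarrow> 'v) \<Rightarrow> bool" where
  "normal_frame J b \<longleftrightarrow> frame sc H J b \<and>
     (\<exists>K G. \<forall>j\<in>J. irrD (b j) = reg.lincomb J b (\<lambda>l. fps_const (K l j) + fps_X * fps_const (G l j))) \<and>
     (\<forall>i\<in>Q \<union> T. \<exists>A. \<forall>j\<in>J. logD i (b j) = reg.lincomb J b (\<lambda>l. fps_const (A l j)))"

text \<open>
  For a coordinate that does not define a component of \<open>D\<close>, the factor \<open>x_i\<close> has to be removed again; it is not a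
  zero divisor, so independence of \<open>u\<close> survives.
\<close>

lemma reg_nx_constant:
  assumes f: "frame sc H J b" and i: "i \<in> Q \<union> T"
    and A: "\<forall>j\<in>J. logD i (b j) = reg.lincomb J b (\<lambda>l. fps_const (A l j))"
  shows "\<exists>B. \<forall>j\<in>J. sc fls_X (nx i (b j)) = reg.lincomb J b (\<lambda>l. fps_const (B l j))"
proof -
  have ind: "reg.indep J b" using f by (rule frame_reg_indep)
  obtain B where B: "\<forall>j\<in>J. sc fls_X (nx i (b j)) = reg.lincomb J b (\<lambda>l. B l j)"
    using frame_matrix[OF f, of J "\<lambda>j. sc fls_X (nx i (b j))"] nx_regular[OF i] frame_in[OF f] by blast
  have "B l j = fps_const (fps_nth (B l j) 0)" if lj: "l \<in> J" "j \<in> J" for l j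
  proof -
    have "reg.lincomb J b (\<lambda>l. fps_const (chi i) * B l j) = reg_scale (fps_const (chi i)) (sc fls_X (nx i (b j)))"
      using B lj by (simp add: reg.lincomb_scale)
    also have "\<dots> = logD i (b j)"
      by (simp add: reg_scale_def logD_def mult.commute)
    also have "\<dots> = reg.lincomb J b (\<lambda>l. fps_const (A l j))" using A lj by blast
    finally have eq: "fps_const (chi i) * B l j = fps_const (A l j)"
      by (rule reg.lincomb_eqD[OF ind _ lj(1)])
    have 0: "chi i * fps_nth (B l j) k = 0" if "k > 0" for k
    proof -
      have "fps_nth (fps_const (chi i) * B l j) k = fps_nth (fps_const (A l j)) k" by (simp only: eq)
      then show ?thesis using that by simp
    qed
    have "fps_nth (B l j) k = 0" if "k > 0" for k
    proof (cases "i \<in> Q")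
      case False
      then show ?thesis using 0[OF that] coord_mult_cancel[OF i, of _ 0] by (simp add: chi_def)
    qed (use 0[OF that] in \<open>simp add: chi_def\<close>)
    then show ?thesis by (intro fps_ext) simp
  qed
  then have "\<forall>j\<in>J. sc fls_X (nx i (b j)) = reg.lincomb J b (\<lambda>l. fps_const (fps_nth (B l j) 0))"
    using B by (auto intro!: reg.lincomb_cong)
  then show ?thesis by (rule exI[where P = "\<lambda>B. \<forall>j\<in>J. _ j = reg.lincomb J b (\<lambda>l. fps_const (B l j))"])
qed

lemma nu_from_irrD: "irrD v = w \<Longrightarrow> nu v = sc (fls_X_inv ^ 2) w"
  by (auto simp: irrD_def fls_X_cancel)

text \<open>
  The framing is differentiation of coordinates with respect to the frame.
\<close>

lemma framing_of_normal_frame: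
  assumes "normal_frame J b"
  shows "\<exists>fu fx. framing cf Q T sc H nu nx fu fx \<and> (\<forall>c. fu (lincomb J b c) = lincomb J b (\<lambda>j. fls_deriv (c j)))"
proof -
  have f: "frame sc H J b" using assms by (simp add: normal_frame_def)
  have inj: "inj_on b J" by (rule frame_inj[OF f])
  have span: "\<exists>c. v = lincomb J b c" for v using f by (simp add: frame_def)
  \<comment> \<open>In the definition of a framing, matrices are indexed by the basis itself.\<close>
  define inv where "inv = the_inv_into J b"
  have inv: "inv (b j) = j" if "j \<in> J" for j
    using that inj by (simp add: inv_def the_inv_into_f_f)
  obtain fu where fu: "covariant_derivative sc fls_deriv fu"
      "\<And>c. fu (lincomb J b c) = lincomb J b (\<lambda>j. fls_deriv (c j))"
    using flat_connection_exists[OF f, of fls_deriv] by auto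
  have "\<exists>D. covariant_derivative sc (fls_map (pderiv_coord cf i)) D \<and>
      (\<forall>c. D (lincomb J b c) = lincomb J b (\<lambda>j. fls_map (pderiv_coord cf i) (c j)))" if "i \<in> Q \<union> T" for i
    using that by (intro flat_connection_exists[OF f])
      (auto intro!: fls_map_add fls_map_derivation simp: pderiv_add pderiv_mult)
  then obtain fx where fx: "\<And>i. i \<in> Q \<union> T \<Longrightarrow> covariant_derivative sc (fls_map (pderiv_coord cf i)) (fx i)"
      "\<And>i c. i \<in> Q \<union> T \<Longrightarrow> fx i (lincomb J b c) = lincomb J b (\<lambda>j. fls_map (pderiv_coord cf i) (c j))"
    by metis
  have zero: "fu (b j) = 0 \<and> (\<forall>i\<in>Q \<union> T. fx i (b j) = 0)" if "j \<in> J" for j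
  proof -
    have "finite J" using f by (simp add: frame_def indep_def)
    have b: "b j = lincomb J b (\<lambda>l. if l = j then 1 else 0)"
      using lincomb_single[OF \<open>finite J\<close> that] by simp
    have "fls_map (pderiv_coord cf i) (if l = j then 1 else 0) = 0" if "i \<in> Q \<union> T" for i l
      using that pderiv_cst[of i 1] fls_map_const[of "pderiv_coord cf i" 1]
      by (auto intro!: fls_eqI simp: fls_map_nth)
    then show ?thesis using fu(2) fx(2) by (subst (1 2) b) (simp add: lincomb_zero if_distrib[of fls_deriv] cong: if_cong)
  qed
  have comm1: "fls_deriv (fls_map (pderiv_coord cf i) g) = fls_map (pderiv_coord cf i) (fls_deriv g)"
    if "i \<in> Q \<union> T" for i g
  proof (rule fls_eqI)
    fix n :: int
    have "pderiv_coord cf i (of_int m * x) = of_int m * pderiv_coord cf i x" for m x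
      using that by (intro cf_eqI) (simp add: cf_pderiv cf_of_int_mult)
    from this[of "n + 1"]
    show "fls_nth (fls_deriv (fls_map (pderiv_coord cf i) g)) n = fls_nth (fls_map (pderiv_coord cf i) (fls_deriv g)) n"
      using that by (simp add: fls_map_nth)
  qed
  obtain K G where KG: "\<forall>j\<in>J. irrD (b j) = reg.lincomb J b (\<lambda>l. fps_const (K l j) + fps_X * fps_const (G l j))"
    using assms by (auto simp: normal_frame_def)
  have "\<forall>i\<in>Q \<union> T. \<exists>A. \<forall>j\<in>J. sc fls_X (nx i (b j)) = reg.lincomb J b (\<lambda>l. fps_const (A l j))"
  proof
    fix i assume i: "i \<in> Q \<union> T"
    then obtain A where "\<forall>j\<in>J. logD i (b j) = reg.lincomb J b (\<lambda>l. fps_const (A l j))"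
      using assms unfolding normal_frame_def by blast
    then show "\<exists>A. \<forall>j\<in>J. sc fls_X (nx i (b j)) = reg.lincomb J b (\<lambda>l. fps_const (A l j))"
      by (rule reg_nx_constant[OF f i])
  qed
  then obtain A where A: "\<And>i j. i \<in> Q \<union> T \<Longrightarrow> j \<in> J \<Longrightarrow>
      sc fls_X (nx i (b j)) = reg.lincomb J b (\<lambda>l. fps_const (A i l j))"
    by metis
  have nu: "nu (b j) = (\<Sum>e'\<in>b ` J. sc (fls_X_inv ^ 2 * fls_const (K (inv e') (inv (b j)))
      + fls_X_inv * fls_const (G (inv e') (inv (b j)))) e')" if "j \<in> J" for j
  proof -
    have "nu (b j) = sc (fls_X_inv ^ 2) (lincomb J b (\<lambda>l. fls_const (K l j) + fls_X * fls_const (G l j)))"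
      using KG that nu_from_irrD by (simp add: reg_lincomb fps_to_fls_mult fps_to_fls_X)
    also have "\<dots> = lincomb J b (\<lambda>l. fls_X_inv ^ 2 * fls_const (K l j) + fls_X_inv * fls_const (G l j))"
      by (simp add: lincomb_scale distrib_left fls_X_cancel flip: mult.assoc)
    also have "\<dots> = lincomb (b ` J) (\<lambda>e. e) (\<lambda>e'. fls_X_inv ^ 2 * fls_const (K (inv e') (inv (b j)))
      + fls_X_inv * fls_const (G (inv e') (inv (b j))))"
      unfolding lincomb_image[OF inj] using that by (intro lincomb_cong) (simp_all add: inv)
    finally show ?thesis by (simp add: lincomb_def)
  qed
  have nx: "nx i (b j) = (\<Sum>e'\<in>b ` J. sc (fls_X_inv * fls_const (A i (inv e') (inv (b j)))) e')"
    if "i \<in> Q \<union> T" "j \<in> J" for i j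
  proof -
    have "nx i (b j) = sc fls_X_inv (sc fls_X (nx i (b j)))" by (simp add: fls_X_inv_mult_X)
    also have "\<dots> = lincomb J b (\<lambda>l. fls_X_inv * fls_const (A i l j))"
      using A[OF that] by (simp add: reg_lincomb lincomb_scale)
    also have "\<dots> = lincomb (b ` J) (\<lambda>e. e) (\<lambda>e'. fls_X_inv * fls_const (A i (inv e') (inv (b j))))"
      unfolding lincomb_image[OF inj] using that by (intro lincomb_cong) (simp_all add: inv)
    finally show ?thesis by (simp add: lincomb_def)
  qed
  have "framing cf Q T sc H nu nx fu fx"
    unfolding framing_def
  proof (intro conjI ballI allI)
    fix i v assume i: "i \<in> Q \<union> T"
    obtain c where v: "v = lincomb J b c" using span by blast
    show "fu (fx i v) = fx i (fu v)" by (simp add: v fu(2) fx(2)[OF i] comm1[OF i])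
    fix j assume j: "j \<in> Q \<union> T"
    have "fls_map (pderiv_coord cf i) (fls_map (pderiv_coord cf j) g)
        = fls_map (pderiv_coord cf j) (fls_map (pderiv_coord cf i) g)" for g
      using i j by (intro fls_eqI) (simp add: fls_map_nth pderiv_commute)
    then show "fx i (fx j v) = fx j (fx i v)" by (simp add: v fx(2)[OF i] fx(2)[OF j])
  next
    fix h assume "h \<in> H"
    then obtain a where h: "h = lincomb J b (\<lambda>j. fps_to_fls (a j))" using f by (auto simp: frame_def)
    have "fu h = reg.lincomb J b (\<lambda>j. fps_deriv (a j))"
      by (simp add: h fu(2) reg_lincomb fls_deriv_fps_to_fls)
    then show "fu h \<in> H" using frame_lattice[OF f] by blast
    fix i assume i: "i \<in> Q \<union> T"
    have "fx i h = reg.lincomb J b (\<lambda>j. fps_map (pderiv_coord cf i) (a j))"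
      using i by (simp add: h fx(2) reg_lincomb fls_map_fps_to_fls)
    then show "fx i h \<in> H" using frame_lattice[OF f] by blast
  next
    show "\<exists>E. bundle_basis sc H E \<and> (\<forall>e\<in>E. fu e = 0 \<and> (\<forall>i\<in>Q \<union> T. fx i e = 0)) \<and>
        (\<exists>K G. \<forall>e\<in>E. nu e = (\<Sum>e'\<in>E. sc (fls_X_inv ^ 2 * fls_const (K e' e) + fls_X_inv * fls_const (G e' e)) e')) \<and>
        (\<exists>A. \<forall>i\<in>Q \<union> T. \<forall>e\<in>E. nx i e = (\<Sum>e'\<in>E. sc (fls_X_inv * fls_const (A i e' e)) e'))"
    proof (intro exI[of _ "b ` J"] conjI)
      show "bundle_basis sc H (b ` J)" using frame_image[OF f] by (simp add: frame_id_iff)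
      show "\<forall>e\<in>b ` J. fu e = 0 \<and> (\<forall>i\<in>Q \<union> T. fx i e = 0)" using zero by blast
      show "\<exists>K G. \<forall>e\<in>b ` J. nu e = (\<Sum>e'\<in>b ` J. sc (fls_X_inv ^ 2 * fls_const (K e' e) + fls_X_inv * fls_const (G e' e)) e')"
        by (rule exI[of _ "\<lambda>e' e. K (inv e') (inv e)"], rule exI[of _ "\<lambda>e' e. G (inv e') (inv e)"])
          (use nu in blast)
      show "\<exists>A. \<forall>i\<in>Q \<union> T. \<forall>e\<in>b ` J. nx i e = (\<Sum>e'\<in>b ` J. sc (fls_X_inv * fls_const (A i e' e)) e')"
        by (rule exI[of _ "\<lambda>i e' e. A i (inv e') (inv e)"]) (use nx in blast)
    qed
  qed (use fu fx in auto)
  with fu(2) show ?thesis by blast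
qed

lemma normal_frame_of_framing:
  assumes "framing cf Q T sc H nu nx fu fx"
  shows "\<exists>E. normal_frame E (\<lambda>e. e) \<and> (\<forall>e\<in>E. fu e = 0 \<and> (\<forall>i\<in>Q \<union> T. fx i e = 0))"
proof -
  obtain E K G A where E: "bundle_basis sc H E" and flat: "\<forall>e\<in>E. fu e = 0 \<and> (\<forall>i\<in>Q \<union> T. fx i e = 0)"
    and nu: "\<forall>e\<in>E. nu e = (\<Sum>e'\<in>E. sc (fls_X_inv ^ 2 * fls_const (K e' e) + fls_X_inv * fls_const (G e' e)) e')"
    and nx: "\<forall>i\<in>Q \<union> T. \<forall>e\<in>E. nx i e = (\<Sum>e'\<in>E. sc (fls_X_inv * fls_const (A i e' e)) e')"
    using assms unfolding framing_def by blast
  have irr: "irrD e = reg.lincomb E (\<lambda>e. e) (\<lambda>l. fps_const (K l e) + fps_X * fps_const (G l e))" if "e \<in> E" for e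
  proof -
    have "irrD e = lincomb E (\<lambda>e. e) (\<lambda>e'. fls_X ^ 2 * (fls_X_inv ^ 2 * fls_const (K e' e) + fls_X_inv * fls_const (G e' e)))"
      using nu that unfolding irrD_def lincomb_scale[symmetric] by (simp add: lincomb_def)
    then show ?thesis
      by (simp add: reg_lincomb distrib_left fls_X_cancel fps_to_fls_mult fps_to_fls_X flip: mult.assoc)
  qed
  have log: "logD i e = reg.lincomb E (\<lambda>e. e) (\<lambda>l. fps_const (chi i * A i l e))" if "i \<in> Q \<union> T" "e \<in> E" for i e
  proof -
    have "nx i e = lincomb E (\<lambda>e. e) (\<lambda>e'. fls_X_inv * fls_const (A i e' e))"
      using nx that by (simp add: lincomb_def)
    then have "logD i e = lincomb E (\<lambda>e. e) (\<lambda>e'. (fls_X * fls_const (chi i)) * (fls_X_inv * fls_const (A i e' e)))"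
      by (simp only: logD_def lincomb_scale)
    also have "(\<lambda>e'. (fls_X * fls_const (chi i)) * (fls_X_inv * fls_const (A i e' e))) =
        (\<lambda>e'. (fls_X * fls_X_inv) * (fls_const (chi i) * fls_const (A i e' e)))"
      by (simp add: mult_ac)
    finally show ?thesis by (simp add: reg_lincomb fls_X_mult_X_inv del: fps_const_mult)
  qed
  have "normal_frame E (\<lambda>e. e)"
    unfolding normal_frame_def frame_id_iff
  proof (intro conjI ballI)
    show "\<exists>K G. \<forall>j\<in>E. irrD j = reg.lincomb E (\<lambda>e. e) (\<lambda>l. fps_const (K l j) + fps_X * fps_const (G l j))"
      by (intro exI[of _ K] exI[of _ G] ballI) (rule irr)
    show "\<exists>A. \<forall>j\<in>E. logD i j = reg.lincomb E (\<lambda>e. e) (\<lambda>l. fps_const (A l j))" if "i \<in> Q \<union> T" for i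
      by (intro exI[of _ "\<lambda>l j. chi i * A i l j"] ballI) (rule log[OF that])
  qed (rule E)
  with flat show ?thesis by blast
qed

end


context f_bundle
begin

lemma normal_frame_eulerD:
  assumes "normal_frame J b"
  shows "\<exists>A. \<forall>j\<in>J. eulerD (b j) = reg.lincomb J b (\<lambda>l. fps_const (A l j))"
proof -
  have "\<forall>i\<in>Q \<union> T. \<exists>A. \<forall>j\<in>J. logD i (b j) = reg.lincomb J b (\<lambda>l. fps_const (A l j))"
    using assms by (simp add: normal_frame_def)
  then obtain A where A: "\<And>i j. i \<in> Q \<union> T \<Longrightarrow> j \<in> J \<Longrightarrow>
      logD i (b j) = reg.lincomb J b (\<lambda>l. fps_const (A i l j))" by metis
  have "(\<Sum>i\<in>Q \<union> T. fps_const (A i l j)) = fps_const (\<Sum>i\<in>Q \<union> T. A i l j)" for l j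
    by (rule fps_ext) (simp add: fps_sum_nth)
  then have "\<forall>j\<in>J. eulerD (b j) = reg.lincomb J b (\<lambda>l. fps_const (\<Sum>i\<in>Q \<union> T. A i l j))"
    using eulerD_matrix[of J b "\<lambda>i l j. fps_const (A i l j)", OF A] by simp
  then show ?thesis by (rule exI[where P = "\<lambda>B. \<forall>j\<in>J. eulerD (b j) = reg.lincomb J b (\<lambda>l. fps_const (B l j))"])
qed

text \<open>
  The Euler directions of the two frames give \<open>u \<theta> g + A g = g A'\<close> with \<open>A\<close> and \<open>A'\<close> independent of \<open>u\<close>. The positive
  part of \<open>g\<close> in \<open>u\<close> vanishes at the closed point, hence everywhere. Then the coefficient of \<open>u\<close> is the
  equation \<open>\<theta> g = 0\<close>.
\<close>

lemma normal_frames_transition_constant: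
  assumes nb: "normal_frame J b" and nb': "normal_frame L b'"
    and g: "\<And>l. l \<in> L \<Longrightarrow> b' l = reg.lincomb J b (\<lambda>j. g j l)"
    and g0: "\<And>j l k. j \<in> J \<Longrightarrow> l \<in> L \<Longrightarrow> k > 0 \<Longrightarrow> cf (fps_nth (g j l) k) 0 = 0"
    and jl: "j \<in> J" "l \<in> L"
  shows "\<exists>c. g j l = fps_const (cst c)"
proof -
  have f: "frame sc H J b" and f': "frame sc H L b'"
    using nb nb' by (simp_all add: normal_frame_def)
  obtain A where A: "\<forall>j\<in>J. eulerD (b j) = reg.lincomb J b (\<lambda>l. fps_const (A l j))"
    using normal_frame_eulerD[OF nb] by blast
  obtain A' where A': "\<forall>j\<in>L. eulerD (b' j) = reg.lincomb L b' (\<lambda>l. fps_const (A' l j))"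
    using normal_frame_eulerD[OF nb'] by blast
  have nil: "nilpotent_mat J (\<lambda>a b. cf (A a b) 0)" "nilpotent_mat L (\<lambda>a b. cf (A' a b) 0)"
    using euler_residue_nilpotent[OF f, of "\<lambda>l j. fps_const (A l j)"] A
      euler_residue_nilpotent[OF f', of "\<lambda>l j. fps_const (A' l j)"] A' by simp_all
  have gauge: "fps_X * fps_map euler (g j l) + mm J (\<lambda>i j. fps_const (A i j)) g j l
      = mm L g (\<lambda>i j. fps_const (A' i j)) j l" if "j \<in> J" "l \<in> L" for j l
    by (rule reg.gauge_transformation[OF frame_reg_indep[OF f] eulerD_reg _ g _ that])
      (simp_all add: A A')
  have eq: "euler (fps_nth (g j l) k) + mm J A (\<lambda>j l. fps_nth (g j l) (Suc k)) j l
      - mm L (\<lambda>j l. fps_nth (g j l) (Suc k)) A' j l = 0" if "j \<in> J" "l \<in> L" for j l k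
    using arg_cong[OF gauge[OF that], of "\<lambda>f. fps_nth f (Suc k)"]
    by (simp add: fps_nth_mm_const_left fps_nth_mm_const_right)
  have pos: "fps_nth (g j l) (Suc k) = 0" if "j \<in> J" "l \<in> L" for j l k
    using euler_equation_unique[where X = "\<lambda>k j l. fps_nth (g j l) (Suc k)", OF nil eq] g0 that
    by simp
  have "euler (fps_nth (g j l) 0) = 0"
    using eq[OF jl, of 0] pos jl by (simp add: mm_def)
  then have "fps_nth (g j l) 0 = cst (cf (fps_nth (g j l) 0) 0)" by (rule euler_zero_imp_cst)
  moreover have "g j l = fps_const (fps_nth (g j l) 0)"
  proof (rule fps_ext)
    show "fps_nth (g j l) n = fps_nth (fps_const (fps_nth (g j l) 0)) n" for n
      using pos[OF jl] by (cases n) simp_all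
  qed
  ultimately show ?thesis by metis
qed

text \<open>
  Flatness with respect to the Euler direction is \<open>u \<theta> A_i + [B, A_i] = u \<theta>_i B\<close> and
  \<open>u \<theta> U + [B, U] = - u B\<close>. The right-hand sides are of degree \<open>1\<close> in \<open>u\<close>, so the coefficients of \<open>A_i\<close> in degrees
  above \<open>0\<close> and those of \<open>U\<close> in degrees above \<open>1\<close> solve the homogeneous equation.
\<close>

lemma normal_frame_of_constant_euler:
  assumes f: "frame sc H J b"
    and B: "\<And>j. j \<in> J \<Longrightarrow> eulerD (b j) = reg.lincomb J b (\<lambda>l. fps_const (B l j))"
    and U: "\<And>j. j \<in> J \<Longrightarrow> irrD (b j) = reg.lincomb J b (\<lambda>l. U l j)"
    and U0: "\<And>i j k. i \<in> J \<Longrightarrow> j \<in> J \<Longrightarrow> k > 1 \<Longrightarrow> cf (fps_nth (U i j) k) 0 = 0"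
    and A: "\<And>i j. i \<in> Q \<union> T \<Longrightarrow> j \<in> J \<Longrightarrow> logD i (b j) = reg.lincomb J b (\<lambda>l. A i l j)"
    and A0: "\<And>i l j k. i \<in> Q \<union> T \<Longrightarrow> l \<in> J \<Longrightarrow> j \<in> J \<Longrightarrow> k > 0 \<Longrightarrow> cf (fps_nth (A i l j) k) 0 = 0"
  shows "normal_frame J b"
proof -
  have ind: "reg.indep J b" using f by (rule frame_reg_indep)
  have nil: "nilpotent_mat J (\<lambda>a b. cf (B a b) 0)"
    using euler_residue_nilpotent[OF f, of "\<lambda>l j. fps_const (B l j)"] B by simp
  have Aconst: "A i l j = fps_const (fps_nth (A i l j) 0)" if i: "i \<in> Q \<union> T" and lj: "l \<in> J" "j \<in> J" for i l j
  proof -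
    have flat: "fps_X * fps_map euler (A i l j) + mm J (\<lambda>i j. fps_const (B i j)) (A i) l j
        - (fps_X * fps_map (theta i) (fps_const (B l j)) + mm J (A i) (\<lambda>i j. fps_const (B i j)) l j) = 0 * A i l j"
      if "l \<in> J" "j \<in> J" for l j
      using that eulerD_logD[OF i] B A[OF i]
      by (intro reg.curvature_matrix[OF ind eulerD_reg logD_reg[OF i]]) simp_all
    have eq: "euler (fps_nth (A i l j) (Suc k)) + mm J B (\<lambda>l j. fps_nth (A i l j) (Suc (Suc k))) l j
        - mm J (\<lambda>l j. fps_nth (A i l j) (Suc (Suc k))) B l j = 0" if "l \<in> J" "j \<in> J" for l j k
      using arg_cong[OF flat[OF that], of "\<lambda>f. fps_nth f (Suc (Suc k))"] i
      by (simp add: fps_nth_mm_const_left fps_nth_mm_const_right)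
    have pos: "fps_nth (A i l j) (Suc k) = 0" for k
      using euler_equation_unique[where X = "\<lambda>k l j. fps_nth (A i l j) (Suc k)", OF nil nil eq] A0[OF i] lj
      by simp
    show ?thesis
    proof (rule fps_ext)
      show "fps_nth (A i l j) n = fps_nth (fps_const (fps_nth (A i l j) 0)) n" for n
        using pos by (cases n) simp_all
    qed
  qed
  have Uconst: "U l j = fps_const (fps_nth (U l j) 0) + fps_X * fps_const (fps_nth (U l j) 1)"
    if lj: "l \<in> J" "j \<in> J" for l j
  proof -
    have flat: "fps_X ^ 2 * fps_deriv (fps_const (B l j)) + mm J U (\<lambda>i j. fps_const (B i j)) l j
        - (fps_X * fps_map euler (U l j) + mm J (\<lambda>i j. fps_const (B i j)) U l j) = fps_X * fps_const (B l j)"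
      if "l \<in> J" "j \<in> J" for l j
      using that irrD_eulerD B U
      by (intro reg.curvature_matrix[OF ind irrD_reg eulerD_reg]) (simp_all add: reg_scale_def fps_to_fls_X)
    have eq: "euler (fps_nth (U l j) (Suc (Suc k))) + mm J B (\<lambda>l j. fps_nth (U l j) (Suc (Suc (Suc k)))) l j
        - mm J (\<lambda>l j. fps_nth (U l j) (Suc (Suc (Suc k)))) B l j = 0" if "l \<in> J" "j \<in> J" for l j k
      using arg_cong[OF flat[OF that], of "\<lambda>f. fps_nth f (Suc (Suc (Suc k)))"]
      by (simp add: fps_nth_mm_const_left fps_nth_mm_const_right algebra_simps)
    have 2: "fps_nth (U l j) (Suc (Suc k)) = 0" for k
      using euler_equation_unique[where X = "\<lambda>k l j. fps_nth (U l j) (Suc (Suc k))", OF nil nil eq] U0 lj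
      by simp
    show ?thesis
    proof (rule fps_ext)
      fix n
      consider "n = 0" | "n = 1" | k where "n = Suc (Suc k)"
        by (metis One_nat_def not0_implies_Suc)
      then show "fps_nth (U l j) n = fps_nth (fps_const (fps_nth (U l j) 0) + fps_X * fps_const (fps_nth (U l j) 1)) n"
        by cases (simp_all add: 2)
    qed
  qed
  show ?thesis
    unfolding normal_frame_def
  proof (intro conjI ballI)
    have "irrD (b j) = reg.lincomb J b (\<lambda>l. fps_const (fps_nth (U l j) 0) + fps_X * fps_const (fps_nth (U l j) 1))"
      if "j \<in> J" for j
      unfolding U[OF that] using that by (intro reg.lincomb_cong Uconst) simp_all
    then show "\<exists>K G. \<forall>j\<in>J. irrD (b j) = reg.lincomb J b (\<lambda>l. fps_const (K l j) + fps_X * fps_const (G l j))"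
      by (intro exI[of _ "\<lambda>l j. fps_nth (U l j) 0"] exI[of _ "\<lambda>l j. fps_nth (U l j) 1"]) simp
    fix i assume i: "i \<in> Q \<union> T"
    have "logD i (b j) = reg.lincomb J b (\<lambda>l. fps_const (fps_nth (A i l j) 0))" if "j \<in> J" for j
      unfolding A[OF i that] using that i by (intro reg.lincomb_cong Aconst) simp_all
    then show "\<exists>A. \<forall>j\<in>J. logD i (b j) = reg.lincomb J b (\<lambda>l. fps_const (A l j))"
      by (intro exI[of _ "\<lambda>l j. fps_nth (A i l j) 0"]) simp
  qed (rule f)
qed

end

section \<open>Extending the framing from the closed point\<close>

locale framing_problem = f_bundle Q T cf sc H nu nx + restricted_bundle "Q \<union> T" cf sc scb \<rho>
  for Q T :: "'i set" and cf :: "'r::comm_ring_1 \<Rightarrow> ('i \<Rightarrow>\<^sub>0 nat) \<Rightarrow> 'k::field_char_0"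
    and sc :: "'r fls \<Rightarrow> 'v::ab_group_add \<Rightarrow> 'v" and H nu nx
    and scb :: "'k fls \<Rightarrow> 'w::ab_group_add \<Rightarrow> 'w" and \<rho> :: "'v \<Rightarrow> 'w" +
  fixes fb :: "'w \<Rightarrow> 'w"
  assumes framing_b: "framing_at_b scb (\<rho> ` H) (restrict_op \<rho> nu) fb"
begin

lemma lattice_frame: "\<exists>E. frame sc H E (\<lambda>e. e)"
  using log_F by (simp add: log_F_bundle_def vector_bundle_def frame_id_iff)

lemma fb_cov: "covariant_derivative scb fls_deriv fb"
  using framing_b by (simp add: framing_at_b_def)

lemma restrict_nu: "restrict_op \<rho> nu (\<rho> v) = \<rho> (nu v)"
proof -
  obtain E where E: "frame sc H E (\<lambda>e. e)" using lattice_frame by blast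
  have "ev (fls_deriv f) = 0" if "ev f = 0" for f
  proof (rule fls_eqI)
    fix n
    have "cf (fls_nth f (n + 1)) 0 = 0" using that by (metis ev_nth fls_zero_nth)
    then show "fls_nth (ev (fls_deriv f)) n = fls_nth 0 n" by simp
  qed
  then show ?thesis by (intro restrict_op_rho[OF E nu_cov])
qed

lemma ev_theta: "i \<in> Q \<union> T \<Longrightarrow> ev (fls_X * fls_map (theta i) f) = 0"
proof -
  assume i: "i \<in> Q \<union> T"
  have "ev (fls_map (theta i) f) = 0"
    using i by (intro fls_eqI) (simp add: fls_map_nth cf_theta)
  then show ?thesis by (simp add: ev_mult)
qed

lemma restrict_logD: "i \<in> Q \<union> T \<Longrightarrow> restrict_op \<rho> (logD i) (\<rho> v) = \<rho> (logD i v)"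
proof -
  assume i: "i \<in> Q \<union> T"
  obtain E where E: "frame sc H E (\<lambda>e. e)" using lattice_frame by blast
  show ?thesis by (rule restrict_op_rho[OF E logD_cov[OF i]]) (rule ev_theta[OF i])
qed

lemma logD_Q: "i \<in> Q \<Longrightarrow> (\<lambda>v. sc fls_X (nx i v)) = logD i"
  by (simp add: logD_def chi_def fun_eq_iff)

lemma eval_fps_nth: "fps_nth (fps_map (eval_b cf) a) k = cf (fps_nth a k) 0"
  by (simp add: eval_b_def)

text \<open>
  Multiply the form \<open>u^-2 K + u^-1 G\<close> of the given framing by \<open>u\<^sup>2\<close>.
\<close>

lemma irrD_at_point:
  assumes f: "frame sc H E s" and s: "\<And>e. e \<in> E \<Longrightarrow> \<rho> (s e) = e"
    and KG: "\<forall>e\<in>E. restrict_op \<rho> nu e =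
        (\<Sum>e'\<in>E. scb (fls_X_inv ^ 2 * fls_const (K e' e) + fls_X_inv * fls_const (G e' e)) e')"
    and U: "irrD (s j) = reg.lincomb E s (\<lambda>l. U l j)" and lj: "l \<in> E" "j \<in> E" and k: "k > 1"
  shows "cf (fps_nth (U l j) k) 0 = 0"
proof -
  have ind: "base.reg.indep E (\<lambda>e. e)"
  proof -
    have "base.reg.indep E (\<lambda>e. \<rho> (s e))" by (rule base.frame_reg_indep[OF rho_frame[OF f]])
    then show ?thesis using s by (simp add: base.reg.indep_def base.reg.lincomb_def)
  qed
  have evX: "ev (fls_X ^ 2) = fls_X ^ 2"
    by (rule fls_eqI) simp
  have "base.reg.lincomb E (\<lambda>e. e) (\<lambda>l. fps_map (eval_b cf) (U l j)) = \<rho> (irrD (s j))"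
    unfolding U rho_reg_lincomb using s by (intro base.reg.lincomb_cong) simp_all
  also have "\<dots> = scb (fls_X ^ 2) (restrict_op \<rho> nu j)"
    using restrict_nu[of "s j"] s lj by (simp add: irrD_def rho_scale evX)
  also have "restrict_op \<rho> nu j = base.lincomb E (\<lambda>e. e)
      (\<lambda>e'. fls_X_inv ^ 2 * fls_const (K e' j) + fls_X_inv * fls_const (G e' j))"
    using KG lj by (simp add: base.lincomb_def)
  also have "scb (fls_X ^ 2) \<dots> = base.reg.lincomb E (\<lambda>e. e) (\<lambda>e'. fps_const (K e' j) + fps_X * fps_const (G e' j))"
    by (simp add: base.lincomb_scale base.reg_lincomb distrib_left fls_X_cancel fps_to_fls_mult fps_to_fls_X flip: mult.assoc)
  finally have "fps_map (eval_b cf) (U l j) = fps_const (K l j) + fps_X * fps_const (G l j)"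
    by (rule base.reg.lincomb_eqD[OF ind _ lj(1)])
  then have "cf (fps_nth (U l j) k) 0 = fps_nth (fps_const (K l j) + fps_X * fps_const (G l j)) k"
    by (simp flip: eval_fps_nth)
  then show ?thesis using k by (cases k) auto
qed

text \<open>
  Constants of \<open>k\<close> lift to constants of \<open>R\<close>, which are killed by \<open>x_i \<partial>/\<partial>x_i\<close>.
\<close>

lemma restrict_logD_const:
  assumes "i \<in> Q \<union> T"
  shows "restrict_op \<rho> (logD i) (base.reg.lincomb L w (\<lambda>l. fps_const (c l)))
       = (\<Sum>l\<in>L. scb (fls_const (c l)) (restrict_op \<rho> (logD i) (w l)))"
proof -
  let ?N = "restrict_op \<rho> (logD i)"
  have N: "?N (\<rho> v) = \<rho> (logD i v)" for v by (rule restrict_logD[OF assms])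
  have add: "?N (x + y) = ?N x + ?N y" for x y
  proof -
    obtain v v' where "x = \<rho> v" "y = \<rho> v'" using rho_surj by (metis surj_def)
    then show ?thesis by (simp add: N logD_add[OF assms] flip: rho_add)
  qed
  have scale: "?N (scb (fls_const c) x) = scb (fls_const c) (?N x)" for c x
  proof -
    obtain v where v: "x = \<rho> v" using rho_surj by (metis surj_def)
    have e: "ev (fls_const (cst c)) = fls_const c" by (rule fls_eqI) simp
    have "scb (fls_const c) x = \<rho> (sc (fls_const (cst c)) v)" by (simp add: v rho_scale e)
    then have "?N (scb (fls_const c) x) = \<rho> (logD i (sc (fls_const (cst c)) v))" by (simp add: N)
    also have "logD i (sc (fls_const (cst c)) v) =
        sc (fls_X * fls_map (theta i) (fls_const (cst c))) v + sc (fls_const (cst c)) (logD i v)"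
      using logD_cov[OF assms] by (simp add: covariant_derivative_def)
    also have "\<rho> \<dots> = scb (fls_const c) (?N x)"
      by (simp add: rho_add rho_scale ev_theta[OF assms] e v N)
    finally show ?thesis .
  qed
  show ?thesis
    by (simp add: base.reg_lincomb base.lincomb_def base.additive_zero_sum(2)[of ?N, OF add] scale)
qed

text \<open>
  For a component of \<open>D\<close> this is the definition of a strong framing, transported from the flat basis chosen there to
  the basis \<open>E\<close>; two flat bases differ by a matrix over \<open>k\<close>. For the other coordinates the matrix is divisible by \<open>x_i\<close>
  and vanishes at the point.
\<close>

lemma logD_at_point:
  assumes f: "frame sc H E s" and s: "\<And>e. e \<in> E \<Longrightarrow> \<rho> (s e) = e"
    and flat: "\<forall>e\<in>E. fb e = 0"
    and strong: "strong_framing Q sc nx scb \<rho> (\<rho> ` H) fb" and i: "i \<in> Q \<union> T"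
    and A: "logD i (s j) = reg.lincomb E s (\<lambda>l. A l j)" and lj: "l \<in> E" "j \<in> E" and k: "k > 0"
  shows "cf (fps_nth (A l j) k) 0 = 0"
proof (cases "i \<in> Q")
  case False
  obtain B where B: "sc fls_X (nx i (s j)) = reg.lincomb E s B"
    using frame_lattice[OF f] nx_regular[OF i] frame_in[OF f lj(2)] by blast
  have "reg.lincomb E s (\<lambda>l. fps_const (chi i) * B l) = reg_scale (fps_const (chi i)) (sc fls_X (nx i (s j)))"
    by (simp add: B reg.lincomb_scale)
  also have "\<dots> = logD i (s j)" by (simp add: reg_scale_def logD_def mult.commute)
  finally have eq: "fps_const (chi i) * B l = A l j"
    unfolding A by (rule reg.lincomb_eqD[OF frame_reg_indep[OF f] _ lj(1)])
  have "cf (coord cf i) 0 = 0"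
    using i cf_coord_mult(2)[OF i, of 0 1] by simp
  then have "cf (fps_nth (fps_const (chi i) * B l) k) 0 = 0"
    using False by (simp add: chi_def)
  then show ?thesis unfolding eq .
next
  case True
  have fE: "frame scb (\<rho> ` H) E (\<lambda>e. e)"
  proof -
    have "base.lincomb E (\<lambda>j. \<rho> (s j)) c = base.lincomb E (\<lambda>e. e) c" for c
      using s by (intro base.lincomb_cong) simp_all
    then show ?thesis using rho_frame[OF f] by (simp add: frame_def base.indep_def)
  qed
  obtain E' M where E': "bundle_basis scb (\<rho> ` H) E'" and flat': "\<forall>e\<in>E'. fb e = 0"
    and M: "\<forall>e\<in>E'. restrict_op \<rho> (logD i) e = (\<Sum>e'\<in>E'. scb (fls_const (M e' e)) e')"
    using strong True unfolding strong_framing_def logD_Q[OF True, symmetric] by blast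
  have fE': "frame scb (\<rho> ` H) E' (\<lambda>e. e)" using E' by (simp add: base.frame_id_iff)
  obtain P P' where P: "\<forall>l\<in>E'. l = base.reg.lincomb E (\<lambda>e. e) (\<lambda>j. P j l)"
    and P': "\<forall>j\<in>E. j = base.reg.lincomb E' (\<lambda>e. e) (\<lambda>l. P' l j)"
    using base.transition_matrices[OF fE fE'] by blast
  define p where "p = (\<lambda>j l. fps_nth (P j l) 0)"
  define p' where "p' = (\<lambda>l j. fps_nth (P' l j) 0)"
  have const: "fps_deriv a = 0 \<Longrightarrow> a = fps_const (fps_nth a 0)" for a :: "'k fps" by simp
  have Pc: "P j l = fps_const (p j l)" if "j \<in> E" "l \<in> E'" for j l
    unfolding p_def
    using base.flat_transition_constant[OF base.frame_reg_indep[OF fE] fb_cov, where w' = "\<lambda>e. e" and L = E' and P = P]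
      flat flat' P that by (intro const) blast
  have P'c: "P' l j = fps_const (p' l j)" if "j \<in> E" "l \<in> E'" for j l
    unfolding p'_def
    using base.flat_transition_constant[OF base.frame_reg_indep[OF fE'] fb_cov, where w' = "\<lambda>e. e" and L = E and P = P']
      flat flat' P' that by (intro const) blast
  let ?m = "mm E' (\<lambda>j l. fps_const (p j l)) (mm E' (\<lambda>i j. fps_const (M i j)) (\<lambda>l j. fps_const (p' l j)))"
  have "j = base.reg.lincomb E' (\<lambda>e. e) (\<lambda>l. P' l j)" using P' lj by blast
  also have "\<dots> = base.reg.lincomb E' (\<lambda>e. e) (\<lambda>l. fps_const (p' l j))"
    using lj by (intro base.reg.lincomb_cong) (simp_all add: P'c)
  finally have j: "j = base.reg.lincomb E' (\<lambda>e. e) (\<lambda>l. fps_const (p' l j))" .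
  have "restrict_op \<rho> (logD i) j = (\<Sum>l\<in>E'. scb (fls_const (p' l j)) (restrict_op \<rho> (logD i) l))"
    by (subst j) (rule restrict_logD_const[OF i])
  also have "\<dots> = base.reg.lincomb E' (\<lambda>l. base.reg.lincomb E' (\<lambda>e. e) (\<lambda>i. fps_const (M i l))) (\<lambda>l. fps_const (p' l j))"
    using M by (simp add: base.reg_lincomb base.lincomb_def)
  also have "\<dots> = base.reg.lincomb E' (\<lambda>e. e) (\<lambda>l. mm E' (\<lambda>i j. fps_const (M i j)) (\<lambda>l j. fps_const (p' l j)) l j)"
    by (rule base.reg.lincomb_mm)
  also have "\<dots> = base.reg.lincomb E' (\<lambda>l. base.reg.lincomb E (\<lambda>e. e) (\<lambda>j. fps_const (p j l)))
      (\<lambda>l. mm E' (\<lambda>i j. fps_const (M i j)) (\<lambda>l j. fps_const (p' l j)) l j)"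
  proof (rule base.reg.lincomb_cong)
    fix l assume l: "l \<in> E'"
    have "l = base.reg.lincomb E (\<lambda>e. e) (\<lambda>j. P j l)" using P l by blast
    also have "\<dots> = base.reg.lincomb E (\<lambda>e. e) (\<lambda>j. fps_const (p j l))"
      using l by (intro base.reg.lincomb_cong) (simp_all add: Pc)
    finally show "l = base.reg.lincomb E (\<lambda>e. e) (\<lambda>j. fps_const (p j l))" .
  qed simp
  also have "\<dots> = base.reg.lincomb E (\<lambda>e. e) (\<lambda>l. ?m l j)" by (rule base.reg.lincomb_mm)
  finally have "restrict_op \<rho> (logD i) j = base.reg.lincomb E (\<lambda>e. e) (\<lambda>l. ?m l j)" .
  moreover have "restrict_op \<rho> (logD i) j = base.reg.lincomb E (\<lambda>e. e) (\<lambda>l. fps_map (eval_b cf) (A l j))"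
  proof -
    have "restrict_op \<rho> (logD i) j = \<rho> (logD i (s j))" using restrict_logD[OF i, of "s j"] s lj by simp
    also have "\<dots> = base.reg.lincomb E (\<lambda>e. e) (\<lambda>l. fps_map (eval_b cf) (A l j))"
      unfolding A rho_reg_lincomb using s by (intro base.reg.lincomb_cong) simp_all
    finally show ?thesis .
  qed
  ultimately have "fps_map (eval_b cf) (A l j) = ?m l j"
    by (intro base.reg.lincomb_eqD[OF base.frame_reg_indep[OF fE] _ lj(1)]) simp
  then have "cf (fps_nth (A l j) k) 0 = fps_nth (?m l j) k" by (simp flip: eval_fps_nth)
  then show ?thesis using k by (simp add: fps_nth_mm_const_left) (simp add: mm_def)
qed

text \<open>
  The gauge transformation of the normal form is the identity at the closed point, so the new frame still lifts the given
  flat basis \<open>E\<close>, and the conclusions about values at the closed point apply to it as well.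
\<close>

lemma strong_imp_normal_frame:
  assumes strong: "strong_framing Q sc nx scb \<rho> (\<rho> ` H) fb"
  shows "\<exists>E s. normal_frame E s \<and> (\<forall>e\<in>E. \<rho> (s e) = e \<and> fb e = 0)"
proof -
  obtain E K G where E: "bundle_basis scb (\<rho> ` H) E" and flat: "\<forall>e\<in>E. fb e = 0"
    and KG: "\<forall>e\<in>E. restrict_op \<rho> nu e =
        (\<Sum>e'\<in>E. scb (fls_X_inv ^ 2 * fls_const (K e' e) + fls_X_inv * fls_const (G e' e)) e')"
    using framing_b unfolding framing_at_b_def by blast
  have fE: "frame scb (\<rho> ` H) E (\<lambda>e. e)" using E by (simp add: base.frame_id_iff)
  have finE: "finite E" using E by (simp add: bundle_basis_def)
  obtain s\<^sub>0 where f0: "frame sc H E s\<^sub>0" and s0: "\<And>e. e \<in> E \<Longrightarrow> \<rho> (s\<^sub>0 e) = e"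
    using lattice_frame lift_frame[OF _ fE] by blast
  have "\<forall>i\<in>Q \<union> T. \<exists>A. \<forall>j\<in>E. logD i (s\<^sub>0 j) = reg.lincomb E s\<^sub>0 (\<lambda>l. A l j)"
    using logD_matrix[OF f0] by blast
  then obtain A where A: "\<And>i j. i \<in> Q \<union> T \<Longrightarrow> j \<in> E \<Longrightarrow> logD i (s\<^sub>0 j) = reg.lincomb E s\<^sub>0 (\<lambda>l. A i l j)"
    by metis
  define A\<^sub>E where "A\<^sub>E = (\<lambda>l j. \<Sum>i\<in>Q \<union> T. A i l j)"
  have AE: "eulerD (s\<^sub>0 j) = reg.lincomb E s\<^sub>0 (\<lambda>l. A\<^sub>E l j)" if "j \<in> E" for j
    unfolding A\<^sub>E_def by (rule eulerD_matrix[OF A that])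
  have AE0: "cf (fps_nth (A\<^sub>E l j) k) 0 = 0" if "l \<in> E" "j \<in> E" "k > 0" for l j k
  proof -
    have "cf (fps_nth (A i l j) k) 0 = 0" if i: "i \<in> Q \<union> T" for i
      using logD_at_point[OF f0 s0 flat strong i, where A = "A i" and j = j] A[OF i \<open>j \<in> E\<close>]
        \<open>l \<in> E\<close> \<open>j \<in> E\<close> \<open>k > 0\<close> by blast
    then show ?thesis by (simp add: A\<^sub>E_def fps_sum_nth cf_sum)
  qed
  have nil: "nilpotent_mat E (\<lambda>a b. cf (fps_nth (A\<^sub>E a b) 0) 0)"
    by (rule euler_residue_nilpotent[OF f0 AE AE0])
  obtain g B where g0: "\<And>a b k. a \<in> E \<Longrightarrow> b \<in> E \<Longrightarrow> cf (fps_nth (g a b) k) 0 = (if a = b \<and> k = 0 then 1 else 0)"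
    and gB: "\<And>a b. a \<in> E \<Longrightarrow> b \<in> E \<Longrightarrow>
      fps_X * fps_map euler (g a b) + mm E A\<^sub>E g a b = mm E g (\<lambda>a b. fps_const (B a b)) a b"
    using normal_form_exists[OF finE nil AE0] by blast
  obtain h where h: "\<And>a b. a \<in> E \<Longrightarrow> b \<in> E \<Longrightarrow> mm E h g a b = one_mat a b \<and> mm E g h a b = one_mat a b"
    using inverse_exists[OF finE g0] by blast
  define s where "s = (\<lambda>e. reg.lincomb E s\<^sub>0 (\<lambda>j. g j e))"
  have f: "frame sc H E s"
    by (rule frame_change[OF f0 finE, where P = g and P' = h]) (simp_all add: s_def h)
  have s: "\<rho> (s e) = e" if "e \<in> E" for e
  proof -
    have "\<rho> (s e) = base.reg.lincomb E (\<lambda>e. e) (\<lambda>j. fps_map (eval_b cf) (g j e))"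
      unfolding s_def rho_reg_lincomb using s0 by (intro base.reg.lincomb_cong) simp_all
    also have "\<dots> = base.reg.lincomb E (\<lambda>e. e) (\<lambda>j. if j = e then 1 else 0)"
      using g0 that by (intro base.reg.lincomb_cong) (auto intro!: fps_ext simp: eval_b_def)
    finally show ?thesis using finE that by (simp add: base.reg.lincomb_single)
  qed
  have B: "eulerD (s j) = reg.lincomb E s (\<lambda>l. fps_const (B l j))" if "j \<in> E" for j
  proof -
    have "eulerD (s j) = reg.lincomb E s\<^sub>0 (\<lambda>i. fps_X * fps_map euler (g i j) + mm E A\<^sub>E g i j)"
      unfolding s_def by (rule reg.covariant_derivative_matrix[OF eulerD_reg AE])
    also have "\<dots> = reg.lincomb E s\<^sub>0 (\<lambda>i. mm E g (\<lambda>a b. fps_const (B a b)) i j)"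
      using that by (intro reg.lincomb_cong) (simp_all add: gB)
    also have "\<dots> = reg.lincomb E s (\<lambda>l. fps_const (B l j))"
      unfolding s_def by (rule reg.lincomb_mm[symmetric])
    finally show ?thesis .
  qed
  obtain U where U: "\<And>j. j \<in> E \<Longrightarrow> irrD (s j) = reg.lincomb E s (\<lambda>l. U l j)"
    using irrD_matrix[OF f] by blast
  have "\<forall>i\<in>Q \<union> T. \<exists>A. \<forall>j\<in>E. logD i (s j) = reg.lincomb E s (\<lambda>l. A l j)"
    using logD_matrix[OF f] by blast
  then obtain A' where A': "\<And>i j. i \<in> Q \<union> T \<Longrightarrow> j \<in> E \<Longrightarrow> logD i (s j) = reg.lincomb E s (\<lambda>l. A' i l j)"
    by metis
  have U0: "cf (fps_nth (U l j) k) 0 = 0" if "l \<in> E" "j \<in> E" "k > 1" for l j k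
    using irrD_at_point[OF f s KG, where U = U and j = j] U[OF that(2)] that by blast
  have A0: "cf (fps_nth (A' i l j) k) 0 = 0" if "i \<in> Q \<union> T" "l \<in> E" "j \<in> E" "k > 0" for i l j k
    using logD_at_point[OF f s flat strong that(1), where A = "A' i" and j = j] A'[OF that(1,3)] that(2-4)
    by blast
  have "normal_frame E s"
    by (rule normal_frame_of_constant_euler[where A = A', OF f B U U0 A' A0])
  with s flat show ?thesis by blast
qed

lemma ev_deriv: "ev (fls_deriv f) = fls_deriv (ev f)"
proof (rule fls_eqI)
  show "fls_nth (ev (fls_deriv f)) n = fls_nth (fls_deriv (ev f)) n" for n
    using cf_of_int_mult[of "n + 1" "fls_nth f (n + 1)" 0] by simp
qed

lemma framing_exists:
  assumes "strong_framing Q sc nx scb \<rho> (\<rho> ` H) fb"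
  shows "\<exists>fu fx. framing cf Q T sc H nu nx fu fx \<and> extends_framing \<rho> fu fb"
proof -
  obtain E s where n: "normal_frame E s" and s: "\<forall>e\<in>E. \<rho> (s e) = e \<and> fb e = 0"
    using strong_imp_normal_frame[OF assms] by blast
  obtain fu fx where fr: "framing cf Q T sc H nu nx fu fx"
    and fu: "\<And>c. fu (lincomb E s c) = lincomb E s (\<lambda>j. fls_deriv (c j))"
    using framing_of_normal_frame[OF n] by blast
  have rho: "\<rho> (lincomb E s c) = base.lincomb E (\<lambda>e. e) (\<lambda>j. ev (c j))" for c
    unfolding rho_lincomb using s by (intro base.lincomb_cong) simp_all
  have "fb (\<rho> v) = \<rho> (fu v)" for v
  proof -
    obtain c where v: "v = lincomb E s c" using n unfolding normal_frame_def frame_def by blast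
    have "fb (\<rho> v) = base.lincomb E (\<lambda>e. e) (\<lambda>j. fls_deriv (ev (c j)))"
      using base.covariant_derivative_lincomb[OF fb_cov, of E "\<lambda>e. e" E "\<lambda>e. e" "\<lambda>_ _. 0" "\<lambda>j. ev (c j)"] s
      by (simp add: v rho base.lincomb_zero)
    then show ?thesis by (simp add: v fu rho ev_deriv)
  qed
  with fr show ?thesis by (auto simp: extends_framing_def)
qed

text \<open>
  The restriction of a flat frame of the framing is a flat basis at the closed point, and the matrix of \<open>logD i\<close> restricts to
  its value there.
\<close>

lemma framing_imp_strong:
  assumes fr: "framing cf Q T sc H nu nx fu fx" and ext: "extends_framing \<rho> fu fb"
  shows "strong_framing Q sc nx scb \<rho> (\<rho> ` H) fb"
proof -
  obtain E where n: "normal_frame E (\<lambda>e. e)" and flat: "\<forall>e\<in>E. fu e = 0"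
    using normal_frame_of_framing[OF fr] by blast
  have f: "frame sc H E (\<lambda>e. e)" using n by (simp add: normal_frame_def)
  have fr\<rho>: "frame scb (\<rho> ` H) E \<rho>" using rho_frame[OF f] by simp
  have inj: "inj_on \<rho> E" by (rule base.frame_inj[OF fr\<rho>])
  define inv where "inv = the_inv_into E \<rho>"
  have inv: "inv (\<rho> e) = e" if "e \<in> E" for e
    using that inj by (simp add: inv_def the_inv_into_f_f)
  show ?thesis
    unfolding strong_framing_def
  proof (intro ballI)
    fix i assume i: "i \<in> Q"
    obtain A where A: "\<forall>e\<in>E. logD i e = reg.lincomb E (\<lambda>e. e) (\<lambda>l. fps_const (A l e))"
      using n i unfolding normal_frame_def by blast
    have "restrict_op \<rho> (logD i) (\<rho> e) = (\<Sum>e'\<in>\<rho> ` E. scb (fls_const (cf (A (inv e') (inv (\<rho> e))) 0)) e')"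
      if "e \<in> E" for e
    proof -
      have "restrict_op \<rho> (logD i) (\<rho> e) = \<rho> (logD i e)" using restrict_logD[of i e] i by simp
      also have "\<dots> = base.lincomb E \<rho> (\<lambda>l. fls_const (cf (A l e) 0))"
        using A that by (simp add: reg_lincomb rho_lincomb fls_map_const eval_b_def[abs_def])
      also have "\<dots> = base.lincomb (\<rho> ` E) (\<lambda>e. e) (\<lambda>e'. fls_const (cf (A (inv e') (inv (\<rho> e))) 0))"
        unfolding base.lincomb_image[OF inj] using that by (intro base.lincomb_cong) (simp_all add: inv)
      finally show ?thesis by (simp add: base.lincomb_def)
    qed
    then have mat: "\<forall>e\<in>\<rho> ` E. restrict_op \<rho> (\<lambda>v. sc fls_X (nx i v)) e =
        (\<Sum>e'\<in>\<rho> ` E. scb (fls_const (cf (A (inv e') (inv e)) 0)) e')"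
      unfolding logD_Q[OF i] by blast
    have "bundle_basis scb (\<rho> ` H) (\<rho> ` E)"
      using base.frame_image[OF fr\<rho>] by (simp add: base.frame_id_iff)
    moreover have "\<forall>e\<in>\<rho> ` E. fb e = 0" using ext flat by (auto simp: extends_framing_def)
    moreover have "\<exists>M. \<forall>e\<in>\<rho> ` E. restrict_op \<rho> (\<lambda>v. sc fls_X (nx i v)) e = (\<Sum>e'\<in>\<rho> ` E. scb (fls_const (M e' e)) e')"
      by (rule exI[of _ "\<lambda>e' e. cf (A (inv e') (inv e)) 0"]) (rule mat)
    ultimately show "\<exists>E. bundle_basis scb (\<rho> ` H) E \<and> (\<forall>e\<in>E. fb e = 0) \<and>
        (\<exists>M. \<forall>e\<in>E. restrict_op \<rho> (\<lambda>v. sc fls_X (nx i v)) e = (\<Sum>e'\<in>E. scb (fls_const (M e' e)) e'))"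
      by blast
  qed
qed

text \<open>
  The restrictions of the two flat frames are flat for the same framing at the point, so their transition matrix is constant
  there, and therefore everywhere. A connection is determined by its derivation and a frame of flat sections.
\<close>

lemma framing_unique:
  assumes fr: "framing cf Q T sc H nu nx fu fx" and ext: "extends_framing \<rho> fu fb"
    and fr': "framing cf Q T sc H nu nx fu' fx'" and ext': "extends_framing \<rho> fu' fb"
  shows "fu = fu' \<and> (\<forall>i\<in>Q \<union> T. fx i = fx' i)"
proof -
  obtain E where n: "normal_frame E (\<lambda>e. e)" and flat: "\<forall>e\<in>E. fu e = 0 \<and> (\<forall>i\<in>Q \<union> T. fx i e = 0)"
    using normal_frame_of_framing[OF fr] by blast
  obtain E' where n': "normal_frame E' (\<lambda>e. e)" and flat': "\<forall>e\<in>E'. fu' e = 0 \<and> (\<forall>i\<in>Q \<union> T. fx' i e = 0)"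
    using normal_frame_of_framing[OF fr'] by blast
  have f: "frame sc H E (\<lambda>e. e)" and f': "frame sc H E' (\<lambda>e. e)"
    using n n' by (simp_all add: normal_frame_def)
  obtain g where g: "\<And>l. l \<in> E' \<Longrightarrow> l = reg.lincomb E (\<lambda>e. e) (\<lambda>j. g j l)"
    using frame_matrix[OF f, of E' "\<lambda>e. e"] frame_in[OF f'] by blast
  have fbE: "fb (\<rho> e) = 0" if "e \<in> E" for e using ext flat that by (simp add: extends_framing_def)
  have fbE': "fb (\<rho> e) = 0" if "e \<in> E'" for e using ext' flat' that by (simp add: extends_framing_def)
  have rg: "\<rho> l = base.reg.lincomb E \<rho> (\<lambda>j. fps_map (eval_b cf) (g j l))" if "l \<in> E'" for l
    by (subst g[OF that]) (simp add: rho_reg_lincomb)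
  have "fps_deriv (fps_map (eval_b cf) (g j l)) = 0" if "j \<in> E" "l \<in> E'" for j l
    by (rule base.flat_transition_constant[OF base.frame_reg_indep[OF rho_frame[OF f]] fb_cov
          fbE fbE' rg that])
  then have g0: "cf (fps_nth (g j l) k) 0 = 0" if "j \<in> E" "l \<in> E'" "k > 0" for j l k
  proof -
    have "fps_map (eval_b cf) (g j l) = fps_const (fps_nth (fps_map (eval_b cf) (g j l)) 0)"
      using \<open>\<And>j l. j \<in> E \<Longrightarrow> l \<in> E' \<Longrightarrow> fps_deriv (fps_map (eval_b cf) (g j l)) = 0\<close>[OF that(1,2)] by simp
    then have "fps_nth (fps_map (eval_b cf) (g j l)) k = fps_nth (fps_const (fps_nth (fps_map (eval_b cf) (g j l)) 0)) k"
      by (rule arg_cong)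
    then show ?thesis using that(3) by (simp add: eval_b_def)
  qed
  have "\<exists>c. g j l = fps_const (cst c)" if "j \<in> E" "l \<in> E'" for j l
    by (rule normal_frames_transition_constant[OF n n' g g0 that])
  then obtain c where c: "\<And>j l. j \<in> E \<Longrightarrow> l \<in> E' \<Longrightarrow> g j l = fps_const (cst (c j l))" by metis
  have gc: "l = lincomb E (\<lambda>e. e) (\<lambda>j. fls_const (cst (c j l)))" if "l \<in> E'" for l
  proof -
    have "l = lincomb E (\<lambda>e. e) (\<lambda>j. fps_to_fls (g j l))" using g[OF that] by (simp add: reg_lincomb)
    also have "\<dots> = lincomb E (\<lambda>e. e) (\<lambda>j. fls_const (cst (c j l)))"
      using that by (intro lincomb_cong) (simp_all add: c)
    finally show ?thesis .
  qed
  have kill: "D l = 0" if "covariant_derivative sc \<delta> D" "\<And>e. e \<in> E \<Longrightarrow> D e = 0"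
    "\<And>c. \<delta> (fls_const (cst c)) = 0" "l \<in> E'" for \<delta> D l
    using covariant_derivative_lincomb[OF that(1), of E "\<lambda>e. e" E "\<lambda>e. e" "\<lambda>_ _. 0" "\<lambda>j. fls_const (cst (c j l))"]
      that(2,3) gc[OF that(4)] by (simp add: lincomb_zero)
  have span: "\<exists>c. v = lincomb E' (\<lambda>e. e) c" for v using f' by (simp add: frame_def)
  have cov: "covariant_derivative sc fls_deriv fu" "covariant_derivative sc fls_deriv fu'"
    "\<And>i. i \<in> Q \<union> T \<Longrightarrow> covariant_derivative sc (fls_map (pderiv_coord cf i)) (fx i)"
    "\<And>i. i \<in> Q \<union> T \<Longrightarrow> covariant_derivative sc (fls_map (pderiv_coord cf i)) (fx' i)"
    using fr fr' unfolding framing_def by simp_all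
  have "fu = fu'"
  proof (rule covariant_derivative_unique[OF cov(1,2) span])
    show "fu e = 0" if "e \<in> E'" for e using kill[OF cov(1)] flat that by simp
  qed (use flat' in simp)
  moreover have "fx i = fx' i" if i: "i \<in> Q \<union> T" for i
  proof (rule covariant_derivative_unique[OF cov(3,4)[OF i] span])
    have "fls_map (pderiv_coord cf i) (fls_const (cst c)) = 0" for c
      using i by (simp add: fls_map_const)
    then show "fx i e = 0" if "e \<in> E'" for e using kill[OF cov(3)[OF i]] flat that i by simp
  qed (use flat' i in simp)
  ultimately show ?thesis by blast
qed

end

theorem theorem1p3:
  fixes cf :: "'r::comm_ring_1 \<Rightarrow> ('i \<Rightarrow>\<^sub>0 nat) \<Rightarrow> 'k::field_char_0"
    and Q T :: "'i set"
    and sc :: "'r fls \<Rightarrow> 'v::ab_group_add \<Rightarrow> 'v"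
    and H :: "'v set"
    and nu :: "'v \<Rightarrow> 'v" and nx :: "'i \<Rightarrow> 'v \<Rightarrow> 'v"
    and scb :: "'k fls \<Rightarrow> 'w::ab_group_add \<Rightarrow> 'w"
    and \<rho> :: "'v \<Rightarrow> 'w"
    and fb :: "'w \<Rightarrow> 'w"
  assumes "power_series_coords (Q \<union> T) cf" and "Q \<inter> T = {}"
    and "log_F_bundle cf Q T sc H nu nx"
    and "restriction_map cf sc scb \<rho>"
    and "framing_at_b scb (\<rho> ` H) (restrict_op \<rho> nu) fb"
  shows "((\<exists>fu fx. framing cf Q T sc H nu nx fu fx \<and> extends_framing \<rho> fu fb) \<longleftrightarrow>
            strong_framing Q sc nx scb \<rho> (\<rho> ` H) fb) \<and>
         (\<forall>fu fx fu' fx'.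
            framing cf Q T sc H nu nx fu fx \<and> extends_framing \<rho> fu fb \<and>
            framing cf Q T sc H nu nx fu' fx' \<and> extends_framing \<rho> fu' fb \<longrightarrow>
            fu = fu' \<and> (\<forall>i\<in>Q \<union> T. fx i = fx' i))"
proof -
  have "module sc" "module scb"
    using assms(3,4) by (auto simp: log_F_bundle_def vector_bundle_def restriction_map_def)
  then interpret framing_problem Q T cf sc H nu nx scb \<rho> fb
    using assms
    by (simp add: framing_problem_def framing_problem_axioms_def f_bundle_def f_bundle_axioms_def
        restricted_bundle_def restricted_bundle_axioms_def power_series_ring_def laurent_module_def lin_module_def)
  show ?thesis
    using framing_exists framing_imp_strong framing_unique by blast
qed

end
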